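(* Let $k$ be an algebraically closed field and let $A$ be a finitely generated associative unital $k$-algebra. If $M_1, \dots, M_t$ are $A$-modules with ${\rm Ext}_A^1(M_i,M_j) = 0$ for all $i \leq j$, then ${\mathcal F}_d(M_1, \dots, M_t)$ is open in ${\rm mod}_A^d(k)$ for all $d$.
   Context: Modules are right $A$-modules. For $d\ge 1$, ${\rm mod}_A^d(k)$ is the set of $A$-module structures on $k^d$, equivalently the set of (unital) $k$-algebra homomorphisms $A \to {\rm M}_d(k)$ (the homomorphism $m$ gives the row space $k^d$ the right module structure $v\cdot a = v\,m(a)$). A homomorphism is determined by its values on a finite set of $N$ generators of $A$, and this embeds ${\rm mod}_A^d(k)$ as a Zariski closed subvariety of ${\rm M}_d(k)^N$; topological notions refer to the Zariski topology. The group ${\rm GL}_d(k)$ acts by conjugation, $(g\cdot m)(a) = g\,m(a)\,g^{-1}$, and orbits correspond to isomorphism classes of $d$-dimensional $A$-modules. For $A$-modules $M_1,\dots,M_t$, ${\mathcal F}(M_1,\dots,M_t)$ denotes the set of $A$-modules $N$ which have an increasing sequence $0 = N_0 \subseteq N_1 \subseteq \cdots \subseteq N_s = N$ of submodules such that each quotient $N_j/N_{j-1}$ is isomorphic to one of the $M_i$. ${\mathcal F}_d(M_1, \dots, M_t)$ denotes the ${\rm GL}_d(k)$-stable subset of ${\rm mod}_A^d(k)$ corresponding to the $d$-dimensional modules in ${\mathcal F}(M_1,\dots,M_t)$. *)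

theory Defs
  imports
    "HOL-Analysis.Abstract_Topology"
    "HOL-Algebra.AbelCoset"
    "HOL-Algebra.Elementary_Groups"
    "HOL-Library.FuncSet"
    "HOL-Computational_Algebra.Polynomial"
    "Jordan_Normal_Form.Matrix"
begin

section \<open>Algebras\<close>

text \<open>The sort \<open>{ring, monoid_mult}\<close> is that of associative unital rings; unlike \<open>ring_1\<close> it does
  not exclude the zero ring.\<close>

locale k_algebra = vector_space scl
  for scl :: "'k::field \<Rightarrow> 'a::{ring,monoid_mult} \<Rightarrow> 'a" +
  assumes scale_mult_left: "scl c (a * b) = scl c a * b"
    and scale_mult_right: "scl c (a * b) = a * scl c b"

definition subalgebra :: "('k::field \<Rightarrow> 'a::{ring,monoid_mult} \<Rightarrow> 'a) \<Rightarrow> 'a set \<Rightarrow> bool" where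
  "subalgebra scl S \<longleftrightarrow> 0 \<in> S \<and> 1 \<in> S \<and> (\<forall>a\<in>S. \<forall>b\<in>S. a + b \<in> S) \<and> (\<forall>a\<in>S. \<forall>b\<in>S. a * b \<in> S)
    \<and> (\<forall>c. \<forall>a\<in>S. scl c a \<in> S)"

definition generates_algebra :: "('k::field \<Rightarrow> 'a::{ring,monoid_mult} \<Rightarrow> 'a) \<Rightarrow> 'a set \<Rightarrow> bool" where
  "generates_algebra scl G \<longleftrightarrow> subalgebra scl hull G = UNIV"


section \<open>Right modules\<close>

text \<open>Modules are records with a carrier set, as in \<^theory>\<open>HOL-Algebra.Module\<close> (whose locale
  \<open>module\<close> needs a commutative ring); the fields \<open>mult\<close> and \<open>one\<close> are not used.
  The right action \<open>x \<cdot> a\<close> is written \<open>a \<odot> x\<close>, which explains the order of factors in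
  \<open>smult_assoc\<close>. Over a \<open>k\<close>-algebra the vector space structure of a module is the one
  induced by the ring action.\<close>

locale right_module = abelian_group M
  for M :: "('a::{ring,monoid_mult}, 'm, 'x) module_scheme" (structure) +
  assumes smult_closed: "x \<in> carrier M \<Longrightarrow> a \<odot> x \<in> carrier M"
    and smult_l_distr: "x \<in> carrier M \<Longrightarrow> (a + b) \<odot> x = a \<odot> x \<oplus> b \<odot> x"
    and smult_r_distr: "x \<in> carrier M \<Longrightarrow> y \<in> carrier M \<Longrightarrow> a \<odot> (x \<oplus> y) = a \<odot> x \<oplus> a \<odot> y"
    and smult_assoc: "x \<in> carrier M \<Longrightarrow> (a * b) \<odot> x = b \<odot> (a \<odot> x)"
    and smult_one: "x \<in> carrier M \<Longrightarrow> 1 \<odot> x = x"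

text \<open>Homomorphisms are extensional, so that equality of homomorphisms is equality of functions.\<close>

definition rmod_hom ::
  "('a, 'm, 'x) module_scheme \<Rightarrow> ('a, 'n, 'y) module_scheme \<Rightarrow> ('m \<Rightarrow> 'n) set" where
  "rmod_hom M N = {f \<in> carrier M \<rightarrow>\<^sub>E carrier N.
     (\<forall>x\<in>carrier M. \<forall>y\<in>carrier M. f (x \<oplus>\<^bsub>M\<^esub> y) = f x \<oplus>\<^bsub>N\<^esub> f y) \<and>
     (\<forall>a. \<forall>x\<in>carrier M. f (a \<odot>\<^bsub>M\<^esub> x) = a \<odot>\<^bsub>N\<^esub> f x)}"

definition rmod_iso ::
  "('a, 'm, 'x) module_scheme \<Rightarrow> ('a, 'n, 'y) module_scheme \<Rightarrow> bool" where
  "rmod_iso M N \<longleftrightarrow> (\<exists>f\<in>rmod_hom M N. bij_betw f (carrier M) (carrier N))"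

definition rsubmodule :: "'m set \<Rightarrow> ('a, 'm, 'x) module_scheme \<Rightarrow> bool" where
  "rsubmodule U M \<longleftrightarrow> subgroup U (add_monoid M) \<and> (\<forall>a. \<forall>x\<in>U. a \<odot>\<^bsub>M\<^esub> x \<in> U)"

text \<open>\<open>subquotient M U W\<close> is the module \<open>U / W\<close>, for submodules \<open>W \<subseteq> U\<close> of \<open>M\<close>; its elements are
  the cosets of \<open>W\<close>, with \<open>(W + x) \<cdot> a = W + x \<cdot> a\<close>.\<close>

definition subquotient :: "('a, 'm, 'x) module_scheme \<Rightarrow> 'm set \<Rightarrow> 'm set \<Rightarrow> ('a, 'm set) module" where
  "subquotient M U W = \<lparr>
     carrier = (\<lambda>x. W +>\<^bsub>M\<^esub> x) ` U,
     monoid.mult = undefined,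
     one = undefined,
     zero = W,
     add = (<+>\<^bsub>M\<^esub>),
     smult = (\<lambda>a X. \<Union>x\<in>X. W +>\<^bsub>M\<^esub> (a \<odot>\<^bsub>M\<^esub> x))\<rparr>"

definition filtered_by :: "('a, 'n, 'y) module_scheme \<Rightarrow> (nat \<Rightarrow> ('a, 'm) module) \<Rightarrow> nat \<Rightarrow> bool" where
  "filtered_by N M t \<longleftrightarrow> (\<exists>s. \<exists>F :: nat \<Rightarrow> 'n set.
     F 0 = {\<zero>\<^bsub>N\<^esub>} \<and> F s = carrier N \<and> (\<forall>j\<le>s. rsubmodule (F j) N) \<and>
     (\<forall>j\<in>{1..s}. F (j - 1) \<subseteq> F j \<and> (\<exists>i\<in>{1..t}. rmod_iso (subquotient N (F j) (F (j - 1))) (M i))))"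


section \<open>The first extension group\<close>

text \<open>\<open>Ext\<^sup>1(M, N)\<close> is the first cohomology of \<open>Hom(P\<^sub>\<bullet>, N)\<close>, where
  \<open>P\<^sub>2 \<rightarrow> P\<^sub>1 \<rightarrow> P\<^sub>0 \<rightarrow> M \<rightarrow> 0\<close> is the canonical free resolution of \<open>M\<close>: \<open>P\<^sub>0\<close> is free on the set
  \<open>M\<close>, and each further term is free on the set of elements of the preceding kernel.\<close>

definition free_rmod :: "'x set \<Rightarrow> ('a::{ring,monoid_mult}, 'x \<Rightarrow> 'a) module" where
  "free_rmod S = \<lparr>
     carrier = {f. finite {x. f x \<noteq> 0} \<and> {x. f x \<noteq> 0} \<subseteq> S},
     monoid.mult = undefined,
     one = undefined,
     zero = (\<lambda>x. 0),
     add = (\<lambda>f g x. f x + g x),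
     smult = (\<lambda>a f x. f x * a)\<rparr>"

text \<open>For \<open>S \<subseteq> carrier X\<close> this is, on \<open>free_rmod S\<close>, the homomorphism to \<open>X\<close> that extends the
  inclusion of the basis \<open>S\<close>.\<close>

definition eval_free :: "('a::{ring,monoid_mult}, 'x, 'z) module_scheme \<Rightarrow> ('x \<Rightarrow> 'a) \<Rightarrow> 'x" where
  "eval_free X f = (\<Oplus>\<^bsub>X\<^esub>x\<in>{x. f x \<noteq> 0}. f x \<odot>\<^bsub>X\<^esub> x)"

definition res0 :: "('a::{ring,monoid_mult}, 'm, 'x) module_scheme \<Rightarrow> ('a, 'm \<Rightarrow> 'a) module" where
  "res0 M = free_rmod (carrier M)"

definition res1 :: "('a::{ring,monoid_mult}, 'm, 'x) module_scheme \<Rightarrow> ('a, ('m \<Rightarrow> 'a) \<Rightarrow> 'a) module" where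
  "res1 M = free_rmod {f \<in> carrier (res0 M). eval_free M f = \<zero>\<^bsub>M\<^esub>}"

definition res2 ::
  "('a::{ring,monoid_mult}, 'm, 'x) module_scheme \<Rightarrow> ('a, (('m \<Rightarrow> 'a) \<Rightarrow> 'a) \<Rightarrow> 'a) module" where
  "res2 M = free_rmod {f \<in> carrier (res1 M). eval_free (res0 M) f = \<zero>\<^bsub>res0 M\<^esub>}"

definition Ext1_cocycles ::
  "('a::{ring,monoid_mult}, 'm, 'x) module_scheme \<Rightarrow> ('a, 'n, 'y) module_scheme
    \<Rightarrow> ((('m \<Rightarrow> 'a) \<Rightarrow> 'a) \<Rightarrow> 'n) monoid" where
  "Ext1_cocycles M N = \<lparr>
     carrier = {\<phi> \<in> rmod_hom (res1 M) N. \<forall>z\<in>carrier (res2 M). \<phi> (eval_free (res1 M) z) = \<zero>\<^bsub>N\<^esub>},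
     monoid.mult = (\<lambda>\<phi> \<psi>. \<lambda>f\<in>carrier (res1 M). \<phi> f \<oplus>\<^bsub>N\<^esub> \<psi> f),
     one = (\<lambda>f\<in>carrier (res1 M). \<zero>\<^bsub>N\<^esub>)\<rparr>"

definition Ext1_coboundaries ::
  "('a::{ring,monoid_mult}, 'm, 'x) module_scheme \<Rightarrow> ('a, 'n, 'y) module_scheme
    \<Rightarrow> ((('m \<Rightarrow> 'a) \<Rightarrow> 'a) \<Rightarrow> 'n) set" where
  "Ext1_coboundaries M N =
     (\<lambda>\<psi>. \<lambda>f\<in>carrier (res1 M). \<psi> (eval_free (res0 M) f)) ` rmod_hom (res0 M) N"

definition Ext1 ::
  "('a::{ring,monoid_mult}, 'm, 'x) module_scheme \<Rightarrow> ('a, 'n, 'y) module_scheme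
    \<Rightarrow> ((('m \<Rightarrow> 'a) \<Rightarrow> 'a) \<Rightarrow> 'n) set monoid" where
  "Ext1 M N = Ext1_cocycles M N Mod Ext1_coboundaries M N"


section \<open>The Zariski topology on tuples of matrices\<close>

definition mat_tuples :: "nat \<Rightarrow> nat \<Rightarrow> 'k mat list set" where
  "mat_tuples N d = {X. length X = N \<and> set X \<subseteq> carrier_mat d d}"

inductive_set polyfuns :: "nat \<Rightarrow> nat \<Rightarrow> ('k::field mat list \<Rightarrow> 'k) set" for N d :: nat where
  coord: "l < N \<Longrightarrow> i < d \<Longrightarrow> j < d \<Longrightarrow> (\<lambda>X. (X ! l) $$ (i, j)) \<in> polyfuns N d"
| const: "(\<lambda>X. c) \<in> polyfuns N d"
| add: "p \<in> polyfuns N d \<Longrightarrow> q \<in> polyfuns N d \<Longrightarrow> (\<lambda>X. p X + q X) \<in> polyfuns N d"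
| mult: "p \<in> polyfuns N d \<Longrightarrow> q \<in> polyfuns N d \<Longrightarrow> (\<lambda>X. p X * q X) \<in> polyfuns N d"

definition zero_locus :: "nat \<Rightarrow> nat \<Rightarrow> ('k::field mat list \<Rightarrow> 'k) set \<Rightarrow> 'k mat list set" where
  "zero_locus N d P = {X \<in> mat_tuples N d. \<forall>p\<in>P. p X = 0}"

definition zariski :: "nat \<Rightarrow> nat \<Rightarrow> 'k::field mat list topology" where
  "zariski N d = topology (\<lambda>U. \<exists>P \<subseteq> polyfuns N d. U = mat_tuples N d - zero_locus N d P)"

lemma openin_zariski:
  fixes U :: "'k::field mat list set"
  shows "openin (zariski N d) U \<longleftrightarrow> (\<exists>P \<subseteq> polyfuns N d. U = mat_tuples N d - zero_locus N d P)"
proof -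
  let ?L = "\<lambda>U :: 'k mat list set. \<exists>P \<subseteq> polyfuns N d. U = mat_tuples N d - zero_locus N d P"
  have inter: "?L (S \<inter> T)" if S: "?L S" and T: "?L T" for S T :: "'k mat list set"
  proof -
    obtain P Q where P: "P \<subseteq> polyfuns N d" "S = mat_tuples N d - zero_locus N d P"
      and Q: "Q \<subseteq> polyfuns N d" "T = mat_tuples N d - zero_locus N d Q"
      using S T by blast
    define R where "R = (\<Union>p\<in>P. (\<lambda>q X. p X * q X) ` Q)"
    have R: "(\<forall>r\<in>R. r X = 0) \<longleftrightarrow> (\<forall>p\<in>P. p X = 0) \<or> (\<forall>q\<in>Q. q X = 0)" for X
      unfolding R_def by (simp add: ball_UN)
    have "R \<subseteq> polyfuns N d"
      unfolding R_def using P(1) Q(1) by (blast intro: polyfuns.mult)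
    moreover have "S \<inter> T = mat_tuples N d - zero_locus N d R"
      unfolding P(2) Q(2) zero_locus_def R by blast
    ultimately show ?thesis by blast
  qed
  have union: "?L (\<Union>K)" if K: "\<forall>S\<in>K. ?L S" for K :: "'k mat list set set"
  proof -
    obtain P where P: "\<And>S. S \<in> K \<Longrightarrow> P S \<subseteq> polyfuns N d \<and> S = mat_tuples N d - zero_locus N d (P S)"
      using bchoice[OF K] by blast
    have "(\<Union>S\<in>K. P S) \<subseteq> polyfuns N d"
      using P by blast
    moreover have "\<Union>K = mat_tuples N d - zero_locus N d (\<Union>S\<in>K. P S)"
    proof -
      have "\<Union>K = (\<Union>S\<in>K. mat_tuples N d - zero_locus N d (P S))"
        using P by blast
      also have "\<dots> = mat_tuples N d - zero_locus N d (\<Union>S\<in>K. P S)"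
        unfolding zero_locus_def by blast
      finally show ?thesis .
    qed
    ultimately show ?thesis by blast
  qed
  have "istopology ?L"
    unfolding istopology_def by (intro conjI allI impI; rule inter union; assumption)
  then show ?thesis
    unfolding zariski_def by (simp add: topology_inverse')
qed

lemma topspace_zariski: "topspace (zariski N d) = (mat_tuples N d :: 'k::field mat list set)"
proof
  show "topspace (zariski N d) \<subseteq> (mat_tuples N d :: 'k mat list set)"
    unfolding topspace_def openin_zariski by blast
  have "openin (zariski N d) (mat_tuples N d :: 'k mat list set)"
    unfolding openin_zariski
    by (rule exI[of _ "{\<lambda>X. 1}"]) (auto simp: zero_locus_def intro: polyfuns.const)
  then show "(mat_tuples N d :: 'k mat list set) \<subseteq> topspace (zariski N d)"
    by (rule openin_subset)
qed


section \<open>Varieties of modules\<close>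

definition mod_variety ::
  "('k::field \<Rightarrow> 'a::{ring,monoid_mult} \<Rightarrow> 'a) \<Rightarrow> nat \<Rightarrow> ('a \<Rightarrow> 'k mat) set" where
  "mod_variety scl d = {m.
     (\<forall>a. m a \<in> carrier_mat d d) \<and>
     (\<forall>a b. m (a + b) = m a + m b) \<and>
     (\<forall>a b. m (a * b) = m a * m b) \<and>
     (\<forall>c a. m (scl c a) = c \<cdot>\<^sub>m m a) \<and>
     m 1 = 1\<^sub>m d}"

text \<open>The subspace topology along the embedding \<open>m \<mapsto> (m(g\<^sub>1), \<dots>, m(g\<^sub>N))\<close> into \<open>M\<^sub>d(k)\<^sup>N\<close> given by a
  list of generators.\<close>

definition mod_topology ::
  "('k::field \<Rightarrow> 'a::{ring,monoid_mult} \<Rightarrow> 'a) \<Rightarrow> 'a list \<Rightarrow> nat \<Rightarrow> ('a \<Rightarrow> 'k mat) topology" where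
  "mod_topology scl gs d =
     pullback_topology (mod_variety scl d) (\<lambda>m. map m gs) (zariski (length gs) d)"

lemma topspace_mod_topology: "topspace (mod_topology scl gs d) = mod_variety scl d"
  unfolding mod_topology_def topspace_pullback_topology topspace_zariski
  by (auto simp: mod_variety_def mat_tuples_def)

text \<open>The transpose turns the product of a matrix and a column vector into the action
  \<open>v \<cdot> a = v m(a)\<close> on row vectors.\<close>

definition row_module :: "nat \<Rightarrow> ('a \<Rightarrow> 'k::field mat) \<Rightarrow> ('a, 'k vec) module" where
  "row_module d m = \<lparr>
     carrier = carrier_vec d,
     monoid.mult = undefined,
     one = undefined,
     zero = 0\<^sub>v d,
     add = (+),
     smult = (\<lambda>a v. transpose_mat (m a) *\<^sub>v v)\<rparr>"

definition filtered_variety ::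
  "('k::field \<Rightarrow> 'a::{ring,monoid_mult} \<Rightarrow> 'a) \<Rightarrow> nat \<Rightarrow> (nat \<Rightarrow> ('a, 'm) module) \<Rightarrow> nat
    \<Rightarrow> ('a \<Rightarrow> 'k mat) set" where
  "filtered_variety scl d M t = {m \<in> mod_variety scl d. filtered_by (row_module d m) M t}"

end

theory Submission
  imports Defs "Jordan_Normal_Form.Determinant"
begin

text \<open>Filtrations are rearranged with the Ext hypothesis: a nonzero filtered module \<open>N\<close> has a nonzero
  submodule isomorphic to some \<open>M\<^sub>j\<close> such that \<open>N\<close> and the quotient are filtered by modules \<open>M\<^sub>i\<close> with
  \<open>j \<le> i\<close>. By half-exactness of Ext, \<open>Ext\<^sup>1(M\<^sub>j, N) = 0\<close>. In terms of matrices this says that the complex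
  \<open>Hom\<^sub>k(M\<^sub>j, N) \<rightarrow> Hom\<^sub>k(M\<^sub>j, N)\<^sup>r \<rightarrow> \<dots>\<close>, whose first map is the commutator with the \<open>r\<close> generators and whose
  second map collects the conditions for a tuple to come from a derivation, is exact in the middle. Its
  entries are regular functions of \<open>N\<close>, so the inclusion of \<open>M\<^sub>j\<close> extends to homomorphisms
  \<open>M\<^sub>j \<rightarrow> N'\<close> with rational entries for all \<open>N'\<close> in a neighbourhood of \<open>N\<close>. They are injective near \<open>N\<close>, the
  cokernel depends rationally on \<open>N'\<close>, and by induction on the dimension the cokernel stays filtered.\<close>

section \<open>Modules and submodules\<close>

text \<open>A homomorphism need not persist when \<open>N\<close> is perturbed: the solutions of
  \<open>p(g) H = H q(g)\<close> can become fewer nearby, because ranks may jump up. Exactness in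
  the middle forbids this. The relations that hold identically in \<open>q\<close> cut out precisely
  the image at \<open>q0\<close>, so the rank cannot grow near \<open>q0\<close>. As
  \<open>A\<close> need not be finitely presented, these relations form an infinite family, but
  elimination over finitely many unknown entries consumes only finitely many of them. The order of
  the indices enters twice: a factor of smaller index can be moved below factors of larger index,
  and once all factors of \<open>N\<close> have index at least \<open>j\<close>,
  \<open>Ext\<^sup>1(M\<^sub>j, N)\<close> vanishes, self-extensions included. The submodule is
  required to be nonzero because some \<open>M\<^sub>i\<close> may be zero and the dimension of the
  cokernel has to drop. The bottom factor keeps one fixed matrix form \<open>p\<close> throughout
  the neighbourhood; for the cokernel, the open set known in smaller dimension is pulled back along
  a map with rational entries.\<close>

context right_module
begin

lemma smult_zero: "a \<odot> \<zero> = \<zero>"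
  using smult_r_distr[of \<zero> \<zero> a] add.l_cancel_one[of "a \<odot> \<zero>" "a \<odot> \<zero>"]
  by (simp add: smult_closed)

lemma zero_smult: "x \<in> carrier M \<Longrightarrow> 0 \<odot> x = \<zero>"
  using smult_l_distr[of x 0 0] add.l_cancel_one[of "0 \<odot> x" "0 \<odot> x"]
  by (simp add: smult_closed)

lemma smult_minus_one: "x \<in> carrier M \<Longrightarrow> (- 1) \<odot> x = \<ominus> x"
proof -
  assume x: "x \<in> carrier M"
  have "(- 1) \<odot> x \<oplus> x = \<zero>"
    using smult_l_distr[OF x, of "- 1" 1] x by (simp add: smult_one zero_smult)
  then show ?thesis
    using x by (simp add: minus_equality smult_closed)
qed

text \<open>Negation is the action of \<open>- 1\<close>, so closure under the action already yields
  the inverses that \<open>subgroup\<close> asks for.\<close>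

lemma rsubmodule_iff:
  "rsubmodule U M \<longleftrightarrow> U \<subseteq> carrier M \<and> \<zero> \<in> U \<and> (\<forall>x\<in>U. \<forall>y\<in>U. x \<oplus> y \<in> U) \<and> (\<forall>a. \<forall>x\<in>U. a \<odot> x \<in> U)"
proof
  assume U: "rsubmodule U M"
  then interpret subgroup U "add_monoid M" by (simp add: rsubmodule_def)
  show "U \<subseteq> carrier M \<and> \<zero> \<in> U \<and> (\<forall>x\<in>U. \<forall>y\<in>U. x \<oplus> y \<in> U) \<and> (\<forall>a. \<forall>x\<in>U. a \<odot> x \<in> U)"
    using U subset one_closed m_closed by (auto simp: rsubmodule_def)
next
  assume U: "U \<subseteq> carrier M \<and> \<zero> \<in> U \<and> (\<forall>x\<in>U. \<forall>y\<in>U. x \<oplus> y \<in> U) \<and> (\<forall>a. \<forall>x\<in>U. a \<odot> x \<in> U)"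
  have "subgroup U (add_monoid M)"
  proof (rule add.subgroupI)
    fix x assume "x \<in> U"
    then show "\<ominus> x \<in> U"
      using U smult_minus_one by (metis subsetD)
  qed (use U in auto)
  then show "rsubmodule U M"
    using U by (simp add: rsubmodule_def)
qed

lemma rsubmoduleD:
  assumes "rsubmodule U M"
  shows "U \<subseteq> carrier M" "\<zero> \<in> U" "x \<in> U \<Longrightarrow> y \<in> U \<Longrightarrow> x \<oplus> y \<in> U"
    "x \<in> U \<Longrightarrow> a \<odot> x \<in> U" "x \<in> U \<Longrightarrow> \<ominus> x \<in> U"
  using assms smult_minus_one unfolding rsubmodule_iff by (auto, metis subsetD)

lemma rsubmodule_zero: "rsubmodule {\<zero>} M"
  unfolding rsubmodule_iff by (auto simp: smult_zero)

lemma rsubmodule_carrier: "rsubmodule (carrier M) M"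
  unfolding rsubmodule_iff by (auto simp: smult_closed)

lemma rsubmodule_coset_eq:
  assumes W: "rsubmodule W M" and x: "x \<in> carrier M" and y: "y \<in> carrier M"
  shows "W +> x = W +> y \<longleftrightarrow> x \<ominus> y \<in> W"
proof -
  interpret abelian_subgroup W M
    using W by (intro abelian_subgroupI3) (auto simp: rsubmodule_def additive_subgroup_def intro: abelian_group_axioms)
  have "W +> x = W +> y \<longleftrightarrow> x \<in> W +> y"
    using a_repr_independence[of x W y] a_rcos_self[OF x] W y by (auto simp: rsubmodule_def)
  also have "\<dots> \<longleftrightarrow> x \<ominus> y \<in> W"
    using a_rcos_module[OF y x] by (simp add: a_minus_def)
  finally show ?thesis .
qed

end

section \<open>Subquotients up to isomorphism and filtrations inside one module\<close>

definition hom_on ::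
  "('a, 'n, 'y) module_scheme \<Rightarrow> 'n set \<Rightarrow> ('a, 'm, 'z) module_scheme \<Rightarrow> ('n \<Rightarrow> 'm) \<Rightarrow> bool" where
  "hom_on N V M f \<longleftrightarrow> f ` V \<subseteq> carrier M \<and>
     (\<forall>x\<in>V. \<forall>y\<in>V. f (x \<oplus>\<^bsub>N\<^esub> y) = f x \<oplus>\<^bsub>M\<^esub> f y) \<and>
     (\<forall>a. \<forall>x\<in>V. f (a \<odot>\<^bsub>N\<^esub> x) = a \<odot>\<^bsub>M\<^esub> f x)"

text \<open>An isomorphism of \<open>V / W\<close> with \<open>M\<close>, encoded as a surjection
  from \<open>V\<close> with kernel \<open>W\<close>. In this form it can be restricted, composed
  and moved along homomorphisms without touching cosets.\<close>

definition factor ::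
  "('a, 'n, 'y) module_scheme \<Rightarrow> 'n set \<Rightarrow> 'n set \<Rightarrow> ('a, 'm, 'z) module_scheme \<Rightarrow> bool" where
  "factor N V W M \<longleftrightarrow> rsubmodule V N \<and> rsubmodule W N \<and> W \<subseteq> V \<and>
     (\<exists>f. hom_on N V M f \<and> f ` V = carrier M \<and> (\<forall>x\<in>V. f x = \<zero>\<^bsub>M\<^esub> \<longleftrightarrow> x \<in> W))"

lemma hom_onD:
  assumes "hom_on N V M f"
  shows "x \<in> V \<Longrightarrow> f x \<in> carrier M"
    "x \<in> V \<Longrightarrow> y \<in> V \<Longrightarrow> f (x \<oplus>\<^bsub>N\<^esub> y) = f x \<oplus>\<^bsub>M\<^esub> f y"
    "x \<in> V \<Longrightarrow> f (a \<odot>\<^bsub>N\<^esub> x) = a \<odot>\<^bsub>M\<^esub> f x"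
  using assms by (auto simp: hom_on_def)

lemma hom_on_zero:
  assumes "right_module N" "right_module M" "rsubmodule V N" "hom_on N V M f"
  shows "f \<zero>\<^bsub>N\<^esub> = \<zero>\<^bsub>M\<^esub>"
proof -
  interpret N: right_module N by fact
  interpret M: right_module M by fact
  have 0: "\<zero>\<^bsub>N\<^esub> \<in> V" using N.rsubmoduleD[OF assms(3)] by blast
  have "f (0 \<odot>\<^bsub>N\<^esub> \<zero>\<^bsub>N\<^esub>) = 0 \<odot>\<^bsub>M\<^esub> f \<zero>\<^bsub>N\<^esub>"
    by (rule hom_onD(3)[OF assms(4) 0])
  then show ?thesis
    using hom_onD(1)[OF assms(4) 0] by (simp add: N.smult_zero M.zero_smult)
qed

lemma hom_on_minus:
  assumes "right_module N" "right_module M" "rsubmodule V N" "hom_on N V M f" "x \<in> V"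
  shows "f (\<ominus>\<^bsub>N\<^esub> x) = \<ominus>\<^bsub>M\<^esub> f x"
proof -
  interpret N: right_module N by fact
  interpret M: right_module M by fact
  have "x \<in> carrier N" using N.rsubmoduleD[OF assms(3)] assms(5) by blast
  then show ?thesis
    using hom_onD(3)[OF assms(4,5), of "- 1"] hom_onD(1)[OF assms(4,5)]
    by (simp add: N.smult_minus_one M.smult_minus_one)
qed

text \<open>First isomorphism theorem. It is the bridge between \<open>subquotient\<close> in the
  definition of filtrations and the surjections used from here on.\<close>

lemma factor_iff_rmod_iso:
  assumes N: "right_module N" and M: "right_module M"
    and V: "rsubmodule V N" and W: "rsubmodule W N" and WV: "W \<subseteq> V"
  shows "factor N V W M \<longleftrightarrow> rmod_iso (subquotient N V W) M"
proof -
  interpret N: right_module N by fact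
  interpret M: right_module M by fact
  note VD = N.rsubmoduleD[OF V] and WD = N.rsubmoduleD[OF W]
  interpret W: abelian_subgroup W N
    using W by (intro abelian_subgroupI3)
      (auto simp: rsubmodule_def additive_subgroup_def intro: N.abelian_group_axioms)
  let ?Q = "subquotient N V W"
  have Vc: "x \<in> carrier N" if "x \<in> V" for x using VD(1) that by blast
  have carr: "carrier ?Q = (\<lambda>x. W +>\<^bsub>N\<^esub> x) ` V" by (simp add: subquotient_def)
  have add: "(W +>\<^bsub>N\<^esub> x) \<oplus>\<^bsub>?Q\<^esub> (W +>\<^bsub>N\<^esub> y) = W +>\<^bsub>N\<^esub> (x \<oplus>\<^bsub>N\<^esub> y)" if "x \<in> V" "y \<in> V" for x y
    using that Vc by (simp add: subquotient_def W.a_rcos_sum)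
  have smult: "a \<odot>\<^bsub>?Q\<^esub> (W +>\<^bsub>N\<^esub> x) = W +>\<^bsub>N\<^esub> (a \<odot>\<^bsub>N\<^esub> x)" if x: "x \<in> V" for a x
  proof -
    \<comment> \<open>The action on a coset is defined as a union over its representatives; this
      shows that all members of the union coincide.\<close>
    have *: "W +>\<^bsub>N\<^esub> (a \<odot>\<^bsub>N\<^esub> y) = W +>\<^bsub>N\<^esub> (a \<odot>\<^bsub>N\<^esub> x)" if y: "y \<in> W +>\<^bsub>N\<^esub> x" for y
    proof -
      obtain w where w: "w \<in> W" "y = w \<oplus>\<^bsub>N\<^esub> x"
        using y by (auto simp: a_r_coset_def')
      then have wc: "w \<in> carrier N" using WD(1) by blast
      have "a \<odot>\<^bsub>N\<^esub> y = a \<odot>\<^bsub>N\<^esub> w \<oplus>\<^bsub>N\<^esub> a \<odot>\<^bsub>N\<^esub> x"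
        using w wc Vc[OF x] by (simp add: N.smult_r_distr)
      then show ?thesis
        using w wc Vc[OF x] WD(4)[OF w(1)]
        by (subst N.rsubmodule_coset_eq[OF W])
          (simp_all add: N.smult_closed N.a_assoc N.r_neg a_minus_def)
    qed
    have "x \<in> W +>\<^bsub>N\<^esub> x" using W.a_rcos_self Vc[OF x] by blast
    have "(\<Union>y\<in>W +>\<^bsub>N\<^esub> x. W +>\<^bsub>N\<^esub> (a \<odot>\<^bsub>N\<^esub> y)) = W +>\<^bsub>N\<^esub> (a \<odot>\<^bsub>N\<^esub> x)"
      by (rule SUP_eq_const) (use * \<open>x \<in> W +>\<^bsub>N\<^esub> x\<close> in blast)+
    then show ?thesis
      by (simp add: subquotient_def)
  qed
  show ?thesis
  proof
    assume "factor N V W M"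
    then obtain f where f: "hom_on N V M f" "f ` V = carrier M"
      "\<And>x. x \<in> V \<Longrightarrow> f x = \<zero>\<^bsub>M\<^esub> \<longleftrightarrow> x \<in> W"
      by (auto simp: factor_def)
    note fD = hom_onD[OF f(1)]
    have feq: "f x = f y \<longleftrightarrow> W +>\<^bsub>N\<^esub> x = W +>\<^bsub>N\<^esub> y" if xy: "x \<in> V" "y \<in> V" for x y
    proof -
      have "f x = f y \<longleftrightarrow> f x \<ominus>\<^bsub>M\<^esub> f y = \<zero>\<^bsub>M\<^esub>"
        using M.add.inv_solve_right'[of "\<zero>\<^bsub>M\<^esub>" "f x" "f y"] fD(1)[OF xy(1)] fD(1)[OF xy(2)]
        by (simp add: a_minus_def)
      also have "f x \<ominus>\<^bsub>M\<^esub> f y = f (x \<ominus>\<^bsub>N\<^esub> y)"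
        using xy VD(5) fD(2) hom_on_minus[OF N M V f(1)] by (simp add: a_minus_def)
      also have "\<dots> = \<zero>\<^bsub>M\<^esub> \<longleftrightarrow> x \<ominus>\<^bsub>N\<^esub> y \<in> W"
        using f(3) xy VD(3,5) by (simp add: a_minus_def)
      finally show ?thesis
        using N.rsubmodule_coset_eq[OF W] xy Vc by blast
    qed
    \<comment> \<open>The representative is picked by \<open>SOME\<close>; \<open>feq\<close> makes
      the value independent of the pick.\<close>
    define g where "g = (\<lambda>X\<in>carrier ?Q. f (SOME x. x \<in> V \<and> X = W +>\<^bsub>N\<^esub> x))"
    have g: "g (W +>\<^bsub>N\<^esub> x) = f x" if x: "x \<in> V" for x
    proof -
      have "(SOME y. y \<in> V \<and> W +>\<^bsub>N\<^esub> x = W +>\<^bsub>N\<^esub> y) \<in> V \<and>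
        W +>\<^bsub>N\<^esub> x = W +>\<^bsub>N\<^esub> (SOME y. y \<in> V \<and> W +>\<^bsub>N\<^esub> x = W +>\<^bsub>N\<^esub> y)"
        using x by (intro someI[of "\<lambda>y. y \<in> V \<and> W +>\<^bsub>N\<^esub> x = W +>\<^bsub>N\<^esub> y"]) auto
      then show ?thesis
        using x feq by (auto simp: g_def carr)
    qed
    have "g \<in> rmod_hom ?Q M"
      unfolding rmod_hom_def
    proof (intro CollectI conjI ballI allI)
      show "g \<in> carrier ?Q \<rightarrow>\<^sub>E carrier M"
      proof (rule PiE_I)
        show "g X \<in> carrier M" if "X \<in> carrier ?Q" for X
          using that g fD(1) by (auto simp: carr)
      qed (simp add: g_def)
    next
      fix X Y assume "X \<in> carrier ?Q" "Y \<in> carrier ?Q"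
      then show "g (X \<oplus>\<^bsub>?Q\<^esub> Y) = g X \<oplus>\<^bsub>M\<^esub> g Y"
        using VD fD by (auto simp: carr add g)
    next
      fix a X assume "X \<in> carrier ?Q"
      then show "g (a \<odot>\<^bsub>?Q\<^esub> X) = a \<odot>\<^bsub>M\<^esub> g X"
        using VD fD by (auto simp: carr smult g)
    qed
    moreover have "bij_betw g (carrier ?Q) (carrier M)"
      unfolding bij_betw_def
    proof
      show "inj_on g (carrier ?Q)"
        by (rule inj_onI) (auto simp: carr g feq)
      show "g ` carrier ?Q = carrier M"
        unfolding carr image_image f(2)[symmetric] using g by (intro image_cong) auto
    qed
    ultimately show "rmod_iso ?Q M" by (auto simp: rmod_iso_def)
  next
    assume "rmod_iso ?Q M"
    then obtain g where g: "g \<in> rmod_hom ?Q M" "bij_betw g (carrier ?Q) (carrier M)"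
      by (auto simp: rmod_iso_def)
    let ?f = "\<lambda>x. g (W +>\<^bsub>N\<^esub> x)"
    have f: "hom_on N V M ?f"
      using g(1) unfolding hom_on_def rmod_hom_def
      by (auto simp flip: add smult simp: carr)
    have onto: "?f ` V = carrier M"
      using g(2) unfolding bij_betw_def carr image_image by blast
    have W0: "W +>\<^bsub>N\<^esub> \<zero>\<^bsub>N\<^esub> = W" using WD by simp
    have "?f x = \<zero>\<^bsub>M\<^esub> \<longleftrightarrow> x \<in> W" if x: "x \<in> V" for x
    proof -
      have "?f x = \<zero>\<^bsub>M\<^esub> \<longleftrightarrow> ?f x = ?f \<zero>\<^bsub>N\<^esub>"
        using hom_on_zero[OF N M V f] by simp
      also have "\<dots> \<longleftrightarrow> W +>\<^bsub>N\<^esub> x = W +>\<^bsub>N\<^esub> \<zero>\<^bsub>N\<^esub>"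
        using g(2) x VD(2) unfolding bij_betw_def carr by (metis imageI inj_on_eq_iff)
      also have "\<dots> \<longleftrightarrow> x \<in> W"
      proof -
        have "\<ominus>\<^bsub>N\<^esub> \<zero>\<^bsub>N\<^esub> = \<zero>\<^bsub>N\<^esub>" by (rule N.minus_equality) simp_all
        then have "x \<ominus>\<^bsub>N\<^esub> \<zero>\<^bsub>N\<^esub> = x" using Vc[OF x] by (simp only: a_minus_def N.r_zero)
        then show ?thesis using N.rsubmodule_coset_eq[OF W Vc[OF x] N.zero_closed] by (simp only:)
      qed
      finally show ?thesis .
    qed
    then show "factor N V W M"
      using V W WV f onto by (auto simp: factor_def)
  qed
qed

text \<open>The variable lower end \<open>U\<close> expresses filtrations of \<open>V / U\<close>
  without forming a quotient module, and \<open>J\<close> records which indices may occur, on which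
  the Ext hypothesis depends.\<close>

inductive chain ::
  "('a, 'n, 'y) module_scheme \<Rightarrow> (nat \<Rightarrow> ('a, 'm, 'z) module_scheme) \<Rightarrow> nat set \<Rightarrow> 'n set \<Rightarrow> 'n set \<Rightarrow> bool"
  for N M J U where
  base: "rsubmodule U N \<Longrightarrow> chain N M J U U"
| step: "chain N M J U V \<Longrightarrow> i \<in> J \<Longrightarrow> factor N V' V (M i) \<Longrightarrow> chain N M J U V'"

lemma chain_rsubmodule:
  "chain N M J U V \<Longrightarrow> rsubmodule U N \<and> rsubmodule V N \<and> U \<subseteq> V"
  by (induction rule: chain.induct) (auto simp: factor_def)

lemma chain_mono: "chain N M J U V \<Longrightarrow> J \<subseteq> J' \<Longrightarrow> chain N M J' U V"
  by (induction rule: chain.induct) (auto intro: chain.intros)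

text \<open>The rule \<open>step\<close> grows a filtration at the top. Growth at the bottom is what
  puts the image of \<open>M\<^sub>j\<close> under the pulled back filtration of the
  cokernel.\<close>

lemma chain_prepend:
  assumes "chain N M J U V" "i \<in> J" "factor N U U' (M i)"
  shows "chain N M J U' V"
  using assms
proof (induction rule: chain.induct)
  case base
  have "rsubmodule U' N" using base.prems(2) by (simp add: factor_def)
  show ?case by (rule chain.step[of N M J U' U' i]) (use \<open>rsubmodule U' N\<close> base.prems in \<open>auto intro: chain.base\<close>)
next
  case (step V i V')
  show ?case by (rule chain.step[OF step.IH[OF step.prems] step.hyps(2,3)])
qed

lemma filtered_by_iff_chain:
  fixes N :: "('a::{ring,monoid_mult}, 'n, 'y) module_scheme" and M :: "nat \<Rightarrow> ('a, 'm) module"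
  assumes N: "right_module N" and M: "\<And>i. i \<in> {1..t} \<Longrightarrow> right_module (M i)"
  shows "filtered_by N M t \<longleftrightarrow> chain N M {1..t} {\<zero>\<^bsub>N\<^esub>} (carrier N)"
proof -
  let ?P = "\<lambda>U V s (F :: nat \<Rightarrow> 'n set). F 0 = U \<and> F s = V \<and> (\<forall>j\<le>s. rsubmodule (F j) N) \<and>
     (\<forall>j\<in>{1..s}. F (j - 1) \<subseteq> F j \<and> (\<exists>i\<in>{1..t}. rmod_iso (subquotient N (F j) (F (j - 1))) (M i)))"
  have 1: "chain N M {1..t} U V" if "?P U V s F" for U V s F
  proof -
    have F: "F 0 = U" "F s = V" "\<And>j. j \<le> s \<Longrightarrow> rsubmodule (F j) N"
      "\<And>j. j \<in> {1..s} \<Longrightarrow> F (j - 1) \<subseteq> F j \<and> (\<exists>i\<in>{1..t}. rmod_iso (subquotient N (F j) (F (j - 1))) (M i))"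
      using that by blast+
    have "chain N M {1..t} U (F j)" if "j \<le> s" for j
      using that
    proof (induction j)
      case 0
      show ?case using F(3)[of 0] F(1) by (simp add: chain.base)
    next
      case (Suc j)
      have "F (Suc j - 1) \<subseteq> F (Suc j) \<and> (\<exists>i\<in>{1..t}. rmod_iso (subquotient N (F (Suc j)) (F (Suc j - 1))) (M i))"
        using Suc.prems by (intro F(4)) simp
      then obtain i where i: "i \<in> {1..t}" "rmod_iso (subquotient N (F (Suc j)) (F j)) (M i)" "F j \<subseteq> F (Suc j)"
        by auto
      have "factor N (F (Suc j)) (F j) (M i)"
        using factor_iff_rmod_iso[OF N M[OF i(1)] F(3) F(3)] i Suc.prems by simp
      moreover have "chain N M {1..t} U (F j)" using Suc by simp
      ultimately show ?case using chain.step i(1) by metis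
    qed
    from this[of s] show ?thesis using F(2) by simp
  qed
  have 2: "\<exists>s F. ?P U V s F" if "chain N M {1..t} U V" for U V
    using that
  proof (induction rule: chain.induct)
    case base
    then show ?case by (intro exI[of _ 0] exI[of _ "\<lambda>_. U"]) auto
  next
    case (step V i V')
    obtain s F where F: "?P U V s F"
      using step.IH by (elim exE) (rule that)
    have i: "rsubmodule V' N" "V \<subseteq> V'" "rmod_iso (subquotient N V' V) (M i)"
      using step.hyps(3) factor_iff_rmod_iso[OF N M[OF step.hyps(2)], of V' V] by (auto simp: factor_def)
    let ?F = "F(Suc s := V')"
    have "?F (j - 1) \<subseteq> ?F j \<and> (\<exists>i\<in>{1..t}. rmod_iso (subquotient N (?F j) (?F (j - 1))) (M i))"
      if "j \<in> {1..Suc s}" for j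
    proof (cases "j = Suc s")
      case True
      then show ?thesis using i F step.hyps(2) by auto
    next
      case False
      then have "j \<in> {1..s}" "j - 1 \<noteq> Suc s" using that by auto
      then show ?thesis using F False by simp
    qed
    moreover have "rsubmodule (?F j) N" if "j \<le> Suc s" for j
      using that F i(1) by auto
    ultimately show ?case
      using F by (intro exI[of _ "Suc s"] exI[of _ ?F]) simp
  qed
  show ?thesis
    unfolding filtered_by_def
    by (rule iffI, elim exE, rule 1, assumption, rule 2)
qed

section \<open>Extensions that split\<close>

definition lin :: "('a::{ring,monoid_mult}, 'x, 'z) module_scheme \<Rightarrow> ('s \<Rightarrow> 'x) \<Rightarrow> ('s \<Rightarrow> 'a) \<Rightarrow> 'x" where
  "lin X \<sigma> f = (\<Oplus>\<^bsub>X\<^esub>s\<in>{s. f s \<noteq> 0}. f s \<odot>\<^bsub>X\<^esub> \<sigma> s)"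

lemma eval_free_eq_lin: "eval_free X = lin X (\<lambda>x. x)"
  by (simp add: fun_eq_iff eval_free_def lin_def)

context right_module
begin

lemma lin_superset:
  assumes "finite S" "{s. f s \<noteq> 0} \<subseteq> S" "\<And>s. s \<in> S \<Longrightarrow> \<sigma> s \<in> carrier M"
  shows "lin M \<sigma> f = (\<Oplus>s\<in>S. f s \<odot> \<sigma> s)"
  unfolding lin_def
  by (rule add.finprod_mono_neutral_cong_left)
    (use assms in \<open>auto simp: zero_smult smult_closed\<close>)

lemma lin_closed:
  assumes "\<And>s. f s \<noteq> 0 \<Longrightarrow> \<sigma> s \<in> carrier M"
  shows "lin M \<sigma> f \<in> carrier M"
  unfolding lin_def using assms by (intro finsum_closed) (auto simp: smult_closed)

lemma lin_add:
  assumes "finite {s. f s \<noteq> 0}" "finite {s. g s \<noteq> 0}"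
    and "\<And>s. f s \<noteq> 0 \<Longrightarrow> \<sigma> s \<in> carrier M" "\<And>s. g s \<noteq> 0 \<Longrightarrow> \<sigma> s \<in> carrier M"
  shows "lin M \<sigma> (\<lambda>s. f s + g s) = lin M \<sigma> f \<oplus> lin M \<sigma> g"
proof -
  let ?S = "{s. f s \<noteq> 0} \<union> {s. g s \<noteq> 0}"
  have S: "finite ?S" "\<And>s. s \<in> ?S \<Longrightarrow> \<sigma> s \<in> carrier M" using assms by auto
  have "lin M \<sigma> (\<lambda>s. f s + g s) = (\<Oplus>s\<in>?S. (f s + g s) \<odot> \<sigma> s)"
    using S by (intro lin_superset) auto
  also have "\<dots> = (\<Oplus>s\<in>?S. f s \<odot> \<sigma> s \<oplus> g s \<odot> \<sigma> s)"
    using S by (intro finsum_cong') (auto simp: smult_l_distr smult_closed)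
  also have "\<dots> = (\<Oplus>s\<in>?S. f s \<odot> \<sigma> s) \<oplus> (\<Oplus>s\<in>?S. g s \<odot> \<sigma> s)"
    using S by (intro finsum_addf) (auto simp: smult_closed)
  also have "(\<Oplus>s\<in>?S. f s \<odot> \<sigma> s) = lin M \<sigma> f"
    using S by (intro lin_superset[symmetric]) auto
  also have "(\<Oplus>s\<in>?S. g s \<odot> \<sigma> s) = lin M \<sigma> g"
    using S by (intro lin_superset[symmetric]) auto
  finally show ?thesis .
qed

lemma smult_finsum:
  assumes "\<And>s. s \<in> S \<Longrightarrow> g s \<in> carrier M"
  shows "a \<odot> (\<Oplus>s\<in>S. g s) = (\<Oplus>s\<in>S. a \<odot> g s)"
  using assms
  by (induction S rule: infinite_finite_induct)
    (auto simp: smult_zero smult_r_distr smult_closed Pi_iff finsum_infinite finsum_insert finsum_closed)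

lemma lin_smult:
  assumes "finite {s. f s \<noteq> 0}" and "\<And>s. f s \<noteq> 0 \<Longrightarrow> \<sigma> s \<in> carrier M"
  shows "lin M \<sigma> (\<lambda>s. f s * a) = a \<odot> lin M \<sigma> f"
proof -
  have "lin M \<sigma> (\<lambda>s. f s * a) = (\<Oplus>s\<in>{s. f s \<noteq> 0}. (f s * a) \<odot> \<sigma> s)"
    using assms by (intro lin_superset) auto
  also have "\<dots> = (\<Oplus>s\<in>{s. f s \<noteq> 0}. a \<odot> (f s \<odot> \<sigma> s))"
    using assms by (intro finsum_cong') (auto simp: smult_assoc smult_closed)
  also have "\<dots> = a \<odot> lin M \<sigma> f"
    unfolding lin_def using assms by (intro smult_finsum[symmetric]) (auto simp: smult_closed)
  finally show ?thesis .
qed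

lemma lin_single:
  assumes "\<sigma> x \<in> carrier M"
  shows "lin M \<sigma> (\<lambda>s. if s = x then 1 else 0) = \<sigma> x"
proof -
  have "lin M \<sigma> (\<lambda>s. if s = x then 1 else 0) = (\<Oplus>s\<in>{x}. (if s = x then 1 else 0) \<odot> \<sigma> s)"
    using assms by (intro lin_superset) auto
  also have "\<dots> = \<sigma> x"
    using assms by (simp add: smult_one)
  finally show ?thesis .
qed

lemma lin_in_rsubmodule:
  assumes "rsubmodule V M" "finite {s. f s \<noteq> 0}" "\<And>s. f s \<noteq> 0 \<Longrightarrow> \<sigma> s \<in> V"
  shows "lin M \<sigma> f \<in> V"
proof -
  note VD = rsubmoduleD[OF assms(1)]
  have "(\<Oplus>s\<in>S. f s \<odot> \<sigma> s) \<in> V" if "finite S" "\<And>s. s \<in> S \<Longrightarrow> \<sigma> s \<in> V" for S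
    using that
  proof (induction S)
    case (insert x S)
    then have "(\<Oplus>s\<in>insert x S. f s \<odot> \<sigma> s) = f x \<odot> \<sigma> x \<oplus> (\<Oplus>s\<in>S. f s \<odot> \<sigma> s)"
      using VD(1) by (intro finsum_insert) (auto intro!: smult_closed)
    then show ?case using insert VD by simp
  qed (use VD in auto)
  then show ?thesis unfolding lin_def using assms by auto
qed

end

lemma hom_on_lin:
  assumes N: "right_module N" and M: "right_module M" and V: "rsubmodule V N" and h: "hom_on N V M h"
    and "finite {s. f s \<noteq> 0}" "\<And>s. f s \<noteq> 0 \<Longrightarrow> \<sigma> s \<in> V"
  shows "h (lin N \<sigma> f) = lin M (\<lambda>s. h (\<sigma> s)) f"
proof -
  interpret N: right_module N by fact
  interpret M: right_module M by fact
  note VD = N.rsubmoduleD[OF V] and hD = hom_onD[OF h]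
  have "(\<Oplus>\<^bsub>N\<^esub>s\<in>S. f s \<odot>\<^bsub>N\<^esub> \<sigma> s) \<in> V \<and>
      h (\<Oplus>\<^bsub>N\<^esub>s\<in>S. f s \<odot>\<^bsub>N\<^esub> \<sigma> s) = (\<Oplus>\<^bsub>M\<^esub>s\<in>S. f s \<odot>\<^bsub>M\<^esub> h (\<sigma> s))"
    if "finite S" "\<And>s. s \<in> S \<Longrightarrow> \<sigma> s \<in> V" for S
    using that
  proof (induction S)
    case (insert x S)
    have 1: "(\<Oplus>\<^bsub>N\<^esub>s\<in>insert x S. f s \<odot>\<^bsub>N\<^esub> \<sigma> s) = f x \<odot>\<^bsub>N\<^esub> \<sigma> x \<oplus>\<^bsub>N\<^esub> (\<Oplus>\<^bsub>N\<^esub>s\<in>S. f s \<odot>\<^bsub>N\<^esub> \<sigma> s)"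
      using insert VD(1) by (intro N.finsum_insert) (auto intro!: N.smult_closed)
    have 2: "(\<Oplus>\<^bsub>M\<^esub>s\<in>insert x S. f s \<odot>\<^bsub>M\<^esub> h (\<sigma> s)) = f x \<odot>\<^bsub>M\<^esub> h (\<sigma> x) \<oplus>\<^bsub>M\<^esub> (\<Oplus>\<^bsub>M\<^esub>s\<in>S. f s \<odot>\<^bsub>M\<^esub> h (\<sigma> s))"
      using insert hD(1) by (intro M.finsum_insert) (auto intro!: M.smult_closed)
    show ?case using insert VD(3,4) hD unfolding 1 2 by simp
  qed (use VD hom_on_zero[OF N M V h] in auto)
  then show ?thesis unfolding lin_def using assms by auto
qed

lemma right_module_free_rmod:
  "right_module (free_rmod S :: ('a::{ring,monoid_mult}, 'x \<Rightarrow> 'a) module)"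
proof -
  let ?F = "free_rmod S :: ('a, 'x \<Rightarrow> 'a) module"
  have supp_add: "{x. f x + g x \<noteq> 0} \<subseteq> {x. f x \<noteq> 0} \<union> {x. g x \<noteq> 0}" for f g :: "'x \<Rightarrow> 'a"
    by auto
  have supp_mult: "{x. f x * a \<noteq> 0} \<subseteq> {x. f x \<noteq> 0}" for f :: "'x \<Rightarrow> 'a" and a
    by auto
  have "abelian_group ?F"
  proof (rule abelian_groupI)
    fix f g assume "f \<in> carrier ?F" "g \<in> carrier ?F"
    then show "f \<oplus>\<^bsub>?F\<^esub> g \<in> carrier ?F"
      using supp_add[of f g] by (auto simp: free_rmod_def intro: finite_subset)
  next
    fix f assume "f \<in> carrier ?F"
    then show "\<exists>g\<in>carrier ?F. g \<oplus>\<^bsub>?F\<^esub> f = \<zero>\<^bsub>?F\<^esub>"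
      by (intro bexI[of _ "\<lambda>x. - f x"]) (auto simp: free_rmod_def)
  qed (auto simp: free_rmod_def add_ac)
  then interpret abelian_group ?F .
  show ?thesis
  proof unfold_locales
    fix f a assume "f \<in> carrier ?F"
    then show "a \<odot>\<^bsub>?F\<^esub> f \<in> carrier ?F"
      using supp_mult[of f a] by (auto simp: free_rmod_def intro: finite_subset)
  qed (auto simp: free_rmod_def algebra_simps)
qed

lemma free_rmod_simps:
  "f \<in> carrier (free_rmod S) \<longleftrightarrow> finite {x. f x \<noteq> 0} \<and> {x. f x \<noteq> 0} \<subseteq> S"
  "\<zero>\<^bsub>free_rmod S\<^esub> = (\<lambda>x. 0)"
  "f \<oplus>\<^bsub>free_rmod S\<^esub> g = (\<lambda>x. f x + g x)"
  "a \<odot>\<^bsub>free_rmod S\<^esub> f = (\<lambda>x. f x * a)"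
  by (simp_all add: free_rmod_def)

lemma single_in_free_rmod: "x \<in> S \<Longrightarrow> (\<lambda>s. if s = x then 1 else 0) \<in> carrier (free_rmod S)"
  by (auto simp: free_rmod_simps intro: finite_subset[of _ "{x}"])

text \<open>Universal property of the free module: \<open>lin X \<sigma>\<close> takes the
  prescribed values \<open>\<sigma>\<close> on the basis.\<close>

lemma hom_on_lin_free:
  assumes "right_module X" "\<sigma> ` S \<subseteq> carrier X"
  shows "hom_on (free_rmod S) (carrier (free_rmod S)) X (lin X \<sigma>)"
proof -
  interpret right_module X by fact
  show ?thesis
    unfolding hom_on_def
    using assms(2) by (auto simp: free_rmod_simps lin_add lin_smult subset_iff intro!: lin_closed)
qed

section \<open>Splitting and reordering of filtrations by vanishing of Ext\<close>

lemma Ext1_trivial_cocycle: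
  assumes "trivial_group (Ext1 X Z)" and Z: "right_module Z" and "\<phi> \<in> carrier (Ext1_cocycles X Z)"
  shows "\<exists>\<psi>\<in>rmod_hom (res0 X) Z. \<phi> = (\<lambda>f\<in>carrier (res1 X). \<psi> (eval_free (res0 X) f))"
proof -
  interpret Z: right_module Z by fact
  let ?C = "Ext1_cocycles X Z" and ?B = "Ext1_coboundaries X Z"
  let ?z = "\<lambda>f\<in>carrier (res0 X). \<zero>\<^bsub>Z\<^esub>"
  interpret P0: right_module "res0 X" by (simp add: res0_def right_module_free_rmod)
  have eval: "eval_free (res0 X) f \<in> carrier (res0 X)" if "f \<in> carrier (res1 X)" for f
    using that unfolding eval_free_eq_lin res1_def free_rmod_simps
    by (intro P0.lin_closed) auto
  have one: "one ?C \<in> ?B"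
  proof -
    have "?z \<in> rmod_hom (res0 X) Z"
      by (auto simp: rmod_hom_def P0.smult_closed Z.smult_zero)
    moreover have "one ?C = (\<lambda>f\<in>carrier (res1 X). ?z (eval_free (res0 X) f))"
      using eval by (auto simp: Ext1_cocycles_def)
    ultimately show ?thesis unfolding Ext1_coboundaries_def by blast
  qed
  \<comment> \<open>In the trivial quotient every coset equals the set of coboundaries. The cocycle
    lies in its own coset because the zero map is a coboundary, so it is a coboundary
    itself.\<close>
  have "?B #>\<^bsub>?C\<^esub> \<phi> \<in> carrier (Ext1 X Z)"
    using assms(3) by (auto simp: Ext1_def FactGroup_def RCOSETS_def)
  then have "?B #>\<^bsub>?C\<^esub> \<phi> = ?B"
    using assms(1) by (simp add: trivial_group_def Ext1_def FactGroup_def)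
  moreover have "one ?C \<otimes>\<^bsub>?C\<^esub> \<phi> \<in> ?B #>\<^bsub>?C\<^esub> \<phi>"
    using one by (auto simp: r_coset_def)
  moreover have "one ?C \<otimes>\<^bsub>?C\<^esub> \<phi> = \<phi>"
    using assms(3) by (auto simp: Ext1_cocycles_def rmod_hom_def fun_eq_iff PiE_def extensional_def Pi_iff)
  ultimately have "\<phi> \<in> ?B" by simp
  then show ?thesis unfolding Ext1_coboundaries_def by blast
qed

lemma rsubmodule_kernel:
  assumes N: "right_module N" and M: "right_module M" and V: "rsubmodule V N" and h: "hom_on N V M h"
  shows "rsubmodule {x \<in> V. h x = \<zero>\<^bsub>M\<^esub>} N"
proof -
  interpret N: right_module N by fact
  interpret M: right_module M by fact
  show ?thesis
    using N.rsubmoduleD[OF V] hom_onD[OF h] hom_on_zero[OF N M V h] M.smult_zero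
    unfolding N.rsubmodule_iff by auto
qed

lemma hom_on_subset: "hom_on N V M h \<Longrightarrow> U \<subseteq> V \<Longrightarrow> hom_on N U M h"
  unfolding hom_on_def by blast

text \<open>Second isomorphism theorem for \<open>Y = U + V\<close>: the component in
  \<open>V\<close> of an element of \<open>Y\<close> is determined up to
  \<open>U \<inter> V\<close>, which is the kernel of the given surjection.\<close>

lemma factor_sum:
  assumes N: "right_module N" and Z: "right_module Z"
    and U: "rsubmodule U N" and Y: "rsubmodule Y N" and UY: "U \<subseteq> Y"
    and sum: "\<And>y. y \<in> Y \<Longrightarrow> \<exists>u\<in>U. \<exists>v\<in>V. y = u \<oplus>\<^bsub>N\<^esub> v"
    and fac: "factor N V (U \<inter> V) Z" and VY: "V \<subseteq> Y"
  shows "factor N Y U Z"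
proof -
  interpret N: right_module N by fact
  interpret Z: right_module Z by fact
  have V: "rsubmodule V N" using fac by (simp add: factor_def)
  obtain \<rho> where \<rho>: "hom_on N V Z \<rho>" "\<rho> ` V = carrier Z" "\<And>x. x \<in> V \<Longrightarrow> \<rho> x = \<zero>\<^bsub>Z\<^esub> \<longleftrightarrow> x \<in> U \<inter> V"
    using fac by (auto simp: factor_def)
  note UD = N.rsubmoduleD[OF U] and VD = N.rsubmoduleD[OF V] and YD = N.rsubmoduleD[OF Y]
  note \<rho>D = hom_onD[OF \<rho>(1)]
  have Uc: "x \<in> carrier N" if "x \<in> U" for x using UD(1) that by blast
  have Vc: "x \<in> carrier N" if "x \<in> V" for x using VD(1) that by blast
  have wd: "\<rho> v = \<rho> v'" if *: "u \<in> U" "u' \<in> U" "v \<in> V" "v' \<in> V" "u \<oplus>\<^bsub>N\<^esub> v = u' \<oplus>\<^bsub>N\<^esub> v'" for u v u' v'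
  proof -
    have "v \<ominus>\<^bsub>N\<^esub> v' = \<ominus>\<^bsub>N\<^esub> u \<oplus>\<^bsub>N\<^esub> (u \<oplus>\<^bsub>N\<^esub> v) \<ominus>\<^bsub>N\<^esub> v'"
      using *(1-4) Uc Vc by (simp add: N.r_neg1)
    also have "\<dots> = \<ominus>\<^bsub>N\<^esub> u \<oplus>\<^bsub>N\<^esub> u'"
      using *(1-4) Uc Vc unfolding *(5) by (simp add: a_minus_def N.a_assoc N.r_neg)
    finally have "v \<ominus>\<^bsub>N\<^esub> v' \<in> U \<inter> V"
      using * UD(3,5) VD(3,5) by (metis IntI a_minus_def)
    then have "\<rho> (v \<ominus>\<^bsub>N\<^esub> v') = \<zero>\<^bsub>Z\<^esub>" using \<rho>(3) by blast
    moreover have "\<rho> v = \<rho> ((v \<ominus>\<^bsub>N\<^esub> v') \<oplus>\<^bsub>N\<^esub> v')"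
      using * Vc by (simp add: a_minus_def N.a_assoc N.l_neg)
    moreover have "\<dots> = \<rho> (v \<ominus>\<^bsub>N\<^esub> v') \<oplus>\<^bsub>Z\<^esub> \<rho> v'"
      using * VD(3,5) by (intro \<rho>D(2)) (auto simp: a_minus_def)
    ultimately show ?thesis using \<rho>D(1)[OF *(4)] by simp
  qed
  define \<theta> where "\<theta> y = \<rho> (SOME v. v \<in> V \<and> (\<exists>u\<in>U. y = u \<oplus>\<^bsub>N\<^esub> v))" for y
  have \<theta>: "\<theta> (u \<oplus>\<^bsub>N\<^esub> v) = \<rho> v" if uv: "u \<in> U" "v \<in> V" for u v
  proof -
    let ?w = "SOME w. w \<in> V \<and> (\<exists>x\<in>U. u \<oplus>\<^bsub>N\<^esub> v = x \<oplus>\<^bsub>N\<^esub> w)"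
    have "?w \<in> V \<and> (\<exists>x\<in>U. u \<oplus>\<^bsub>N\<^esub> v = x \<oplus>\<^bsub>N\<^esub> ?w)"
      by (rule someI[of _ v]) (use uv in blast)
    then obtain x where "x \<in> U" "?w \<in> V" "u \<oplus>\<^bsub>N\<^esub> v = x \<oplus>\<^bsub>N\<^esub> ?w"
      by (elim conjE bexE)
    then show ?thesis unfolding \<theta>_def using wd[of x u ?w v] uv by simp
  qed
  have "hom_on N Y Z \<theta>"
    unfolding hom_on_def
  proof (intro conjI ballI allI)
    show "\<theta> ` Y \<subseteq> carrier Z"
      using sum \<theta> \<rho>D(1) by (metis image_subsetI)
  next
    fix x y assume "x \<in> Y" "y \<in> Y"
    then obtain u v u' v' where *: "u \<in> U" "v \<in> V" "x = u \<oplus>\<^bsub>N\<^esub> v" "u' \<in> U" "v' \<in> V" "y = u' \<oplus>\<^bsub>N\<^esub> v'"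
      using sum by metis
    have "x \<oplus>\<^bsub>N\<^esub> y = (u \<oplus>\<^bsub>N\<^esub> u') \<oplus>\<^bsub>N\<^esub> (v \<oplus>\<^bsub>N\<^esub> v')"
      using * Uc Vc by (simp add: N.a_ac)
    then show "\<theta> (x \<oplus>\<^bsub>N\<^esub> y) = \<theta> x \<oplus>\<^bsub>Z\<^esub> \<theta> y"
      using * \<theta> UD(3) VD(3) \<rho>D(2) by simp
  next
    fix a x assume "x \<in> Y"
    then obtain u v where *: "u \<in> U" "v \<in> V" "x = u \<oplus>\<^bsub>N\<^esub> v"
      using sum by metis
    have "a \<odot>\<^bsub>N\<^esub> x = a \<odot>\<^bsub>N\<^esub> u \<oplus>\<^bsub>N\<^esub> a \<odot>\<^bsub>N\<^esub> v"
      using * Uc Vc by (simp add: N.smult_r_distr)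
    then show "\<theta> (a \<odot>\<^bsub>N\<^esub> x) = a \<odot>\<^bsub>Z\<^esub> \<theta> x"
      using * \<theta> UD(4) VD(4) \<rho>D(3) by simp
  qed
  moreover have "\<theta> ` Y = carrier Z"
  proof
    show "\<theta> ` Y \<subseteq> carrier Z"
      using sum \<theta> \<rho>D(1) by (metis image_subsetI)
    show "carrier Z \<subseteq> \<theta> ` Y"
    proof
      fix z assume "z \<in> carrier Z"
      then obtain v where "v \<in> V" "z = \<rho> v" using \<rho>(2) by blast
      then have "z = \<theta> v" "v \<in> Y" using \<theta>[OF UD(2), of v] Vc VY by auto
      then show "z \<in> \<theta> ` Y" by blast
    qed
  qed
  moreover have "\<theta> y = \<zero>\<^bsub>Z\<^esub> \<longleftrightarrow> y \<in> U" if y: "y \<in> Y" for y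
  proof -
    obtain u v where *: "u \<in> U" "v \<in> V" "y = u \<oplus>\<^bsub>N\<^esub> v"
      using sum[OF y] by blast
    have "v = \<ominus>\<^bsub>N\<^esub> u \<oplus>\<^bsub>N\<^esub> y" using * Uc Vc by (simp add: N.r_neg1)
    then have "v \<in> U \<longleftrightarrow> y \<in> U"
      using * UD(3,5) by metis
    then show ?thesis using * \<theta> \<rho>(3) by simp
  qed
  ultimately show ?thesis
    using U Y UY by (auto simp: factor_def)
qed

text \<open>The extension of \<open>X\<close> by \<open>Z\<close> between \<open>W\<close> and
  \<open>Y\<close> defines a cocycle on the free resolution: lift the generators of
  \<open>P0\<close> to \<open>Y\<close> and measure in \<open>Z\<close> how the relations fail. A
  trivialisation of the cocycle corrects the lift modulo \<open>W\<close>, and the corrected image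
  is a complement \<open>U\<close>. The effect is to exchange the two factors, \<open>X\<close> now
  sitting below \<open>Z\<close>.\<close>

lemma ext_split:
  fixes N :: "('a::{ring,monoid_mult}, 'n, 'y) module_scheme"
    and X :: "('a, 'm, 'x) module_scheme" and Z :: "('a, 'l, 'z) module_scheme"
  assumes N: "right_module N" and X: "right_module X" and Z: "right_module Z"
    and ext: "trivial_group (Ext1 X Z)" and YV: "factor N Y V X" and VW: "factor N V W Z"
  shows "\<exists>U. factor N U W X \<and> factor N Y U Z \<and> U \<inter> V = W \<and> (\<forall>y\<in>Y. \<exists>u\<in>U. \<exists>v\<in>V. y = u \<oplus>\<^bsub>N\<^esub> v)"
proof -
  interpret N: right_module N by fact
  interpret X: right_module X by fact
  interpret Z: right_module Z by fact
  have sub: "rsubmodule Y N" "rsubmodule V N" "rsubmodule W N" "W \<subseteq> V" "V \<subseteq> Y"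
    using YV VW by (auto simp: factor_def)
  note YD = N.rsubmoduleD[OF sub(1)] and VD = N.rsubmoduleD[OF sub(2)] and WD = N.rsubmoduleD[OF sub(3)]
  have Yc: "x \<in> carrier N" if "x \<in> Y" for x using YD(1) that by blast
  have Vc: "x \<in> carrier N" if "x \<in> V" for x using VD(1) that by blast
  obtain \<pi> where \<pi>: "hom_on N Y X \<pi>" "\<pi> ` Y = carrier X" "\<And>x. x \<in> Y \<Longrightarrow> \<pi> x = \<zero>\<^bsub>X\<^esub> \<longleftrightarrow> x \<in> V"
    using YV by (auto simp: factor_def)
  obtain \<rho> where \<rho>: "hom_on N V Z \<rho>" "\<rho> ` V = carrier Z" "\<And>x. x \<in> V \<Longrightarrow> \<rho> x = \<zero>\<^bsub>Z\<^esub> \<longleftrightarrow> x \<in> W"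
    using VW by (auto simp: factor_def)
  note \<pi>D = hom_onD[OF \<pi>(1)] and \<rho>D = hom_onD[OF \<rho>(1)]
  \<comment> \<open>A set-theoretic section; linearity is gained by passing to the free module on
    the elements of \<open>X\<close>.\<close>
  define \<sigma> where "\<sigma> = inv_into Y \<pi>"
  have \<sigma>: "\<sigma> x \<in> Y \<and> \<pi> (\<sigma> x) = x" if "x \<in> carrier X" for x
    using that inv_into_into[of x \<pi> Y] f_inv_into_f[of x \<pi> Y] by (simp add: \<pi>(2) \<sigma>_def)
  let ?P0 = "res0 X" and ?P1 = "res1 X" and ?P2 = "res2 X"
  interpret P0: right_module ?P0 by (simp add: res0_def right_module_free_rmod)
  interpret P1: right_module ?P1 by (simp add: res1_def right_module_free_rmod)
  define K where "K = {f \<in> carrier ?P0. eval_free X f = \<zero>\<^bsub>X\<^esub>}"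
  define K1 where "K1 = {f \<in> carrier ?P1. eval_free ?P0 f = \<zero>\<^bsub>?P0\<^esub>}"
  have P1: "?P1 = free_rmod K" by (simp add: res1_def K_def)
  have P2: "?P2 = free_rmod K1" by (simp add: res2_def K1_def)
  define lm where "lm = lin N \<sigma>"
  have lam: "hom_on ?P0 (carrier ?P0) N lm"
    unfolding lm_def res0_def using \<sigma> Yc by (intro hom_on_lin_free N) blast
  have eX: "hom_on ?P0 (carrier ?P0) X (eval_free X)"
    unfolding eval_free_eq_lin res0_def by (intro hom_on_lin_free X) blast
  have e0: "hom_on ?P1 (carrier ?P1) ?P0 (eval_free ?P0)"
    unfolding eval_free_eq_lin P1 by (intro hom_on_lin_free P0.right_module_axioms) (auto simp: K_def)
  have Ksub: "rsubmodule K ?P0"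
    unfolding K_def by (rule rsubmodule_kernel[OF P0.right_module_axioms X P0.rsubmodule_carrier eX])
  have K1sub: "rsubmodule K1 ?P1"
    unfolding K1_def
    by (rule rsubmodule_kernel[OF P1.right_module_axioms P0.right_module_axioms P1.rsubmodule_carrier e0])
  have Kc: "f \<in> carrier ?P0" if "f \<in> K" for f using that by (simp add: K_def)
  have lamY: "lm f \<in> Y" and pilam: "\<pi> (lm f) = eval_free X f" if f: "f \<in> carrier ?P0" for f
  proof -
    have f': "finite {s. f s \<noteq> 0}" "\<And>s. f s \<noteq> 0 \<Longrightarrow> s \<in> carrier X"
      using f by (auto simp: res0_def free_rmod_simps)
    then have f'': "\<And>s. f s \<noteq> 0 \<Longrightarrow> \<sigma> s \<in> Y" using \<sigma> by blast
    show "lm f \<in> Y"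
      unfolding lm_def by (rule N.lin_in_rsubmodule[OF sub(1) f'(1) f''])
    have "\<pi> (lm f) = lin X (\<lambda>s. \<pi> (\<sigma> s)) f"
      unfolding lm_def by (rule hom_on_lin[OF N X sub(1) \<pi>(1) f'(1) f''])
    also have "\<dots> = eval_free X f"
      unfolding eval_free_def lin_def
      using f'(2) \<sigma> by (intro X.finsum_cong') (auto intro: X.smult_closed)
    finally show "\<pi> (lm f) = eval_free X f" .
  qed
  have lamV: "lm f \<in> V" if f: "f \<in> K" for f
    using pilam[OF Kc[OF f]] \<pi>(3)[OF lamY[OF Kc[OF f]]] f by (simp add: K_def)
  \<comment> \<open>On the relations \<open>K\<close> the lift lands in \<open>V\<close>, so it can
    be pushed to \<open>Z\<close>. The extension splits as soon as this map extends from
    \<open>K\<close> to all of \<open>P0\<close>.\<close>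
  define \<kappa> where "\<kappa> f = \<rho> (lm f)" for f
  have kap: "hom_on ?P0 K Z \<kappa>"
    unfolding hom_on_def
  proof (intro conjI ballI allI)
    show "\<kappa> ` K \<subseteq> carrier Z"
      using \<rho>D(1) lamV by (auto simp: \<kappa>_def)
    show "\<kappa> (f \<oplus>\<^bsub>?P0\<^esub> g) = \<kappa> f \<oplus>\<^bsub>Z\<^esub> \<kappa> g" if "f \<in> K" "g \<in> K" for f g
      using \<rho>D(2)[OF lamV[OF that(1)] lamV[OF that(2)]] hom_onD(2)[OF lam Kc[OF that(1)] Kc[OF that(2)]]
      by (simp add: \<kappa>_def)
    show "\<kappa> (a \<odot>\<^bsub>?P0\<^esub> f) = a \<odot>\<^bsub>Z\<^esub> \<kappa> f" if "f \<in> K" for a f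
      using \<rho>D(3)[OF lamV[OF that(1)], of a] hom_onD(3)[OF lam Kc[OF that(1)], of a]
      by (simp add: \<kappa>_def)
  qed
  have e0K: "eval_free ?P0 g \<in> K" if g: "g \<in> carrier ?P1" for g
    unfolding eval_free_eq_lin
    using g by (intro P0.lin_in_rsubmodule[OF Ksub]) (auto simp: P1 free_rmod_simps)
  have e1K: "eval_free ?P1 z \<in> K1" if z: "z \<in> carrier ?P2" for z
    unfolding eval_free_eq_lin
    using z by (intro P1.lin_in_rsubmodule[OF K1sub]) (auto simp: P2 free_rmod_simps)
  \<comment> \<open>\<open>\<kappa>\<close> pulled back to \<open>P1\<close>, the free module on
    \<open>K\<close>. It kills the image of \<open>P2\<close>, since that image already vanishes in
    \<open>P0\<close>.\<close>
  define \<phi> where "\<phi> = (\<lambda>g\<in>carrier ?P1. \<kappa> (eval_free ?P0 g))"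
  have "\<phi> \<in> rmod_hom ?P1 Z"
    unfolding rmod_hom_def
  proof (intro CollectI conjI ballI allI)
    show "\<phi> \<in> carrier ?P1 \<rightarrow>\<^sub>E carrier Z"
      using e0K hom_onD(1)[OF kap] by (auto simp: \<phi>_def)
  qed (use e0K hom_onD[OF kap] hom_onD[OF e0] in \<open>simp_all add: \<phi>_def P1.smult_closed\<close>)
  moreover have "\<phi> (eval_free ?P1 z) = \<zero>\<^bsub>Z\<^esub>" if z: "z \<in> carrier ?P2" for z
    using e1K[OF z] hom_on_zero[OF P0.right_module_axioms Z Ksub kap] by (simp add: \<phi>_def K1_def)
  ultimately have "\<phi> \<in> carrier (Ext1_cocycles X Z)"
    by (simp add: Ext1_cocycles_def)
  then obtain \<psi> where \<psi>: "\<psi> \<in> rmod_hom ?P0 Z" "\<phi> = (\<lambda>g\<in>carrier ?P1. \<psi> (eval_free ?P0 g))"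
    using Ext1_trivial_cocycle[OF ext Z] by blast
  have psi: "hom_on ?P0 (carrier ?P0) Z \<psi>"
    using \<psi>(1) by (auto simp: rmod_hom_def hom_on_def)
  note \<psi>D = hom_onD[OF psi] and lamD = hom_onD[OF lam]
  \<comment> \<open>Each relation \<open>f\<close> is the image of its own basis element of
    \<open>P1\<close>, so the identity of cocycles on \<open>P1\<close> descends to
    \<open>K\<close>.\<close>
  have kp: "\<kappa> f = \<psi> f" if f: "f \<in> K" for f
  proof -
    let ?d = "\<lambda>s. if s = f then 1 else (0 :: 'a)"
    have d: "?d \<in> carrier ?P1" unfolding P1 using f by (rule single_in_free_rmod)
    have e: "eval_free ?P0 ?d = f"
      unfolding eval_free_eq_lin by (rule P0.lin_single) (rule Kc[OF f])
    have "\<phi> ?d = \<kappa> f" using d e by (simp add: \<phi>_def)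
    moreover have "\<phi> ?d = \<psi> f" unfolding \<psi>(2) using d e by simp
    ultimately show ?thesis by simp
  qed
  define U where "U = {y \<in> Y. \<exists>f\<in>carrier ?P0. \<exists>v\<in>V. \<rho> v = \<psi> f \<and> y \<oplus>\<^bsub>N\<^esub> v = lm f}"
  have lam0: "lm \<zero>\<^bsub>?P0\<^esub> = \<zero>\<^bsub>N\<^esub>"
    by (rule hom_on_zero[OF P0.right_module_axioms N P0.rsubmodule_carrier lam])
  have psi0: "\<psi> \<zero>\<^bsub>?P0\<^esub> = \<zero>\<^bsub>Z\<^esub>"
    by (rule hom_on_zero[OF P0.right_module_axioms Z P0.rsubmodule_carrier psi])
  have WU: "w \<in> U" if w: "w \<in> W" for w
  proof -
    have wV: "w \<in> V" using w sub by blast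
    have "\<rho> (\<ominus>\<^bsub>N\<^esub> w) = \<zero>\<^bsub>Z\<^esub>"
      using \<rho>(3)[of "\<ominus>\<^bsub>N\<^esub> w"] WD(5)[OF w] VD(5)[OF wV] by blast
    moreover have "w \<oplus>\<^bsub>N\<^esub> \<ominus>\<^bsub>N\<^esub> w = lm \<zero>\<^bsub>?P0\<^esub>"
      using Vc[OF wV] by (simp add: lam0 N.r_neg)
    ultimately show ?thesis
      unfolding U_def using wV sub(5) VD(5) psi0 by force
  qed
  have Usub: "rsubmodule U N"
    unfolding N.rsubmodule_iff
  proof (intro conjI ballI allI)
    show "U \<subseteq> carrier N" using Yc by (auto simp: U_def)
    show "\<zero>\<^bsub>N\<^esub> \<in> U" using WU WD(2) by blast
  next
    fix x y assume "x \<in> U" "y \<in> U"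
    then obtain f v g w where *: "f \<in> carrier ?P0" "v \<in> V" "\<rho> v = \<psi> f" "x \<oplus>\<^bsub>N\<^esub> v = lm f" "x \<in> Y"
      "g \<in> carrier ?P0" "w \<in> V" "\<rho> w = \<psi> g" "y \<oplus>\<^bsub>N\<^esub> w = lm g" "y \<in> Y"
      by (auto simp: U_def)
    have "(x \<oplus>\<^bsub>N\<^esub> y) \<oplus>\<^bsub>N\<^esub> (v \<oplus>\<^bsub>N\<^esub> w) = (x \<oplus>\<^bsub>N\<^esub> v) \<oplus>\<^bsub>N\<^esub> (y \<oplus>\<^bsub>N\<^esub> w)"
      using Yc[OF *(5)] Yc[OF *(10)] Vc[OF *(2)] Vc[OF *(7)] by (simp add: N.a_ac)
    also have "\<dots> = lm (f \<oplus>\<^bsub>?P0\<^esub> g)" unfolding *(4,9) by (rule lamD(2)[OF *(1,6), symmetric])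
    finally show "x \<oplus>\<^bsub>N\<^esub> y \<in> U"
      unfolding U_def using * YD(3) VD(3) \<rho>D(2) \<psi>D(2)
      by (intro CollectI conjI bexI[of _ "f \<oplus>\<^bsub>?P0\<^esub> g"] bexI[of _ "v \<oplus>\<^bsub>N\<^esub> w"]) simp_all
  next
    fix a x assume "x \<in> U"
    then obtain f v where *: "f \<in> carrier ?P0" "v \<in> V" "\<rho> v = \<psi> f" "x \<oplus>\<^bsub>N\<^esub> v = lm f" "x \<in> Y"
      by (auto simp: U_def)
    have "a \<odot>\<^bsub>N\<^esub> x \<oplus>\<^bsub>N\<^esub> a \<odot>\<^bsub>N\<^esub> v = a \<odot>\<^bsub>N\<^esub> (x \<oplus>\<^bsub>N\<^esub> v)"
      using Yc[OF *(5)] Vc[OF *(2)] by (simp add: N.smult_r_distr)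
    also have "\<dots> = lm (a \<odot>\<^bsub>?P0\<^esub> f)" unfolding *(4) by (rule lamD(3)[OF *(1), symmetric])
    finally show "a \<odot>\<^bsub>N\<^esub> x \<in> U"
      unfolding U_def using * YD(4) VD(4) \<rho>D(3) \<psi>D(3) P0.smult_closed
      by (intro CollectI conjI bexI[of _ "a \<odot>\<^bsub>?P0\<^esub> f"] bexI[of _ "a \<odot>\<^bsub>N\<^esub> v"]) simp_all
  qed
  note UD = N.rsubmoduleD[OF Usub]
  have UY: "U \<subseteq> Y" by (auto simp: U_def)
  have UV: "U \<inter> V = W"
  proof
    show "U \<inter> V \<subseteq> W"
    proof
      fix y assume y: "y \<in> U \<inter> V"
      then obtain f v where *: "f \<in> carrier ?P0" "v \<in> V" "\<rho> v = \<psi> f" "y \<oplus>\<^bsub>N\<^esub> v = lm f" "y \<in> V"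
        by (auto simp: U_def)
      have "lm f \<in> V" using VD(3)[OF *(5,2)] *(4) by simp
      then have fK: "f \<in> K"
        using pilam[OF *(1)] \<pi>(3)[OF lamY[OF *(1)]] *(1) by (simp add: K_def)
      have "\<rho> y \<oplus>\<^bsub>Z\<^esub> \<rho> v = \<rho> v"
        using kp[OF fK] \<rho>D(2)[OF *(5,2)] unfolding \<kappa>_def *(4)[symmetric] *(3)[symmetric] by simp
      then have "\<rho> y = \<zero>\<^bsub>Z\<^esub>"
        using Z.add.r_cancel_one[OF \<rho>D(1)[OF *(2)] \<rho>D(1)[OF *(5)]] by simp
      then show "y \<in> W" using \<rho>(3) * by blast
    qed
    show "W \<subseteq> U \<inter> V" using WU sub(4) by blast
  qed
  \<comment> \<open>The basis element at \<open>\<pi> y\<close>, lifted and corrected, gives an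
    element \<open>u\<close> of \<open>U\<close> with the same image as \<open>y\<close> in
    \<open>X\<close>; the difference lies in \<open>V\<close>.\<close>
  have sum: "\<exists>u\<in>U. \<exists>v\<in>V. y = u \<oplus>\<^bsub>N\<^esub> v" if y: "y \<in> Y" for y
  proof -
    let ?x = "\<pi> y"
    let ?d = "\<lambda>s. if s = ?x then 1 else (0 :: 'a)"
    have x: "?x \<in> carrier X" using y \<pi>D(1) by blast
    have d: "?d \<in> carrier ?P0" unfolding res0_def using x by (rule single_in_free_rmod)
    have e: "lm ?d = \<sigma> ?x"
      unfolding lm_def by (rule N.lin_single) (use \<sigma> x Yc in blast)
    have "\<psi> ?d \<in> \<rho> ` V" using \<psi>D(1)[OF d] by (simp only: \<rho>(2))
    then obtain v where v: "v \<in> V" "\<rho> v = \<psi> ?d" by (elim imageE) simp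
    have vY: "v \<in> Y" using v sub by blast
    have sY: "\<sigma> ?x \<in> Y" using \<sigma> x by blast
    define u where "u = \<sigma> ?x \<ominus>\<^bsub>N\<^esub> v"
    have uY: "u \<in> Y" unfolding u_def a_minus_def using YD(3,5) vY sY by blast
    have uv: "u \<oplus>\<^bsub>N\<^esub> v = \<sigma> ?x" using vY sY Yc by (simp add: u_def a_minus_def N.a_assoc N.l_neg)
    have uU: "u \<in> U" unfolding U_def using uY v d e uv by (intro CollectI conjI bexI[of _ ?d] bexI[of _ v]) simp_all
    have "?x = \<pi> u \<oplus>\<^bsub>X\<^esub> \<pi> v" using uv \<pi>D(2)[OF uY vY] \<sigma>[OF x] by simp
    moreover have "\<pi> v = \<zero>\<^bsub>X\<^esub>" using \<pi>(3) vY v by blast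
    ultimately have "\<pi> u = ?x" using \<pi>D(1)[OF uY] by simp
    define w where "w = y \<ominus>\<^bsub>N\<^esub> u"
    have wY: "w \<in> Y" unfolding w_def a_minus_def using YD(3,5) uY y by blast
    have yw: "y = u \<oplus>\<^bsub>N\<^esub> w" using N.a_lcomm[of u y "\<ominus>\<^bsub>N\<^esub> u"] Yc[OF uY] Yc[OF y]
      by (simp add: w_def a_minus_def N.r_neg)
    then have "\<pi> y = \<pi> u \<oplus>\<^bsub>X\<^esub> \<pi> w" using \<pi>D(2)[OF uY wY] by simp
    then have "\<pi> w = \<zero>\<^bsub>X\<^esub>" using \<open>\<pi> u = ?x\<close> X.add.l_cancel_one[OF x \<pi>D(1)[OF wY]] by simp
    then have "w \<in> V" using \<pi>(3) wY by blast
    then show ?thesis using uU yw by blast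
  qed
  have "\<pi> ` U = carrier X"
  proof
    show "\<pi> ` U \<subseteq> carrier X" using UY \<pi>D(1) by blast
    show "carrier X \<subseteq> \<pi> ` U"
    proof
      fix x assume "x \<in> carrier X"
      then have "x \<in> \<pi> ` Y" by (simp only: \<pi>(2))
      then obtain y where y: "y \<in> Y" "\<pi> y = x" by (elim imageE) simp
      obtain u v where uv: "u \<in> U" "v \<in> V" "y = u \<oplus>\<^bsub>N\<^esub> v" using sum[OF y(1)] by blast
      have "\<pi> v = \<zero>\<^bsub>X\<^esub>" using \<pi>(3) uv(2) sub by blast
      moreover have "\<pi> y = \<pi> u \<oplus>\<^bsub>X\<^esub> \<pi> v"
        unfolding uv(3) by (rule \<pi>D(2)) (use uv UY sub(5) in auto)
      moreover have "\<pi> u \<in> carrier X" by (rule \<pi>D(1)) (use uv UY in auto)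
      ultimately have "x = \<pi> u" using y(2) by simp
      then show "x \<in> \<pi> ` U" using uv(1) by blast
    qed
  qed
  moreover have "hom_on N U X \<pi>" using \<pi>(1) UY by (rule hom_on_subset)
  moreover have "\<pi> u = \<zero>\<^bsub>X\<^esub> \<longleftrightarrow> u \<in> W" if "u \<in> U" for u
    using \<pi>(3)[of u] that UY UV by blast
  ultimately have "factor N U W X"
    unfolding factor_def using Usub sub(3) WU by (intro conjI exI[of _ \<pi>]) auto
  moreover have "factor N Y U Z"
    using factor_sum[OF N Z Usub sub(1) UY sum _ sub(5)] VW UV by simp
  ultimately show ?thesis using UV sum by blast
qed

text \<open>\<open>X\<close> is moved down past one factor at a time. This takes the place of
  half-exactness: when \<open>Ext\<^sup>1(X, -)\<close> vanishes on every factor, an extension of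
  \<open>X\<close> by a filtered module splits, and the old factors reappear above
  \<open>U\<close>.\<close>

lemma chain_split:
  assumes N: "right_module N" and M: "\<And>i. i \<in> J \<Longrightarrow> right_module (M i)" and X: "right_module X"
    and ext: "\<And>i. i \<in> J \<Longrightarrow> trivial_group (Ext1 X (M i))"
    and "chain N M J W V" and "factor N Y V X"
  shows "\<exists>U. factor N U W X \<and> chain N M J U Y \<and> U \<inter> V = W \<and> (\<forall>y\<in>Y. \<exists>u\<in>U. \<exists>v\<in>V. y = u \<oplus>\<^bsub>N\<^esub> v)"
  using assms(5,6)
proof (induction arbitrary: Y rule: chain.induct)
  case base
  interpret N: right_module N by fact
  have Y: "rsubmodule Y N" "W \<subseteq> Y" using base.prems by (auto simp: factor_def)
  have "y \<in> Y \<Longrightarrow> y = y \<oplus>\<^bsub>N\<^esub> \<zero>\<^bsub>N\<^esub>" for y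
    using N.rsubmoduleD(1)[OF Y(1)] by auto
  then show ?case
    using base Y N.rsubmoduleD(2)[OF base.hyps] by (intro exI[of _ Y]) (auto intro: chain.base)
next
  case (step V i V')
  interpret N: right_module N by fact
  obtain U1 where U1: "factor N U1 V X" "factor N Y U1 (M i)" "U1 \<inter> V' = V"
    "\<And>y. y \<in> Y \<Longrightarrow> \<exists>u\<in>U1. \<exists>v\<in>V'. y = u \<oplus>\<^bsub>N\<^esub> v"
    using ext_split[OF N X M[OF step.hyps(2)] ext[OF step.hyps(2)] step.prems step.hyps(3)] by blast
  obtain U where U: "factor N U W X" "chain N M J U U1" "U \<inter> V = W"
    "\<And>y. y \<in> U1 \<Longrightarrow> \<exists>u\<in>U. \<exists>v\<in>V. y = u \<oplus>\<^bsub>N\<^esub> v"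
    using step.IH[OF U1(1)] by blast
  have sub: "rsubmodule U N" "rsubmodule V' N" "V \<subseteq> V'" "U \<subseteq> U1"
    using U(1) step.hyps(3) chain_rsubmodule[OF U(2)] by (auto simp: factor_def)
  have "\<exists>u\<in>U. \<exists>v\<in>V'. y = u \<oplus>\<^bsub>N\<^esub> v" if y: "y \<in> Y" for y
  proof -
    obtain u v where uv: "u \<in> U1" "v \<in> V'" "y = u \<oplus>\<^bsub>N\<^esub> v" using U1(4)[OF y] by blast
    obtain u' v' where uv': "u' \<in> U" "v' \<in> V" "u = u' \<oplus>\<^bsub>N\<^esub> v'" using U(4) uv(1) by blast
    have "y = u' \<oplus>\<^bsub>N\<^esub> (v' \<oplus>\<^bsub>N\<^esub> v)"
      using uv uv' sub N.rsubmoduleD(1)[OF sub(1)] N.rsubmoduleD(1)[OF sub(2)]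
      by (auto simp: N.a_assoc subset_iff)
    then show ?thesis using uv uv' sub(3) N.rsubmoduleD(3)[OF sub(2)] by blast
  qed
  moreover have "U \<inter> V' = W" using U1(3) U(3) sub(3,4) by blast
  moreover have "chain N M J U Y" using U(2) step.hyps(2) U1(2) by (rule chain.step)
  ultimately show ?case using U(1) by blast
qed

text \<open>Induction from the bottom up. A new top factor of index \<open>i < j\<close> meets only
  factors of index above \<open>i\<close>, so it splits off and becomes the new bottom; for
  \<open>j \<le> i\<close> it stays on top. The bottom is kept nonzero because it has to reduce the
  dimension later.\<close>

lemma chain_bottom_factor:
  assumes N: "right_module N" and M: "\<And>i. i \<in> J \<Longrightarrow> right_module (M i)"
    and ext: "\<And>i j. i \<in> J \<Longrightarrow> j \<in> J \<Longrightarrow> i \<le> j \<Longrightarrow> trivial_group (Ext1 (M i) (M j))"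
    and "chain N M J {\<zero>\<^bsub>N\<^esub>} V" "V \<noteq> {\<zero>\<^bsub>N\<^esub>}"
  shows "\<exists>j U. j \<in> J \<and> U \<noteq> {\<zero>\<^bsub>N\<^esub>} \<and> factor N U {\<zero>\<^bsub>N\<^esub>} (M j) \<and> chain N M {i \<in> J. j \<le> i} U V \<and>
    chain N M {i \<in> J. j \<le> i} {\<zero>\<^bsub>N\<^esub>} V"
  using assms(4,5)
proof (induction rule: chain.induct)
  case base
  then show ?case by simp
next
  case (step V i V')
  interpret N: right_module N by fact
  have sub: "rsubmodule V N" "rsubmodule V' N" "V \<subseteq> V'"
    using step.hyps(3) by (auto simp: factor_def)
  have iJ: "i \<in> {l \<in> J. i \<le> l}" using step.hyps(2) by simp
  show ?case
  proof (cases "V = {\<zero>\<^bsub>N\<^esub>}")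
    case True
    have "chain N M {l \<in> J. i \<le> l} {\<zero>\<^bsub>N\<^esub>} V'"
      using chain.step[where M = M, OF chain.base[OF sub(1)] iJ step.hyps(3)] unfolding True by simp
    then show ?thesis
      using step True sub(2) by (intro exI[of _ i] exI[of _ V']) (auto intro: chain.base)
  next
    case False
    then obtain j U where U: "j \<in> J" "U \<noteq> {\<zero>\<^bsub>N\<^esub>}" "factor N U {\<zero>\<^bsub>N\<^esub>} (M j)"
      "chain N M {i \<in> J. j \<le> i} U V" "chain N M {i \<in> J. j \<le> i} {\<zero>\<^bsub>N\<^esub>} V"
      using step.IH by blast
    \<comment> \<open>The case \<open>V' = V\<close> is separated because a zero factor could carry
      an index below \<open>j\<close>, while its complement would be zero and useless as a
      bottom.\<close>
    consider "V' = V" | "j \<le> i" | "V' \<noteq> V" "i < j" by fastforce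
    then show ?thesis
    proof cases
      case 1
      then show ?thesis using U by blast
    next
      case 2
      then have "i \<in> {i \<in> J. j \<le> i}" using step.hyps(2) by simp
      then show ?thesis
        using U chain.step[where M = M, OF U(4) _ step.hyps(3)] chain.step[where M = M, OF U(5) _ step.hyps(3)] by blast
    next
      case 3
      let ?J = "{l \<in> J. j \<le> l}"
      have J: "?J \<subseteq> {l \<in> J. i \<le> l}" using 3 by auto
      \<comment> \<open>Indices \<open>l\<close> in \<open>?J\<close> satisfy
        \<open>l \<ge> j > i\<close>, so the hypothesis gives
        \<open>Ext\<^sup>1(M\<^sub>i, M\<^sub>l) = 0\<close> for all of them.\<close>
      have "\<exists>U'. factor N U' {\<zero>\<^bsub>N\<^esub>} (M i) \<and> chain N M ?J U' V' \<and> U' \<inter> V = {\<zero>\<^bsub>N\<^esub>} \<and>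
          (\<forall>y\<in>V'. \<exists>u\<in>U'. \<exists>v\<in>V. y = u \<oplus>\<^bsub>N\<^esub> v)"
        using 3(2) step.hyps(2)
        by (intro chain_split[OF N _ M[OF step.hyps(2)] _ U(5) step.hyps(3)] M ext) auto
      then obtain U' where U': "factor N U' {\<zero>\<^bsub>N\<^esub>} (M i)" "chain N M ?J U' V'"
        "\<And>y. y \<in> V' \<Longrightarrow> \<exists>u\<in>U'. \<exists>v\<in>V. y = u \<oplus>\<^bsub>N\<^esub> v"
        by blast
      have "U' \<noteq> {\<zero>\<^bsub>N\<^esub>}"
      proof
        assume "U' = {\<zero>\<^bsub>N\<^esub>}"
        then have "V' \<subseteq> V"
          using U'(3) N.rsubmoduleD(1)[OF sub(1)] by fastforce
        then show False using 3(1) sub(3) by blast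
      qed
      moreover have "chain N M {l \<in> J. i \<le> l} {\<zero>\<^bsub>N\<^esub>} V'"
        using chain.step[where M = M, OF chain_mono[OF U(5) J] iJ step.hyps(3)] .
      ultimately show ?thesis
        using U'(1) chain_mono[OF U'(2) J] step.hyps(2) by blast
    qed
  qed
qed

section \<open>Germs of regular functions\<close>

text \<open>Models the local ring at \<open>q0\<close> with actual functions in place of equivalence
  classes: nonvanishing is asked for along \<open>F\<close> only, while values at \<open>q0\<close>
  are exact. Inverses are total functions because of \<open>inverse 0 = 0\<close>.\<close>

locale germ_ring =
  fixes L :: "('q \<Rightarrow> 'k::field) set" and F :: "'q filter" and q0 :: 'q
  assumes const: "(\<lambda>_. c) \<in> L"
    and add: "f \<in> L \<Longrightarrow> g \<in> L \<Longrightarrow> (\<lambda>q. f q + g q) \<in> L"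
    and mult: "f \<in> L \<Longrightarrow> g \<in> L \<Longrightarrow> (\<lambda>q. f q * g q) \<in> L"
    and inverse: "f \<in> L \<Longrightarrow> f q0 \<noteq> 0 \<Longrightarrow> (\<lambda>q. inverse (f q)) \<in> L"
    and nonzero: "f \<in> L \<Longrightarrow> f q0 \<noteq> 0 \<Longrightarrow> \<forall>\<^sub>F q in F. f q \<noteq> 0"
begin

lemma uminus: "f \<in> L \<Longrightarrow> (\<lambda>q. - f q) \<in> L"
  using mult[OF const[of "- 1"], of f] by simp

lemma diff: "f \<in> L \<Longrightarrow> g \<in> L \<Longrightarrow> (\<lambda>q. f q - g q) \<in> L"
  using add[OF _ uminus, of f g] by simp

lemma divide: "f \<in> L \<Longrightarrow> g \<in> L \<Longrightarrow> g q0 \<noteq> 0 \<Longrightarrow> (\<lambda>q. f q / g q) \<in> L"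
  using mult[OF _ inverse, of f g] by (simp add: divide_inverse)

lemma sum: "(\<And>i. i \<in> I \<Longrightarrow> f i \<in> L) \<Longrightarrow> (\<lambda>q. \<Sum>i\<in>I. f i q) \<in> L"
  by (induction I rule: infinite_finite_induct) (simp_all add: const add)

lemma prod: "(\<And>i. i \<in> I \<Longrightarrow> f i \<in> L) \<Longrightarrow> (\<lambda>q. \<Prod>i\<in>I. f i q) \<in> L"
  by (induction I rule: infinite_finite_induct) (simp_all add: const mult)

lemma det:
  assumes A: "\<And>q. A q \<in> carrier_mat n n"
    and L: "\<And>i j. i < n \<Longrightarrow> j < n \<Longrightarrow> (\<lambda>q. A q $$ (i, j)) \<in> L"
  shows "(\<lambda>q. det (A q)) \<in> L"
proof -
  have "(\<lambda>q. \<Sum>p | p permutes {0..<n}. signof p * (\<Prod>i = 0..<n. A q $$ (i, p i))) \<in> L"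
    by (intro sum mult const prod L) (auto simp: permutes_in_image dest: permutes_in_image)
  then show ?thesis by (simp only: det_def'[OF A])
qed

lemma adj_mat:
  assumes A: "\<And>q. A q \<in> carrier_mat n n"
    and L: "\<And>i j. i < n \<Longrightarrow> j < n \<Longrightarrow> (\<lambda>q. A q $$ (i, j)) \<in> L"
    and ij: "i < n" "j < n"
  shows "(\<lambda>q. adj_mat (A q) $$ (i, j)) \<in> L"
proof -
  have dim: "dim_row (A q) = n" "dim_col (A q) = n" for q using A[of q] by auto
  have "(\<lambda>q. det (mat_delete (A q) j i)) \<in> L"
  proof (rule det)
    show "mat_delete (A q) j i \<in> carrier_mat (n - 1) (n - 1)" for q
      by (rule mat_delete_carrier[OF A])
    show "(\<lambda>q. mat_delete (A q) j i $$ (k, l)) \<in> L" if "k < n - 1" "l < n - 1" for k l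
      using that L by (simp add: mat_delete_def dim)
  qed
  then have "(\<lambda>q. cofactor (A q) j i) \<in> L"
    unfolding cofactor_def by (intro mult const)
  then show ?thesis using ij by (simp add: adj_mat_def dim)
qed

lemma polyfun_comp:
  assumes "P \<in> polyfuns N d"
    and L: "\<And>l i j. l < N \<Longrightarrow> i < d \<Longrightarrow> j < d \<Longrightarrow> (\<lambda>q. (X q ! l) $$ (i, j)) \<in> L"
  shows "(\<lambda>q. P (X q)) \<in> L"
  using assms(1) by induction (auto intro: L const add mult)

text \<open>Gaussian elimination: a nonzero entry of \<open>B\<close> at \<open>q0\<close> is a pivot, and if there is none then
  exactness gives a functional in \<open>C\<close> that expresses one row of \<open>B\<close> by the others.\<close>

lemma kernel_section:
  fixes B :: "'q \<Rightarrow> 'j \<Rightarrow> 'i \<Rightarrow> 'k"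
  assumes "finite J" "finite I"
    and BL: "\<And>j i. j \<in> J \<Longrightarrow> i \<in> I \<Longrightarrow> (\<lambda>q. B q j i) \<in> L"
    and CL: "\<And>c j. c \<in> C \<Longrightarrow> j \<in> J \<Longrightarrow> (\<lambda>q. c q j) \<in> L"
    and CB: "\<And>c i. c \<in> C \<Longrightarrow> i \<in> I \<Longrightarrow> \<forall>\<^sub>F q in F. (\<Sum>j\<in>J. c q j * B q j i) = 0"
    and exact: "\<And>y. (\<And>c. c \<in> C \<Longrightarrow> (\<Sum>j\<in>J. c q0 j * y j) = 0) \<Longrightarrow> \<exists>x. \<forall>j\<in>J. y j = (\<Sum>i\<in>I. B q0 j i * x i)"
    and x0: "\<And>j. j \<in> J \<Longrightarrow> (\<Sum>i\<in>I. B q0 j i * x0 i) = 0"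
  shows "\<exists>x. (\<forall>i\<in>I. (\<lambda>q. x q i) \<in> L) \<and> x q0 = x0 \<and> (\<forall>\<^sub>F q in F. \<forall>j\<in>J. (\<Sum>i\<in>I. B q j i * x q i) = 0)"
  using assms
proof (induction J arbitrary: B C rule: finite_psubset_induct)
  case (psubset J)
  note fin = \<open>finite J\<close> \<open>finite I\<close>
  note BL = psubset.prems(2) and CL = psubset.prems(3) and CB = psubset.prems(4)
    and exact = psubset.prems(5) and x0 = psubset.prems(6)
  consider "J = {}" | j0 i0 where "j0 \<in> J" "i0 \<in> I" "B q0 j0 i0 \<noteq> 0"
    | j0 where "j0 \<in> J" "\<And>j i. j \<in> J \<Longrightarrow> i \<in> I \<Longrightarrow> B q0 j i = 0"
    by blast
  then show ?case
  proof cases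
    case 1
    then show ?thesis by (intro exI[of _ "\<lambda>_. x0"]) (auto intro: const)
  next
    case (2 j0 i0)
    let ?J = "J - {j0}"
    have J: "?J \<subset> J" using 2 by blast
    \<comment> \<open>Subtracting \<open>\<beta> q i\<close> times column \<open>i0\<close> from
      column \<open>i\<close> clears row \<open>j0\<close>. The relations given by \<open>C\<close>
      persist under column operations, and the new image is the part of the old one with coordinate
      zero at \<open>j0\<close>, so exactness is inherited by extending \<open>y\<close> with 0
      there.\<close>
    define \<beta> where "\<beta> q i = B q j0 i / B q j0 i0" for q i
    define B' where "B' q j i = B q j i - B q j i0 * \<beta> q i" for q j i
    have \<beta>L: "(\<lambda>q. \<beta> q i) \<in> L" if "i \<in> I" for i
      unfolding \<beta>_def using 2 that by (intro divide BL)
    have nz: "\<forall>\<^sub>F q in F. B q j0 i0 \<noteq> 0" using 2 by (intro nonzero BL)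
    have B'x: "(\<Sum>i\<in>I. B' q j i * x i) = (\<Sum>i\<in>I. B q j i * x i) - B q j i0 * (\<Sum>i\<in>I. \<beta> q i * x i)" for q j x
      by (simp add: B'_def algebra_simps sum_subtractf sum_distrib_left)
    have \<beta>x: "(\<Sum>i\<in>I. \<beta> q i * x i) = (\<Sum>i\<in>I. B q j0 i * x i) / B q j0 i0" for q x
      by (simp add: \<beta>_def sum_divide_distrib)
    have "\<exists>x. (\<forall>i\<in>I. (\<lambda>q. x q i) \<in> L) \<and> x q0 = x0 \<and>
        (\<forall>\<^sub>F q in F. \<forall>j\<in>?J. (\<Sum>i\<in>I. B' q j i * x q i) = 0)"
    proof (rule psubset.IH[OF J fin(2)])
      show "(\<lambda>q. B' q j i) \<in> L" if "j \<in> ?J" "i \<in> I" for j i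
        unfolding B'_def using that 2 by (intro diff mult BL \<beta>L) auto
      show "(\<lambda>q. c q j) \<in> L" if "c \<in> C" "j \<in> ?J" for c j
        using that CL by blast
      show "\<forall>\<^sub>F q in F. (\<Sum>j\<in>?J. c q j * B' q j i) = 0" if "c \<in> C" "i \<in> I" for c i
        using nz CB[OF that(1) 2(2)] CB[OF that]
      proof eventually_elim
        case (elim q)
        have "(\<Sum>j\<in>J. c q j * B' q j i) =
            (\<Sum>j\<in>J. c q j * B q j i) - (\<Sum>j\<in>J. c q j * B q j i0) * \<beta> q i"
          by (simp add: B'_def right_diff_distrib sum_subtractf sum_distrib_right mult.assoc)
        then have "(\<Sum>j\<in>J. c q j * B' q j i) = 0" using elim by simp
        moreover have "B' q j0 i = 0" using elim(1) by (simp add: B'_def \<beta>_def)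
        ultimately show ?case
          using fin(1) 2(1) by (simp add: sum.remove[of J j0])
      qed
      show "\<exists>x. \<forall>j\<in>?J. y j = (\<Sum>i\<in>I. B' q0 j i * x i)"
        if y: "\<And>c. c \<in> C \<Longrightarrow> (\<Sum>j\<in>?J. c q0 j * y j) = 0" for y
      proof -
        have "\<exists>x. \<forall>j\<in>J. (y(j0 := 0)) j = (\<Sum>i\<in>I. B q0 j i * x i)"
        proof (rule exact)
          fix c assume "c \<in> C"
          have "(\<Sum>j\<in>J. c q0 j * (y(j0 := 0)) j) = (\<Sum>j\<in>?J. c q0 j * (y(j0 := 0)) j)"
            using fin(1) 2(1) by (simp add: sum.remove[of J j0])
          also have "\<dots> = (\<Sum>j\<in>?J. c q0 j * y j)"
            by (intro sum.cong) auto
          finally show "(\<Sum>j\<in>J. c q0 j * (y(j0 := 0)) j) = 0"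
            using y[OF \<open>c \<in> C\<close>] by simp
        qed
        then obtain x where x: "\<And>j. j \<in> J \<Longrightarrow> (y(j0 := 0)) j = (\<Sum>i\<in>I. B q0 j i * x i)" by blast
        have "(\<Sum>i\<in>I. \<beta> q0 i * x i) = 0"
          using x[OF 2(1)] by (simp add: \<beta>x)
        then have "y j = (\<Sum>i\<in>I. B' q0 j i * x i)" if "j \<in> ?J" for j
          using x[of j] that by (simp add: B'x)
        then show ?thesis by blast
      qed
      show "(\<Sum>i\<in>I. B' q0 j i * x0 i) = 0" if "j \<in> ?J" for j
        using x0[OF 2(1)] x0[of j] that by (simp add: B'x \<beta>x)
    qed
    then obtain x where x: "\<And>i. i \<in> I \<Longrightarrow> (\<lambda>q. x q i) \<in> L" "x q0 = x0"
      "\<forall>\<^sub>F q in F. \<forall>j\<in>?J. (\<Sum>i\<in>I. B' q j i * x q i) = 0"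
      by blast
    define s where "s q = (\<Sum>i\<in>I. \<beta> q i * x q i)" for q
    \<comment> \<open>Solutions for \<open>B'\<close> turn into solutions for \<open>B\<close> by
      adjusting coordinate \<open>i0\<close>. The adjustment is zero at \<open>q0\<close> because
      \<open>x0\<close> solves row \<open>j0\<close>, so the prescribed value survives.\<close>
    define x' where "x' q = (x q)(i0 := x q i0 - s q)" for q
    have Bx': "(\<Sum>i\<in>I. B q j i * x' q i) = (\<Sum>i\<in>I. B' q j i * x q i)" for q j
    proof -
      have "(\<Sum>i\<in>I. B q j i * x' q i) = (\<Sum>i\<in>I. B q j i * x q i - (if i = i0 then B q j i * s q else 0))"
        by (intro sum.cong) (auto simp: x'_def right_diff_distrib)
      also have "\<dots> = (\<Sum>i\<in>I. B q j i * x q i) - B q j i0 * s q"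
        using fin(2) 2(2) by (simp add: sum_subtractf)
      finally show ?thesis by (simp add: B'x s_def)
    qed
    have "(\<lambda>q. x' q i) \<in> L" if "i \<in> I" for i
    proof -
      have "s \<in> L" unfolding s_def[abs_def] using x(1) \<beta>L by (intro sum mult)
      then show ?thesis
        using that x(1) diff[OF x(1)[OF 2(2)], of s] by (cases "i = i0") (simp_all add: x'_def)
    qed
    moreover have "x' q0 = x0"
    proof -
      have "s q0 = 0" using x0[OF 2(1)] by (simp add: s_def x(2) \<beta>x)
      then show ?thesis by (simp add: x'_def x(2) fun_upd_idem)
    qed
    moreover have "\<forall>\<^sub>F q in F. \<forall>j\<in>J. (\<Sum>i\<in>I. B q j i * x' q i) = 0"
      using nz x(3)
    proof eventually_elim
      case (elim q)
      have "B' q j0 i = 0" for i using elim(1) by (simp add: B'_def \<beta>_def)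
      then show ?case using elim(2) unfolding Bx' by (metis (no_types, lifting) Diff_iff mult_zero_left singletonD sum.neutral)
    qed
    ultimately show ?thesis by blast
  next
    case (3 j0)
    let ?J = "J - {j0}"
    have J: "?J \<subset> J" using 3 by blast
    \<comment> \<open>Otherwise the unit vector at \<open>j0\<close> would meet all conditions in
      \<open>C\<close> and lie in the image of \<open>B q0\<close>, which is zero in this
      case.\<close>
    have "\<exists>c\<in>C. c q0 j0 \<noteq> 0"
    proof (rule ccontr)
      assume *: "\<not> (\<exists>c\<in>C. c q0 j0 \<noteq> 0)"
      have "\<exists>x. \<forall>j\<in>J. (if j = j0 then 1 else 0) = (\<Sum>i\<in>I. B q0 j i * x i)"
        using * by (intro exact sum.neutral) auto
      then obtain x where "1 = (\<Sum>i\<in>I. B q0 j0 i * x i)" using 3(1) by force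
      also have "\<dots> = 0" using 3 by (intro sum.neutral) auto
      finally show False by simp
    qed
    then obtain e where e: "e \<in> C" "e q0 j0 \<noteq> 0" by blast
    have nz: "\<forall>\<^sub>F q in F. e q j0 \<noteq> 0" using e 3(1) by (intro nonzero CL)
    have split: "(\<Sum>j\<in>J. f j) = f j0 + (\<Sum>j\<in>?J. f j)" for f :: "'j \<Rightarrow> 'k"
      using fin(1) 3(1) by (rule sum.remove)
    \<comment> \<open>The condition \<open>e\<close> is used to cancel the coordinate
      \<open>j0\<close> of every condition, so that the relations still hold after row
      \<open>j0\<close> is deleted.\<close>
    define red where "red c q j = c q j - c q j0 / e q j0 * e q j" for c q j
    have redx: "(\<Sum>j\<in>?J. red c q j * y j) = (\<Sum>j\<in>?J. c q j * y j) - c q j0 / e q j0 * (\<Sum>j\<in>?J. e q j * y j)" for c q y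
      by (simp add: red_def left_diff_distrib sum_subtractf sum_distrib_left mult.assoc)
    have "\<exists>x. (\<forall>i\<in>I. (\<lambda>q. x q i) \<in> L) \<and> x q0 = x0 \<and>
        (\<forall>\<^sub>F q in F. \<forall>j\<in>?J. (\<Sum>i\<in>I. B q j i * x q i) = 0)"
    proof (rule psubset.IH[OF J fin(2), of B "red ` C"])
      show "(\<lambda>q. B q j i) \<in> L" if "j \<in> ?J" "i \<in> I" for j i
        using that BL by blast
      show "(\<lambda>q. c q j) \<in> L" if c: "c \<in> red ` C" and j: "j \<in> ?J" for c j
      proof -
        obtain c' where c': "c' \<in> C" "c = red c'" using c by blast
        have "(\<lambda>q. c' q j) \<in> L" "(\<lambda>q. c' q j0) \<in> L" "(\<lambda>q. e q j) \<in> L" "(\<lambda>q. e q j0) \<in> L"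
          using j c'(1) e(1) 3(1) by (simp_all add: CL)
        then show ?thesis
          unfolding c'(2) red_def using e(2) by (intro diff mult divide)
      qed
      show "\<forall>\<^sub>F q in F. (\<Sum>j\<in>?J. c q j * B q j i) = 0" if c: "c \<in> red ` C" "i \<in> I" for c i
      proof -
        obtain c' where c': "c' \<in> C" "c = red c'" using c(1) by blast
        show ?thesis
          using nz CB[OF c'(1) c(2)] CB[OF e(1) c(2)]
        proof eventually_elim
          case (elim q)
          have "(\<Sum>j\<in>?J. c' q j * B q j i) = - (c' q j0 * B q j0 i)"
            "(\<Sum>j\<in>?J. e q j * B q j i) = - (e q j0 * B q j0 i)"
            using elim(2,3) unfolding split by (simp_all add: eq_neg_iff_add_eq_0 add.commute)
          then show ?case using elim(1) by (simp add: c'(2) redx)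
        qed
      qed
      show "\<exists>x. \<forall>j\<in>?J. y j = (\<Sum>i\<in>I. B q0 j i * x i)"
        if y: "\<And>c. c \<in> red ` C \<Longrightarrow> (\<Sum>j\<in>?J. c q0 j * y j) = 0" for y
      proof -
        \<comment> \<open>The coordinate at \<open>j0\<close> is the one that the condition
          \<open>e\<close> dictates.\<close>
        let ?y = "y(j0 := - (\<Sum>j\<in>?J. e q0 j * y j) / e q0 j0)"
        have "\<exists>x. \<forall>j\<in>J. ?y j = (\<Sum>i\<in>I. B q0 j i * x i)"
        proof (rule exact)
          fix c assume c: "c \<in> C"
          have "(\<Sum>j\<in>?J. c q0 j * ?y j) = (\<Sum>j\<in>?J. c q0 j * y j)"
            by (intro sum.cong) auto
          also have "\<dots> = c q0 j0 / e q0 j0 * (\<Sum>j\<in>?J. e q0 j * y j)"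
            using y[of "red c"] c by (simp add: redx)
          finally show "(\<Sum>j\<in>J. c q0 j * ?y j) = 0"
            unfolding split by simp
        qed
        then obtain x where x: "\<And>j. j \<in> J \<Longrightarrow> ?y j = (\<Sum>i\<in>I. B q0 j i * x i)" by blast
        have "y j = (\<Sum>i\<in>I. B q0 j i * x i)" if "j \<in> ?J" for j
          using x[of j] that by simp
        then show ?thesis by blast
      qed
      show "(\<Sum>i\<in>I. B q0 j i * x0 i) = 0" if "j \<in> ?J" for j
        using x0 that by blast
    qed
    then obtain x where x: "\<And>i. i \<in> I \<Longrightarrow> (\<lambda>q. x q i) \<in> L" "x q0 = x0"
      "\<forall>\<^sub>F q in F. \<forall>j\<in>?J. (\<Sum>i\<in>I. B q j i * x q i) = 0"
      by blast
    have "\<forall>\<^sub>F q in F. \<forall>i\<in>I. (\<Sum>j\<in>J. e q j * B q j i) = 0"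
      using fin(2) CB[OF e(1)] by (simp add: eventually_ball_finite)
    then have "\<forall>\<^sub>F q in F. \<forall>j\<in>J. (\<Sum>i\<in>I. B q j i * x q i) = 0"
      using nz x(3)
    proof eventually_elim
      case (elim q)
      \<comment> \<open>Row \<open>j0\<close> comes back from the others: the combination of rows
        with coefficients \<open>e q\<close> is zero, the other rows annihilate \<open>x q\<close>,
        and \<open>e q j0\<close> is nonzero.\<close>
      have "0 = (\<Sum>i\<in>I. (\<Sum>j\<in>J. e q j * B q j i) * x q i)"
        using elim(1) by simp
      also have "\<dots> = (\<Sum>j\<in>J. e q j * (\<Sum>i\<in>I. B q j i * x q i))"
        unfolding sum_distrib_left sum_distrib_right by (subst sum.swap) (simp add: mult.assoc)
      also have "\<dots> = e q j0 * (\<Sum>i\<in>I. B q j0 i * x q i)"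
        unfolding split using elim(3) by simp
      finally have "(\<Sum>i\<in>I. B q j0 i * x q i) = 0" using elim(2) by simp
      then show ?case using elim(3) by blast
    qed
    then show ?thesis using x by blast
  qed
qed

end

section \<open>Zariski neighbourhoods\<close>

text \<open>The values off the variety are left free, so that multiplicativity and linearity of
  \<open>m\<close> may be used in showing membership.\<close>

definition reg :: "('k::field \<Rightarrow> 'a::{ring,monoid_mult} \<Rightarrow> 'a) \<Rightarrow> 'a list \<Rightarrow> nat \<Rightarrow> (('a \<Rightarrow> 'k mat) \<Rightarrow> 'k) set" where
  "reg scl gs d = {f. \<exists>p\<in>polyfuns (length gs) d. \<forall>m\<in>mod_variety scl d. f m = p (map m gs)}"

text \<open>The basic open sets \<open>D(f)\<close> around \<open>m0\<close> form the filter base;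
  products of functions make it directed.\<close>

definition zar :: "('k::field \<Rightarrow> 'a::{ring,monoid_mult} \<Rightarrow> 'a) \<Rightarrow> 'a list \<Rightarrow> nat \<Rightarrow> ('a \<Rightarrow> 'k mat) \<Rightarrow> ('a \<Rightarrow> 'k mat) filter" where
  "zar scl gs d m0 = (INF f\<in>{f \<in> reg scl gs d. f m0 \<noteq> 0}. principal {m \<in> mod_variety scl d. f m \<noteq> 0})"

text \<open>The equation at \<open>m0\<close> stands apart from the one along the filter, since for
  \<open>m0\<close> outside the variety the filter would not see that point.\<close>

definition germs :: "('k::field \<Rightarrow> 'a::{ring,monoid_mult} \<Rightarrow> 'a) \<Rightarrow> 'a list \<Rightarrow> nat \<Rightarrow> ('a \<Rightarrow> 'k mat) \<Rightarrow> (('a \<Rightarrow> 'k mat) \<Rightarrow> 'k) set" where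
  "germs scl gs d m0 = {f. \<exists>p\<in>reg scl gs d. \<exists>q\<in>reg scl gs d. q m0 \<noteq> 0 \<and> f m0 = p m0 / q m0 \<and>
     (\<forall>\<^sub>F m in zar scl gs d m0. f m = p m / q m)}"

lemma reg_const: "(\<lambda>_. c) \<in> reg scl gs d"
  unfolding reg_def by (auto intro: polyfuns.const bexI[of _ "\<lambda>_. c"])

lemma reg_add: "f \<in> reg scl gs d \<Longrightarrow> g \<in> reg scl gs d \<Longrightarrow> (\<lambda>m. f m + g m) \<in> reg scl gs d"
  unfolding reg_def by (force intro: polyfuns.add)

lemma reg_mult: "f \<in> reg scl gs d \<Longrightarrow> g \<in> reg scl gs d \<Longrightarrow> (\<lambda>m. f m * g m) \<in> reg scl gs d"
  unfolding reg_def by (force intro: polyfuns.mult)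

lemma eventually_zar:
  "(\<forall>\<^sub>F m in zar scl gs d m0. P m) \<longleftrightarrow>
    (\<exists>f\<in>reg scl gs d. f m0 \<noteq> 0 \<and> (\<forall>m\<in>mod_variety scl d. f m \<noteq> 0 \<longrightarrow> P m))"
proof -
  have "(\<forall>\<^sub>F m in zar scl gs d m0. P m) \<longleftrightarrow>
    (\<exists>f\<in>{f \<in> reg scl gs d. f m0 \<noteq> 0}. eventually P (principal {m \<in> mod_variety scl d. f m \<noteq> 0}))"
    unfolding zar_def
  proof (rule eventually_INF_base)
    show "{f \<in> reg scl gs d. f m0 \<noteq> 0} \<noteq> {}"
      using reg_const[of 1 scl gs d] by auto
    fix f g assume "f \<in> {f \<in> reg scl gs d. f m0 \<noteq> 0}" "g \<in> {f \<in> reg scl gs d. f m0 \<noteq> 0}"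
    then show "\<exists>h\<in>{f \<in> reg scl gs d. f m0 \<noteq> 0}. principal {m \<in> mod_variety scl d. h m \<noteq> 0} \<le>
        inf (principal {m \<in> mod_variety scl d. f m \<noteq> 0}) (principal {m \<in> mod_variety scl d. g m \<noteq> 0})"
      by (intro bexI[of _ "\<lambda>m. f m * g m"]) (auto intro: reg_mult)
  qed
  then show ?thesis by (auto simp: eventually_principal)
qed

lemma eventually_zar_variety: "\<forall>\<^sub>F m in zar scl gs d m0. m \<in> mod_variety scl d"
  unfolding eventually_zar by (rule bexI[OF _ reg_const[of 1]]) auto

lemma reg_nonzero: "f \<in> reg scl gs d \<Longrightarrow> f m0 \<noteq> 0 \<Longrightarrow> \<forall>\<^sub>F m in zar scl gs d m0. f m \<noteq> 0"
  unfolding eventually_zar by blast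

lemma reg_in_germs: "f \<in> reg scl gs d \<Longrightarrow> f \<in> germs scl gs d m0"
  unfolding germs_def by (intro CollectI bexI[of _ f] bexI[OF _ reg_const[of 1]]) auto

lemma germ_ring_germs: "germ_ring (germs scl gs d m0) (zar scl gs d m0) m0"
proof
  let ?R = "reg scl gs d" and ?G = "germs scl gs d m0" and ?Z = "zar scl gs d m0"
  show "(\<lambda>_. c) \<in> ?G" for c by (intro reg_in_germs reg_const)
  fix f assume "f \<in> ?G"
  then obtain p q where f: "p \<in> ?R" "q \<in> ?R" "q m0 \<noteq> 0" "f m0 = p m0 / q m0"
    "\<forall>\<^sub>F m in ?Z. f m = p m / q m"
    unfolding germs_def by blast
  show "(\<lambda>m. inverse (f m)) \<in> ?G" if "f m0 \<noteq> 0"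
    unfolding germs_def
    using f that
    by (intro CollectI bexI[OF _ f(2)] bexI[OF _ f(1)])
      (auto elim!: eventually_mono)
  show "\<forall>\<^sub>F m in ?Z. f m \<noteq> 0" if "f m0 \<noteq> 0"
  proof -
    have "p m0 \<noteq> 0" using f(4) that by auto
    from f(5) reg_nonzero[OF f(1) this] reg_nonzero[OF f(2,3)] show ?thesis
      by eventually_elim simp
  qed
  fix g assume "g \<in> ?G"
  then obtain r s where g: "r \<in> ?R" "s \<in> ?R" "s m0 \<noteq> 0" "g m0 = r m0 / s m0"
    "\<forall>\<^sub>F m in ?Z. g m = r m / s m"
    unfolding germs_def by blast
  have "\<forall>\<^sub>F m in ?Z. f m + g m = (p m * s m + r m * q m) / (q m * s m)"
    using f(5) g(5) reg_nonzero[OF f(2,3)] reg_nonzero[OF g(2,3)]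
    by eventually_elim (simp add: add_frac_eq)
  then show "(\<lambda>m. f m + g m) \<in> ?G"
    unfolding germs_def using f(1-4) g(1-4)
    by (intro CollectI bexI[of _ "\<lambda>m. p m * s m + r m * q m"] bexI[of _ "\<lambda>m. q m * s m"])
      (auto intro: reg_add reg_mult simp: add_frac_eq)
  have "\<forall>\<^sub>F m in ?Z. f m * g m = (p m * r m) / (q m * s m)"
    using f(5) g(5) by eventually_elim simp
  then show "(\<lambda>m. f m * g m) \<in> ?G"
    unfolding germs_def using f(1-4) g(1-4)
    by (intro CollectI bexI[of _ "\<lambda>m. p m * r m"] bexI[of _ "\<lambda>m. q m * s m"])
      (auto intro: reg_mult)
qed

text \<open>Meant for expressions, such as entries of conjugated matrices, whose rational formula is
  verified only at points of the variety.\<close>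

lemma germs_cong:
  assumes "g \<in> germs scl gs d m0" and eq: "\<And>m. m \<in> mod_variety scl d \<Longrightarrow> f m = g m"
    and m0: "m0 \<in> mod_variety scl d"
  shows "f \<in> germs scl gs d m0"
proof -
  obtain p q where pq: "p \<in> reg scl gs d" "q \<in> reg scl gs d" "q m0 \<noteq> 0" "g m0 = p m0 / q m0"
    "\<forall>\<^sub>F m in zar scl gs d m0. g m = p m / q m"
    using assms(1) unfolding germs_def by blast
  have "\<forall>\<^sub>F m in zar scl gs d m0. f m = p m / q m"
    using pq(5) eventually_zar_variety by eventually_elim (simp add: eq)
  then show ?thesis unfolding germs_def using pq eq[OF m0] by auto
qed

text \<open>Recasts openness as a condition at each point, the form in which finitely many
  shrinkings of a neighbourhood can be combined.\<close>

lemma openin_mod_topology_iff: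
  fixes scl :: "'k::field \<Rightarrow> 'a::{ring,monoid_mult} \<Rightarrow> 'a"
  shows "openin (mod_topology scl gs d) S \<longleftrightarrow>
    S \<subseteq> mod_variety scl d \<and> (\<forall>m0\<in>S. \<forall>\<^sub>F m in zar scl gs d m0. m \<in> S)"
proof
  let ?N = "length gs"
  have mt: "map m gs \<in> mat_tuples ?N d" if "m \<in> mod_variety scl d" for m
    using that by (auto simp: mat_tuples_def mod_variety_def)
  {
    assume "openin (mod_topology scl gs d) S"
    then obtain P where P: "P \<subseteq> polyfuns ?N d"
      "S = (\<lambda>m. map m gs) -` (mat_tuples ?N d - zero_locus ?N d P) \<inter> mod_variety scl d"
      unfolding mod_topology_def openin_pullback_topology openin_zariski by blast
    have "\<forall>\<^sub>F m in zar scl gs d m0. m \<in> S" if "m0 \<in> S" for m0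
    proof -
      obtain p where p: "p \<in> P" "p (map m0 gs) \<noteq> 0"
        using \<open>m0 \<in> S\<close> unfolding P(2) zero_locus_def by blast
      have "m \<in> S" if "m \<in> mod_variety scl d" "p (map m gs) \<noteq> 0" for m
        using that p(1) mt unfolding P(2) zero_locus_def by blast
      moreover have "(\<lambda>m. p (map m gs)) \<in> reg scl gs d"
        using p(1) P(1) by (auto simp: reg_def)
      ultimately show ?thesis
        unfolding eventually_zar using p(2) by (intro bexI[of _ "\<lambda>m. p (map m gs)"]) auto
    qed
    then show "S \<subseteq> mod_variety scl d \<and> (\<forall>m0\<in>S. \<forall>\<^sub>F m in zar scl gs d m0. m \<in> S)"
      using P(2) by blast
  next
    assume S: "S \<subseteq> mod_variety scl d \<and> (\<forall>m0\<in>S. \<forall>\<^sub>F m in zar scl gs d m0. m \<in> S)"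
    \<comment> \<open>All polynomials whose nonvanishing locus on the variety lies in
      \<open>S\<close>, so that their loci together form the largest open set inside
      \<open>S\<close>.\<close>
    define P where "P = {p \<in> polyfuns ?N d. \<forall>m\<in>mod_variety scl d. p (map m gs) \<noteq> 0 \<longrightarrow> m \<in> S}"
    have "\<exists>p\<in>P. p (map m0 gs) \<noteq> 0" if "m0 \<in> S" for m0
    proof -
      obtain f where f: "f \<in> reg scl gs d" "f m0 \<noteq> 0" "\<And>m. m \<in> mod_variety scl d \<Longrightarrow> f m \<noteq> 0 \<Longrightarrow> m \<in> S"
        using S \<open>m0 \<in> S\<close> unfolding eventually_zar by blast
      obtain p where p: "p \<in> polyfuns ?N d" "\<And>m. m \<in> mod_variety scl d \<Longrightarrow> f m = p (map m gs)"
        using f(1) unfolding reg_def by blast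
      have "p \<in> P" using p f(3) by (auto simp: P_def)
      moreover have "p (map m0 gs) \<noteq> 0" using p(2)[of m0] S that f(2) by auto
      ultimately show ?thesis by blast
    qed
    then have "S = (\<lambda>m. map m gs) -` (mat_tuples ?N d - zero_locus ?N d P) \<inter> mod_variety scl d"
      using S mt by (auto simp: zero_locus_def P_def)
    moreover have "P \<subseteq> polyfuns ?N d" by (auto simp: P_def)
    ultimately show "openin (mod_topology scl gs d) S"
      unfolding mod_topology_def openin_pullback_topology openin_zariski by blast
  }
qed

section \<open>Matrix entries of arbitrary algebra elements as regular functions\<close>

lemma generates_induct:
  assumes "generates_algebra scl (set gs)"
    and "\<And>g. g \<in> set gs \<Longrightarrow> P g" "\<And>c. P (scl c 1)"
    and "\<And>a b. P a \<Longrightarrow> P b \<Longrightarrow> P (a + b)" "\<And>a b. P a \<Longrightarrow> P b \<Longrightarrow> P (a * b)"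
    and alg: "k_algebra scl"
  shows "P a"
proof -
  interpret k_algebra scl by fact
  have "subalgebra scl {a. P a}"
    unfolding subalgebra_def
  proof (intro conjI ballI allI)
    show "0 \<in> {a. P a}" using assms(3)[of 0] by simp
    show "1 \<in> {a. P a}" using assms(3)[of 1] by simp
    \<comment> \<open>A scalar multiple of \<open>a\<close> is the product of \<open>scl c 1\<close>
      and \<open>a\<close>, so the rules for constants and products cover it.\<close>
    show "scl c a \<in> {a. P a}" if "a \<in> {a. P a}" for c a
      using assms(5)[OF assms(3)[of c], of a] that scale_mult_left[of c 1 a] by simp
  qed (use assms in auto)
  then have "subalgebra scl hull (set gs) \<subseteq> {a. P a}"
    using assms(2) by (intro hull_minimal) auto
  then show ?thesis using assms(1) by (auto simp: generates_algebra_def)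
qed

text \<open>One expression of \<open>a\<close> through the generators works for every
  \<open>m\<close> at once, so its entries are given by the same polynomials on the whole
  variety.\<close>

lemma reg_entry:
  fixes scl :: "'k::field \<Rightarrow> 'a::{ring,monoid_mult} \<Rightarrow> 'a"
  assumes alg: "k_algebra scl" and gen: "generates_algebra scl (set gs)" and ij: "i < d" "j < d"
  shows "(\<lambda>m. m a $$ (i, j)) \<in> reg scl gs d"
proof -
  have cong: "f \<in> reg scl gs d" if "g \<in> reg scl gs d" "\<And>m. m \<in> mod_variety scl d \<Longrightarrow> f m = g m" for f g
    using that unfolding reg_def by auto
  have reg_sum: "(\<lambda>m. \<Sum>k\<in>K. f k m) \<in> reg scl gs d" if "\<And>k. k \<in> K \<Longrightarrow> f k \<in> reg scl gs d" for f and K :: "nat set"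
    using that by (induction K rule: infinite_finite_induct) (simp_all add: reg_const reg_add)
  have carr: "m a \<in> carrier_mat d d" if "m \<in> mod_variety scl d" for m a
    using that by (auto simp: mod_variety_def)
  have "\<forall>i<d. \<forall>j<d. (\<lambda>m. m a $$ (i, j)) \<in> reg scl gs d"
  proof (induction a rule: generates_induct[OF gen _ _ _ _ alg])
    case (1 g)
    then obtain l where l: "l < length gs" "g = gs ! l" by (metis in_set_conv_nth)
    then show ?case
      unfolding reg_def
      by (auto intro!: bexI[of _ "\<lambda>X. (X ! l) $$ (i, j)" for i j] polyfuns.coord)
  next
    case (2 c)
    show ?case
    proof (intro allI impI)
      fix i j assume ij: "i < d" "j < d"
      show "(\<lambda>m. m (scl c 1) $$ (i, j)) \<in> reg scl gs d"
        by (rule cong[OF reg_const[of "c * (if i = j then 1 else 0)"]])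
          (use ij in \<open>auto simp: mod_variety_def\<close>)
    qed
  next
    case (3 a b)
    show ?case
    proof (intro allI impI)
      fix i j assume ij: "i < d" "j < d"
      show "(\<lambda>m. m (a + b) $$ (i, j)) \<in> reg scl gs d"
      proof (rule cong[OF reg_add])
        show "(\<lambda>m. m a $$ (i, j)) \<in> reg scl gs d" "(\<lambda>m. m b $$ (i, j)) \<in> reg scl gs d"
          using 3 ij by auto
        show "m (a + b) $$ (i, j) = m a $$ (i, j) + m b $$ (i, j)" if "m \<in> mod_variety scl d" for m
          using carrier_matD[OF carr[OF that, of b]] that ij by (simp add: mod_variety_def)
      qed
    qed
  next
    case (4 a b)
    show ?case
    proof (intro allI impI)
      fix i j assume ij: "i < d" "j < d"
      show "(\<lambda>m. m (a * b) $$ (i, j)) \<in> reg scl gs d"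
      proof (rule cong[OF reg_sum])
        show "(\<lambda>m. m a $$ (i, k) * m b $$ (k, j)) \<in> reg scl gs d" if "k \<in> {0..<d}" for k
          using 4 ij that by (intro reg_mult) auto
        show "m (a * b) $$ (i, j) = (\<Sum>k\<in>{0..<d}. m a $$ (i, k) * m b $$ (k, j))" if "m \<in> mod_variety scl d" for m
          using carrier_matD[OF carr[OF that, of a]] carrier_matD[OF carr[OF that, of b]] that ij
          by (auto simp: mod_variety_def scalar_prod_def intro!: sum.cong)
      qed
    qed
  qed
  then show ?thesis using ij by blast
qed

section \<open>Row modules and subspaces\<close>

lemma mod_varietyD:
  assumes "m \<in> mod_variety scl d"
  shows "m a \<in> carrier_mat d d" "dim_row (m a) = d" "dim_col (m a) = d"
    "m (a + b) = m a + m b" "m (a * b) = m a * m b" "m (scl c a) = c \<cdot>\<^sub>m m a" "m 1 = 1\<^sub>m d"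
  using assms by (auto simp: mod_variety_def)

lemma row_module_simps:
  "carrier (row_module d m) = carrier_vec d"
  "\<zero>\<^bsub>row_module d m\<^esub> = 0\<^sub>v d"
  "x \<oplus>\<^bsub>row_module d m\<^esub> y = x + y"
  "a \<odot>\<^bsub>row_module d m\<^esub> x = transpose_mat (m a) *\<^sub>v x"
  by (simp_all add: row_module_def)

lemma right_module_row_module:
  fixes m :: "'a::{ring,monoid_mult} \<Rightarrow> 'k::field mat"
  assumes "m \<in> mod_variety scl d"
  shows "right_module (row_module d m)"
proof -
  note mD = mod_varietyD[OF assms]
  let ?N = "row_module d m"
  have "abelian_group ?N"
  proof (rule abelian_groupI)
    fix x assume "x \<in> carrier ?N"
    then show "\<exists>y\<in>carrier ?N. y \<oplus>\<^bsub>?N\<^esub> x = \<zero>\<^bsub>?N\<^esub>"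
      by (intro bexI[of _ "- x"]) (auto simp: row_module_simps)
  qed (auto simp: row_module_simps intro: comm_add_vec)
  then interpret abelian_group ?N .
  have t: "transpose_mat (m a) \<in> carrier_mat d d" for a using mD(1) by simp
  show ?thesis
  proof unfold_locales
    fix x a assume "x \<in> carrier ?N"
    then show "a \<odot>\<^bsub>?N\<^esub> x \<in> carrier ?N"
      unfolding row_module_simps by (rule mult_mat_vec_carrier[OF t])
  next
    fix x a b assume "x \<in> carrier ?N"
    then show "(a + b) \<odot>\<^bsub>?N\<^esub> x = a \<odot>\<^bsub>?N\<^esub> x \<oplus>\<^bsub>?N\<^esub> b \<odot>\<^bsub>?N\<^esub> x"
      using t add_mult_distrib_mat_vec[OF t t] transpose_add[OF mD(1) mD(1)]
      by (simp add: row_module_simps mD(4))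
  next
    fix x y a assume "x \<in> carrier ?N" "y \<in> carrier ?N"
    then show "a \<odot>\<^bsub>?N\<^esub> (x \<oplus>\<^bsub>?N\<^esub> y) = a \<odot>\<^bsub>?N\<^esub> x \<oplus>\<^bsub>?N\<^esub> a \<odot>\<^bsub>?N\<^esub> y"
      using mult_add_distrib_mat_vec[OF t] by (simp add: row_module_simps)
  next
    fix x a b assume "x \<in> carrier ?N"
    then show "(a * b) \<odot>\<^bsub>?N\<^esub> x = b \<odot>\<^bsub>?N\<^esub> (a \<odot>\<^bsub>?N\<^esub> x)"
      using assoc_mult_mat_vec[OF t t] transpose_mult[OF mD(1) mD(1)]
      by (simp add: row_module_simps mD(5))
  next
    fix x assume "x \<in> carrier ?N"
    then show "1 \<odot>\<^bsub>?N\<^esub> x = x"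
      by (simp add: row_module_simps mD(7))
  qed
qed

text \<open>Scalars act through the elements \<open>scl c 1\<close> of the algebra, so submodules
  are subspaces.\<close>

lemma rsubmodule_row_module_smult:
  assumes m: "m \<in> mod_variety scl d" and U: "rsubmodule U (row_module d m)" and v: "v \<in> U"
  shows "c \<cdot>\<^sub>v v \<in> U"
proof -
  interpret right_module "row_module d m" using right_module_row_module[OF m] .
  have vc: "v \<in> carrier_vec d" using rsubmoduleD(1)[OF U] v by (auto simp: row_module_simps)
  have "transpose_mat (c \<cdot>\<^sub>m 1\<^sub>m d) = c \<cdot>\<^sub>m 1\<^sub>m d"
    by (intro eq_matI) auto
  then have "scl c 1 \<odot>\<^bsub>row_module d m\<^esub> v = c \<cdot>\<^sub>v v"
    using vc by (auto simp: row_module_simps mod_varietyD(6,7)[OF m] intro!: eq_vecI)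
  then show ?thesis using rsubmoduleD(4)[OF U v, of "scl c 1"] by simp
qed

section \<open>Explicit inverses and bases adapted to a subspace\<close>

lemma mult_mat_vec_unit:
  fixes A :: "'k::field mat"
  assumes "A \<in> carrier_mat n m" "k < m"
  shows "A *\<^sub>v unit_vec m k = col A k"
  using assms by (intro eq_vecI) auto

text \<open>The inverse is written through the adjugate because in this form its entries are visibly
  rational in those of \<open>A\<close>, as the neighbourhood argument requires.\<close>

lemma det_nonzero_inverse:
  fixes A :: "'k::field mat"
  assumes A: "A \<in> carrier_mat n n" and "det A \<noteq> 0"
  defines "S \<equiv> inverse (det A) \<cdot>\<^sub>m adj_mat A"
  shows "S \<in> carrier_mat n n" "A * S = 1\<^sub>m n" "S * A = 1\<^sub>m n"
proof -
  note adj = adj_mat[OF A]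
  show "S \<in> carrier_mat n n" using adj(1) by (simp add: S_def)
  have "A * S = inverse (det A) \<cdot>\<^sub>m (A * adj_mat A)"
    unfolding S_def by (rule mult_smult_distrib[OF A adj(1)])
  then show "A * S = 1\<^sub>m n"
    using assms(2) by (auto simp: adj(2) intro!: eq_matI)
  have "S * A = inverse (det A) \<cdot>\<^sub>m (adj_mat A * A)"
    unfolding S_def by (rule mult_smult_assoc_mat[OF adj(1) A])
  then show "S * A = 1\<^sub>m n"
    using assms(2) by (auto simp: adj(3) intro!: eq_matI)
qed

text \<open>Exchange argument: \<open>e\<close> is the largest number of leading columns of an
  invertible matrix that fit into \<open>U\<close>. A vector of \<open>U\<close> with a nonzero
  coordinate at a place \<open>j \<ge> e\<close> could be exchanged in, contradicting
  maximality.\<close>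

lemma subspace_basis:
  fixes U :: "'k::field vec set"
  assumes Uc: "U \<subseteq> carrier_vec d" and U0: "0\<^sub>v d \<in> U"
    and Uadd: "\<And>x y. x \<in> U \<Longrightarrow> y \<in> U \<Longrightarrow> x + y \<in> U" and Usmult: "\<And>c x. x \<in> U \<Longrightarrow> c \<cdot>\<^sub>v x \<in> U"
  obtains C S e where "C \<in> carrier_mat d d" "S \<in> carrier_mat d d" "C * S = 1\<^sub>m d" "S * C = 1\<^sub>m d" "e \<le> d"
    "U = {v \<in> carrier_vec d. \<forall>k. e \<le> k \<longrightarrow> k < d \<longrightarrow> (S *\<^sub>v v) $ k = 0}"
proof -
  define P where "P e \<longleftrightarrow> e \<le> d \<and> (\<exists>C\<in>carrier_mat d d. det C \<noteq> 0 \<and> (\<forall>j<e. col C j \<in> U))" for e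
  have "P 0" unfolding P_def by (auto intro!: bexI[of _ "1\<^sub>m d"])
  have "\<exists>e. P e \<and> \<not> P (Suc e)"
  proof (rule ccontr)
    assume *: "\<not> (\<exists>e. P e \<and> \<not> P (Suc e))"
    have "P n" for n
      by (induction n) (use * \<open>P 0\<close> in auto)
    from this[of "Suc d"] show False by (simp add: P_def)
  qed
  then obtain e where e: "P e" "\<not> P (Suc e)" by blast
  obtain C where C: "C \<in> carrier_mat d d" "det C \<noteq> 0" "\<And>j. j < e \<Longrightarrow> col C j \<in> U" and ed: "e \<le> d"
    using e(1) unfolding P_def by blast
  define S where "S = inverse (det C) \<cdot>\<^sub>m adj_mat C"
  note S = det_nonzero_inverse[OF C(1,2), folded S_def]
  have "U = {v \<in> carrier_vec d. \<forall>k. e \<le> k \<longrightarrow> k < d \<longrightarrow> (S *\<^sub>v v) $ k = 0}"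
  proof (intro equalityI subsetI)
    fix v assume v: "v \<in> {v \<in> carrier_vec d. \<forall>k. e \<le> k \<longrightarrow> k < d \<longrightarrow> (S *\<^sub>v v) $ k = 0}"
    define w where "w = S *\<^sub>v v"
    have w: "w \<in> carrier_vec d" "\<And>k. e \<le> k \<Longrightarrow> k < d \<Longrightarrow> w $ k = 0" using v S(1) by (auto simp: w_def)
    have Cw: "C *\<^sub>v w = v"
      using v assoc_mult_mat_vec[OF C(1) S(1), of v] S(2) by (simp add: w_def)
    have "C *\<^sub>v vec d (\<lambda>k. if k < n then w $ k else 0) \<in> U" if "n \<le> e" for n
      using that
    proof (induction n)
      case 0
      have "C *\<^sub>v vec d (\<lambda>k. if k < 0 then w $ k else 0) = 0\<^sub>v d"
        using C(1) by (intro eq_vecI) (auto simp: scalar_prod_def)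
      then show ?case using U0 by simp
    next
      case (Suc n)
      have "vec d (\<lambda>k. if k < Suc n then w $ k else 0) =
          vec d (\<lambda>k. if k < n then w $ k else 0) + w $ n \<cdot>\<^sub>v unit_vec d n"
        using Suc.prems ed by (intro eq_vecI) (auto simp: less_Suc_eq)
      then have "C *\<^sub>v vec d (\<lambda>k. if k < Suc n then w $ k else 0) =
          C *\<^sub>v vec d (\<lambda>k. if k < n then w $ k else 0) + w $ n \<cdot>\<^sub>v col C n"
        using Suc.prems ed C(1) mult_mat_vec_unit[OF C(1), of n]
        by (simp add: mult_add_distrib_mat_vec[OF C(1)] mult_mat_vec[OF C(1)])
      then show ?case using Suc C(3) Uadd Usmult by simp
    qed
    from this[of e] have "C *\<^sub>v vec d (\<lambda>k. if k < e then w $ k else 0) \<in> U" by simp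
    moreover have "vec d (\<lambda>k. if k < e then w $ k else 0) = w"
      using w by (intro eq_vecI) auto
    ultimately show "v \<in> U" using Cw by simp
  next
    fix v assume v: "v \<in> U"
    then have vc: "v \<in> carrier_vec d" using Uc by blast
    define w where "w = S *\<^sub>v v"
    have w: "w \<in> carrier_vec d" using vc S(1) by (auto simp: w_def)
    have Cw: "C *\<^sub>v w = v"
      using vc assoc_mult_mat_vec[OF C(1) S(1), of v] S(2) by (simp add: w_def)
    have "w $ j = 0" if j: "e \<le> j" "j < d" for j
    proof (rule ccontr)
      assume nz: "w $ j \<noteq> 0"
      \<comment> \<open>Column \<open>e\<close> becomes \<open>w\<close>, so \<open>C * W\<close>
        has \<open>v\<close> there; the former basis vector at \<open>e\<close> moves to place
        \<open>j\<close>. For \<open>j = e\<close> the first case prevails. The only nonzero entry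
        of row \<open>j\<close> is \<open>w $ j\<close> in column \<open>e\<close>, from which
        invertibility follows.\<close>
      define W where "W = mat d d (\<lambda>(i,k). if k = e then w $ i
        else if k = j then (if i = e then 1 else 0) else (if i = k then 1 else 0))"
      have W: "W \<in> carrier_mat d d" by (simp add: W_def)
      have e': "e < d" using j by simp
      have "det W \<noteq> 0"
      proof
        assume "det W = 0"
        then obtain x where x: "x \<in> carrier_vec d" "x \<noteq> 0\<^sub>v d" "W *\<^sub>v x = 0\<^sub>v d"
          using det_0_iff_vec_prod_zero[OF W] by blast
        have row: "(\<Sum>k\<in>{0..<d}. W $$ (i, k) * x $ k) = 0" if "i < d" for i
        proof -
          have "(W *\<^sub>v x) $ i = (\<Sum>k\<in>{0..<d}. W $$ (i, k) * x $ k)"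
            using W x(1) that by (auto simp: scalar_prod_def)
          then show ?thesis using x(3) that by simp
        qed
        have xe: "x $ e = 0"
        proof -
          have "(\<Sum>k\<in>{0..<d}. W $$ (j, k) * x $ k) = (\<Sum>k\<in>{0..<d}. if k = e then w $ j * x $ e else 0)"
            using j by (intro sum.cong) (auto simp: W_def)
          then show ?thesis using row[OF j(2)] e' nz by simp
        qed
        have "x $ i = 0" if i: "i < d" for i
        proof (cases "i = e")
          case False
          \<comment> \<open>The row whose only nonzero entry outside column \<open>e\<close> is the
            1 in column \<open>i\<close>.\<close>
          let ?r = "if i = j then e else i"
          have "(\<Sum>k\<in>{0..<d}. W $$ (?r, k) * x $ k) = (\<Sum>k\<in>{0..<d}. if k = i then x $ i else 0)"
            using i False e' xe by (intro sum.cong) (auto simp: W_def)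
          then show ?thesis using row[of ?r] i e' by simp
        qed (use xe in simp)
        then show False using x(1,2) by auto
      qed
      then have "det (C * W) \<noteq> 0" using C(1,2) W by (simp add: det_mult)
      moreover have "col (C * W) k \<in> U" if k: "k < Suc e" for k
      proof -
        have "col (C * W) k = C *\<^sub>v col W k" using k e' by (intro col_mult2[OF C(1) W]) simp
        moreover have "\<dots> \<in> U"
        proof (cases "k = e")
          case True
          have "col W e = w" using W e' w by (intro eq_vecI) (auto simp: W_def)
          then show ?thesis using True Cw v by simp
        next
          case False
          have "col W k = unit_vec d k" using W k False j e' by (intro eq_vecI) (auto simp: W_def)
          then show ?thesis using mult_mat_vec_unit[OF C(1)] k False e' C(3) by simp
        qed
        ultimately show ?thesis by simp
      qed
      ultimately have "P (Suc e)"
        unfolding P_def using e' C(1) W by (intro conjI bexI[of _ "C * W"]) auto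
      then show False using e(2) by simp
    qed
    then show "v \<in> {v \<in> carrier_vec d. \<forall>k. e \<le> k \<longrightarrow> k < d \<longrightarrow> (S *\<^sub>v v) $ k = 0}"
      using vc by (simp add: w_def)
  qed
  then show ?thesis using that C(1) S ed by blast
qed

section \<open>Block triangular form of a representation along a submodule\<close>

locale row_block =
  fixes scl :: "'k::field \<Rightarrow> 'a::{ring,monoid_mult} \<Rightarrow> 'a"
    and d e :: nat and q :: "'a \<Rightarrow> 'k mat" and C S :: "'k mat"
  assumes q: "q \<in> mod_variety scl d" and C: "C \<in> carrier_mat d d" and S: "S \<in> carrier_mat d d"
    and CS: "C * S = 1\<^sub>m d" and SC: "S * C = 1\<^sub>m d" and ed: "e \<le> d"
    and zero: "i < e \<Longrightarrow> e \<le> k \<Longrightarrow> k < d \<Longrightarrow> (S * transpose_mat (q a) * C) $$ (k, i) = 0"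
begin

text \<open>The action of \<open>a\<close> in the basis of columns of \<open>C\<close>, whose first
  \<open>e\<close> members span the submodule. Because of the transpose it reverses products; the
  swapped indices in \<open>sub_rep\<close> and \<open>quot_rep\<close> restore the order. The
  matrices \<open>C\<close> and \<open>S\<close> are parameters of the locale since they will vary
  with \<open>q\<close>.\<close>

definition \<Gamma> where "\<Gamma> a = S * transpose_mat (q a) * C"
definition sub_rep where "sub_rep a = mat e e (\<lambda>(i,j). \<Gamma> a $$ (j, i))"
definition quot_rep where "quot_rep a = mat (d - e) (d - e) (\<lambda>(i,j). \<Gamma> a $$ (j + e, i + e))"
definition U where "U = {v \<in> carrier_vec d. \<forall>k. e \<le> k \<longrightarrow> k < d \<longrightarrow> (S *\<^sub>v v) $ k = 0}"

lemma qt: "transpose_mat (q a) \<in> carrier_mat d d"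
  using mod_varietyD(1)[OF q] by simp

lemma \<Gamma>_carrier: "\<Gamma> a \<in> carrier_mat d d"
  unfolding \<Gamma>_def using S C qt by auto

lemma \<Gamma>_add: "\<Gamma> (a + b) = \<Gamma> a + \<Gamma> b"
  unfolding \<Gamma>_def mod_varietyD(4)[OF q] transpose_add[OF mod_varietyD(1)[OF q] mod_varietyD(1)[OF q]]
    mult_add_distrib_mat[OF S qt qt]
  by (rule add_mult_distrib_mat[OF mult_carrier_mat[OF S qt] mult_carrier_mat[OF S qt] C])

lemma \<Gamma>_mult: "\<Gamma> (a * b) = \<Gamma> b * \<Gamma> a"
proof -
  have *: "S * B * C * (S * A * C) = S * (B * A) * C"
    if A: "A \<in> carrier_mat d d" and B: "B \<in> carrier_mat d d" for A B
  proof -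
    note c = mult_carrier_mat[of _ d d _ d] and assoc = assoc_mult_mat[of _ d d _ d _ d]
    have "S * B * C * (S * A * C) = S * B * (C * S) * (A * C)"
      using S C A B by (simp add: assoc c)
    also have "\<dots> = S * (B * A) * C"
      using S C A B by (simp add: CS assoc c)
    finally show ?thesis .
  qed
  have "\<Gamma> b * \<Gamma> a = S * (transpose_mat (q b) * transpose_mat (q a)) * C"
    unfolding \<Gamma>_def by (rule *[OF qt qt])
  also have "\<dots> = \<Gamma> (a * b)"
    unfolding \<Gamma>_def mod_varietyD(5)[OF q] transpose_mult[OF mod_varietyD(1)[OF q] mod_varietyD(1)[OF q]] ..
  finally show ?thesis by simp
qed

lemma \<Gamma>_scl: "\<Gamma> (scl c a) = c \<cdot>\<^sub>m \<Gamma> a"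
proof -
  have "transpose_mat (c \<cdot>\<^sub>m q a) = c \<cdot>\<^sub>m transpose_mat (q a)"
    by (intro eq_matI) auto
  then show ?thesis
    unfolding \<Gamma>_def mod_varietyD(6)[OF q]
    by (simp only: mult_smult_distrib[OF S qt] mult_smult_assoc_mat[OF mult_carrier_mat[OF S qt] C])
qed

lemma \<Gamma>_one: "\<Gamma> 1 = 1\<^sub>m d"
  unfolding \<Gamma>_def mod_varietyD(7)[OF q] using S C SC by simp

lemma \<Gamma>_zero: "i < e \<Longrightarrow> e \<le> k \<Longrightarrow> k < d \<Longrightarrow> \<Gamma> a $$ (k, i) = 0"
  unfolding \<Gamma>_def by (rule zero)

lemma \<Gamma>_mult_entry:
  assumes "i < d" "j < d"
  shows "\<Gamma> (a * b) $$ (i, j) = (\<Sum>k\<in>{0..<d}. \<Gamma> b $$ (i, k) * \<Gamma> a $$ (k, j))"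
  using \<Gamma>_carrier[of a] \<Gamma>_carrier[of b] assms by (simp add: \<Gamma>_mult scalar_prod_def)

lemma \<Gamma>_dims[simp]: "dim_row (\<Gamma> a) = d" "dim_col (\<Gamma> a) = d"
  using \<Gamma>_carrier[of a] by auto

lemma sum_low:
  fixes f :: "nat \<Rightarrow> 'k"
  assumes "\<And>k. e \<le> k \<Longrightarrow> k < d \<Longrightarrow> f k = 0"
  shows "(\<Sum>k\<in>{0..<d}. f k) = (\<Sum>k\<in>{0..<e}. f k)"
  using ed assms by (intro sum.mono_neutral_right) auto

lemma sum_high:
  fixes f :: "nat \<Rightarrow> 'k"
  assumes "\<And>k. k < e \<Longrightarrow> f k = 0"
  shows "(\<Sum>k\<in>{0..<d}. f k) = (\<Sum>k\<in>{0..<d - e}. f (k + e))"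
proof -
  have "(\<Sum>k\<in>{0..<d}. f k) = (\<Sum>k\<in>{0 + e..<(d - e) + e}. f k)"
    using ed assms by (intro sum.mono_neutral_right) auto
  then show ?thesis by (simp only: sum.shift_bounds_nat_ivl)
qed

lemma sub_rep_variety: "sub_rep \<in> mod_variety scl e"
  unfolding mod_variety_def
proof (intro CollectI conjI allI)
  show "sub_rep (a * b) = sub_rep a * sub_rep b" for a b
  proof (rule eq_matI)
    fix i j assume "i < dim_row (sub_rep a * sub_rep b)" "j < dim_col (sub_rep a * sub_rep b)"
    then have ij: "i < e" "j < e" by (auto simp: sub_rep_def)
    have "sub_rep (a * b) $$ (i, j) = (\<Sum>k\<in>{0..<d}. \<Gamma> b $$ (j, k) * \<Gamma> a $$ (k, i))"
      using ij ed by (simp add: sub_rep_def \<Gamma>_mult_entry)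
    also have "\<dots> = (\<Sum>k\<in>{0..<e}. \<Gamma> b $$ (j, k) * \<Gamma> a $$ (k, i))"
      using ij by (intro sum_low) (simp add: \<Gamma>_zero)
    also have "\<dots> = (sub_rep a * sub_rep b) $$ (i, j)"
      using ij by (auto simp: sub_rep_def scalar_prod_def mult.commute intro!: sum.cong)
    finally show "sub_rep (a * b) $$ (i, j) = (sub_rep a * sub_rep b) $$ (i, j)" .
  qed (auto simp: sub_rep_def)
qed (use ed in \<open>auto simp: sub_rep_def \<Gamma>_add \<Gamma>_scl \<Gamma>_one intro!: eq_matI\<close>)

lemma quot_rep_variety: "quot_rep \<in> mod_variety scl (d - e)"
  unfolding mod_variety_def
proof (intro CollectI conjI allI)
  show "quot_rep (a * b) = quot_rep a * quot_rep b" for a b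
  proof (rule eq_matI)
    fix i j assume "i < dim_row (quot_rep a * quot_rep b)" "j < dim_col (quot_rep a * quot_rep b)"
    then have ij: "i < d - e" "j < d - e" by (auto simp: quot_rep_def)
    have "quot_rep (a * b) $$ (i, j) = (\<Sum>k\<in>{0..<d}. \<Gamma> b $$ (j + e, k) * \<Gamma> a $$ (k, i + e))"
      using ij ed by (simp add: quot_rep_def \<Gamma>_mult_entry)
    also have "\<dots> = (\<Sum>k\<in>{0..<d - e}. \<Gamma> b $$ (j + e, k + e) * \<Gamma> a $$ (k + e, i + e))"
      using ij by (intro sum_high) (simp add: \<Gamma>_zero)
    also have "\<dots> = (quot_rep a * quot_rep b) $$ (i, j)"
      using ij by (auto simp: quot_rep_def scalar_prod_def mult.commute intro!: sum.cong)
    finally show "quot_rep (a * b) $$ (i, j) = (quot_rep a * quot_rep b) $$ (i, j)" .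
  qed (auto simp: quot_rep_def)
qed (use ed in \<open>auto simp: quot_rep_def \<Gamma>_add \<Gamma>_scl \<Gamma>_one intro!: eq_matI\<close>)

lemma S_action:
  assumes v: "v \<in> carrier_vec d"
  shows "S *\<^sub>v (transpose_mat (q a) *\<^sub>v v) = \<Gamma> a *\<^sub>v (S *\<^sub>v v)"
proof -
  have "\<Gamma> a *\<^sub>v (S *\<^sub>v v) = S *\<^sub>v (transpose_mat (q a) *\<^sub>v (C *\<^sub>v (S *\<^sub>v v)))"
    unfolding \<Gamma>_def using S C qt v by (simp add: assoc_mult_mat_vec[of _ d d _ d])
  also have "C *\<^sub>v (S *\<^sub>v v) = v"
    using assoc_mult_mat_vec[OF C S v] v by (simp add: CS)
  finally show ?thesis by simp
qed

lemma S_action_entry: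
  assumes "v \<in> carrier_vec d" "k < d"
  shows "(S *\<^sub>v (transpose_mat (q a) *\<^sub>v v)) $ k = (\<Sum>i\<in>{0..<d}. \<Gamma> a $$ (k, i) * (S *\<^sub>v v) $ i)"
  unfolding S_action[OF assms(1)] using assms S by (auto simp: scalar_prod_def)

abbreviation N where "N \<equiv> row_module d q"

lemma right_module_N: "right_module N"
  using right_module_row_module[OF q] .

text \<open>The zero block makes the last coordinates a homomorphism on all of \<open>N\<close>,
  while the first ones in \<open>sub_map\<close> are treated as a homomorphism on \<open>U\<close>
  only, where the remaining coordinates vanish.\<close>

definition quot_map where "quot_map v = vec (d - e) (\<lambda>k. (S *\<^sub>v v) $ (k + e))"
definition sub_map where "sub_map v = vec e (\<lambda>k. (S *\<^sub>v v) $ k)"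

lemma S_add: "v \<in> carrier_vec d \<Longrightarrow> w \<in> carrier_vec d \<Longrightarrow> S *\<^sub>v (v + w) = S *\<^sub>v v + S *\<^sub>v w"
  by (rule mult_add_distrib_mat_vec[OF S])

lemma S_dim[simp]: "dim_row S = d" "dim_col S = d"
  using S by auto

lemma quot_map_hom: "hom_on N (carrier N) (row_module (d - e) quot_rep) quot_map"
  unfolding hom_on_def row_module_simps
proof (intro conjI ballI allI)
  show "quot_map ` carrier_vec d \<subseteq> carrier_vec (d - e)" by (auto simp: quot_map_def)
  show "quot_map (v + w) = quot_map v + quot_map w" if "v \<in> carrier_vec d" "w \<in> carrier_vec d" for v w
    using that by (auto simp: quot_map_def S_add intro!: eq_vecI)
  show "quot_map (transpose_mat (q a) *\<^sub>v v) = transpose_mat (quot_rep a) *\<^sub>v quot_map v"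
    if v: "v \<in> carrier_vec d" for a v
  proof (rule eq_vecI)
    fix k assume "k < dim_vec (transpose_mat (quot_rep a) *\<^sub>v quot_map v)"
    then have k: "k < d - e" by (simp add: quot_rep_def)
    have "quot_map (transpose_mat (q a) *\<^sub>v v) $ k = (\<Sum>i\<in>{0..<d}. \<Gamma> a $$ (k + e, i) * (S *\<^sub>v v) $ i)"
      using k v by (simp add: quot_map_def S_action_entry del: index_mult_mat_vec)
    also have "\<dots> = (\<Sum>i\<in>{0..<d - e}. \<Gamma> a $$ (k + e, i + e) * (S *\<^sub>v v) $ (i + e))"
      using k by (intro sum_high) (simp add: \<Gamma>_zero)
    also have "\<dots> = (transpose_mat (quot_rep a) *\<^sub>v quot_map v) $ k"
      using k by (auto simp: quot_rep_def quot_map_def scalar_prod_def intro!: sum.cong)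
    finally show "quot_map (transpose_mat (q a) *\<^sub>v v) $ k = (transpose_mat (quot_rep a) *\<^sub>v quot_map v) $ k" .
  qed (auto simp: quot_map_def quot_rep_def)
qed

lemma S_C_vec: "w \<in> carrier_vec d \<Longrightarrow> S *\<^sub>v (C *\<^sub>v w) = w"
  using assoc_mult_mat_vec[OF S C] SC by simp

lemma C_S_vec: "v \<in> carrier_vec d \<Longrightarrow> C *\<^sub>v (S *\<^sub>v v) = v"
  using assoc_mult_mat_vec[OF C S] CS by simp

lemma quot_map_onto: "quot_map ` carrier N = carrier (row_module (d - e) quot_rep)"
proof
  show "quot_map ` carrier N \<subseteq> carrier (row_module (d - e) quot_rep)"
    using quot_map_hom by (simp add: hom_on_def)
  show "carrier (row_module (d - e) quot_rep) \<subseteq> quot_map ` carrier N"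
  proof
    fix y assume "y \<in> carrier (row_module (d - e) quot_rep)"
    then have y: "y \<in> carrier_vec (d - e)" by (simp add: row_module_simps)
    let ?w = "vec d (\<lambda>k. if k < e then 0 else y $ (k - e))"
    have w: "?w \<in> carrier_vec d" by simp
    have eq: "y = quot_map (C *\<^sub>v ?w)"
      using y by (auto simp: quot_map_def S_C_vec[OF w] intro!: eq_vecI)
    have mem: "C *\<^sub>v ?w \<in> carrier N"
      using C w by (auto simp: row_module_simps)
    show "y \<in> quot_map ` carrier N" by (subst eq) (rule imageI[OF mem])
  qed
qed

lemma quot_map_kernel: "v \<in> carrier N \<Longrightarrow> quot_map v = \<zero>\<^bsub>row_module (d - e) quot_rep\<^esub> \<longleftrightarrow> v \<in> U"
proof -
  assume v: "v \<in> carrier N"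
  have "quot_map v = 0\<^sub>v (d - e) \<longleftrightarrow> (\<forall>k<d - e. (S *\<^sub>v v) $ (k + e) = 0)"
    by (auto simp: quot_map_def vec_eq_iff)
  also have "\<dots> \<longleftrightarrow> (\<forall>k. e \<le> k \<longrightarrow> k < d \<longrightarrow> (S *\<^sub>v v) $ k = 0)"
    by (metis add_lessD1 add.commute le_add2 le_add_diff_inverse2 less_diff_conv)
  finally show ?thesis using v by (simp add: U_def row_module_simps)
qed

lemma U_rsubmodule: "rsubmodule U N"
proof -
  have "U = {x \<in> carrier N. quot_map x = \<zero>\<^bsub>row_module (d - e) quot_rep\<^esub>}"
    using quot_map_kernel by (auto simp: U_def row_module_simps)
  then show ?thesis
    using rsubmodule_kernel[OF right_module_N right_module_row_module[OF quot_rep_variety]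
        right_module.rsubmodule_carrier[OF right_module_N] quot_map_hom]
    by simp
qed

lemma factor_U: "factor N U {\<zero>\<^bsub>N\<^esub>} (row_module e sub_rep)"
proof -
  interpret N: right_module N by (rule right_module_N)
  have "hom_on N U (row_module e sub_rep) sub_map"
    unfolding hom_on_def row_module_simps
  proof (intro conjI ballI allI)
    show "sub_map ` U \<subseteq> carrier_vec e" by (auto simp: sub_map_def)
    show "sub_map (v + w) = sub_map v + sub_map w" if "v \<in> U" "w \<in> U" for v w
      using that ed by (auto simp: sub_map_def S_add U_def intro!: eq_vecI)
    show "sub_map (transpose_mat (q a) *\<^sub>v v) = transpose_mat (sub_rep a) *\<^sub>v sub_map v"
      if v: "v \<in> U" for a v
    proof (rule eq_vecI)
      fix k assume "k < dim_vec (transpose_mat (sub_rep a) *\<^sub>v sub_map v)"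
      then have k: "k < e" by (simp add: sub_rep_def)
      have "sub_map (transpose_mat (q a) *\<^sub>v v) $ k = (\<Sum>i\<in>{0..<d}. \<Gamma> a $$ (k, i) * (S *\<^sub>v v) $ i)"
        using k v ed by (simp add: sub_map_def S_action_entry U_def del: index_mult_mat_vec)
      also have "\<dots> = (\<Sum>i\<in>{0..<e}. \<Gamma> a $$ (k, i) * (S *\<^sub>v v) $ i)"
        using v by (intro sum_low) (simp add: U_def)
      also have "\<dots> = (transpose_mat (sub_rep a) *\<^sub>v sub_map v) $ k"
        using k by (auto simp: sub_rep_def sub_map_def scalar_prod_def intro!: sum.cong)
      finally show "sub_map (transpose_mat (q a) *\<^sub>v v) $ k = (transpose_mat (sub_rep a) *\<^sub>v sub_map v) $ k" .
    qed (auto simp: sub_map_def sub_rep_def)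
  qed
  moreover have "sub_map ` U = carrier (row_module e sub_rep)"
  proof
    show "sub_map ` U \<subseteq> carrier (row_module e sub_rep)" by (auto simp: sub_map_def row_module_simps)
    show "carrier (row_module e sub_rep) \<subseteq> sub_map ` U"
    proof
      fix y assume "y \<in> carrier (row_module e sub_rep)"
      then have y: "y \<in> carrier_vec e" by (simp add: row_module_simps)
      let ?w = "vec d (\<lambda>k. if k < e then y $ k else 0)"
      have w: "?w \<in> carrier_vec d" by simp
      have eq: "y = sub_map (C *\<^sub>v ?w)"
        using y ed by (auto simp: sub_map_def S_C_vec[OF w] intro!: eq_vecI)
      have mem: "C *\<^sub>v ?w \<in> U"
        using C w by (auto simp: U_def S_C_vec[OF w] simp del: index_mult_mat_vec)
      show "y \<in> sub_map ` U" by (subst eq) (rule imageI[OF mem])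
    qed
  qed
  moreover have "sub_map v = \<zero>\<^bsub>row_module e sub_rep\<^esub> \<longleftrightarrow> v \<in> {\<zero>\<^bsub>N\<^esub>}" if v: "v \<in> U" for v
  proof
    assume "sub_map v = \<zero>\<^bsub>row_module e sub_rep\<^esub>"
    then have "(S *\<^sub>v v) $ k = 0" if "k < d" for k
      using v that by (cases "k < e") (auto simp: sub_map_def U_def row_module_simps vec_eq_iff)
    then have "S *\<^sub>v v = 0\<^sub>v d" by (intro eq_vecI) auto
    moreover have "v = C *\<^sub>v (S *\<^sub>v v)" using v C_S_vec by (simp add: U_def)
    ultimately show "v \<in> {\<zero>\<^bsub>N\<^esub>}" using C by (auto simp: row_module_simps intro!: eq_vecI)
  next
    assume "v \<in> {\<zero>\<^bsub>N\<^esub>}"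
    moreover have "S *\<^sub>v 0\<^sub>v d = 0\<^sub>v d" by (intro eq_vecI) (auto simp: scalar_prod_def)
    ultimately show "sub_map v = \<zero>\<^bsub>row_module e sub_rep\<^esub>"
      using ed by (auto simp: sub_map_def row_module_simps intro!: eq_vecI)
  qed
  ultimately show ?thesis
    unfolding factor_def using U_rsubmodule N.rsubmodule_zero N.rsubmoduleD(2)[OF U_rsubmodule] by blast
qed

end

section \<open>Transport of filtrations\<close>

lemma factor_preimage:
  assumes N: "right_module N" and P: "right_module P"
    and \<pi>: "hom_on N (carrier N) P \<pi>" and onto: "\<pi> ` carrier N = carrier P"
    and fac: "factor P V W M"
  shows "factor N {x \<in> carrier N. \<pi> x \<in> V} {x \<in> carrier N. \<pi> x \<in> W} M"
proof -
  interpret N: right_module N by fact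
  interpret P: right_module P by fact
  have sub: "rsubmodule V P" "rsubmodule W P" "W \<subseteq> V" using fac by (auto simp: factor_def)
  have pre: "rsubmodule {x \<in> carrier N. \<pi> x \<in> T} N" if "rsubmodule T P" for T
    using P.rsubmoduleD[OF that] hom_onD[OF \<pi>] hom_on_zero[OF N P N.rsubmodule_carrier \<pi>]
    unfolding N.rsubmodule_iff by (auto simp: N.smult_closed)
  obtain \<rho> where \<rho>: "hom_on P V M \<rho>" "\<rho> ` V = carrier M" "\<And>x. x \<in> V \<Longrightarrow> \<rho> x = \<zero>\<^bsub>M\<^esub> \<longleftrightarrow> x \<in> W"
    using fac by (auto simp: factor_def)
  have "hom_on N {x \<in> carrier N. \<pi> x \<in> V} M (\<lambda>x. \<rho> (\<pi> x))"
    using hom_onD[OF \<pi>] hom_onD[OF \<rho>(1)] unfolding hom_on_def by auto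
  moreover have "(\<lambda>x. \<rho> (\<pi> x)) ` {x \<in> carrier N. \<pi> x \<in> V} = carrier M"
  proof -
    have *: "\<pi> ` {x \<in> carrier N. \<pi> x \<in> V} = V"
    proof (intro equalityI subsetI)
      fix y assume y: "y \<in> V"
      then have "y \<in> \<pi> ` carrier N" unfolding onto using P.rsubmoduleD(1)[OF sub(1)] by blast
      then show "y \<in> \<pi> ` {x \<in> carrier N. \<pi> x \<in> V}" using y by blast
    qed auto
    show ?thesis by (simp only: image_image[of \<rho> \<pi>, symmetric] * \<rho>(2))
  qed
  ultimately show ?thesis
    unfolding factor_def using pre sub \<rho>(3)
    by (intro conjI exI[of _ "\<lambda>x. \<rho> (\<pi> x)"]) auto
qed

text \<open>One half of the correspondence between submodules of a quotient and submodules above the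
  kernel; it lifts the filtration of a nearby cokernel.\<close>

lemma chain_preimage:
  assumes N: "right_module N" and P: "right_module P"
    and \<pi>: "hom_on N (carrier N) P \<pi>" and onto: "\<pi> ` carrier N = carrier P"
    and "chain P M J U V"
  shows "chain N M J {x \<in> carrier N. \<pi> x \<in> U} {x \<in> carrier N. \<pi> x \<in> V}"
  using assms(5)
proof (induction rule: chain.induct)
  case base
  have "rsubmodule {x \<in> carrier N. \<pi> x \<in> U} N"
  proof -
    interpret N: right_module N by fact
    interpret P: right_module P by fact
    show ?thesis
      using P.rsubmoduleD[OF base] hom_onD[OF \<pi>] hom_on_zero[OF N P N.rsubmodule_carrier \<pi>]
      unfolding N.rsubmodule_iff by (auto simp: N.smult_closed)
  qed
  then show ?case by (rule chain.base)
next
  case (step V i V')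
  show ?case
    by (rule chain.step[where M = M, OF step.IH step.hyps(2) factor_preimage[OF N P \<pi> onto step.hyps(3)]])
qed

lemma rsubmodule_image:
  assumes N: "right_module N" and P: "right_module P"
    and V: "rsubmodule V N" and \<pi>: "hom_on N V P \<pi>"
  shows "rsubmodule (\<pi> ` V) P"
proof -
  interpret N: right_module N by fact
  interpret P: right_module P by fact
  note VD = N.rsubmoduleD[OF V] and \<pi>D = hom_onD[OF \<pi>]
  show ?thesis
    unfolding P.rsubmodule_iff
  proof (intro conjI ballI allI)
    show "\<pi> ` V \<subseteq> carrier P" using \<pi>D(1) by blast
    show "\<zero>\<^bsub>P\<^esub> \<in> \<pi> ` V" using hom_on_zero[OF N P V \<pi>] VD(2) by (metis imageI)
  next
    fix x y assume "x \<in> \<pi> ` V" "y \<in> \<pi> ` V"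
    then obtain u v where uv: "u \<in> V" "v \<in> V" "x = \<pi> u" "y = \<pi> v" by blast
    then have "x \<oplus>\<^bsub>P\<^esub> y = \<pi> (u \<oplus>\<^bsub>N\<^esub> v)" using \<pi>D(2) by simp
    then show "x \<oplus>\<^bsub>P\<^esub> y \<in> \<pi> ` V" using VD(3)[OF uv(1,2)] by blast
  next
    fix a x assume "x \<in> \<pi> ` V"
    then obtain u where u: "u \<in> V" "x = \<pi> u" by blast
    then have "a \<odot>\<^bsub>P\<^esub> x = \<pi> (a \<odot>\<^bsub>N\<^esub> u)" using \<pi>D(3) by simp
    then show "a \<odot>\<^bsub>P\<^esub> x \<in> \<pi> ` V" using VD(4)[OF u(1)] by blast
  qed
qed

lemma hom_descend:
  assumes N: "right_module N" and P: "right_module P" and M: "right_module M"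
    and V: "rsubmodule V N" and \<pi>: "hom_on N V P \<pi>" and h: "hom_on N V M h"
    and ker: "\<And>x. x \<in> V \<Longrightarrow> \<pi> x = \<zero>\<^bsub>P\<^esub> \<Longrightarrow> h x = \<zero>\<^bsub>M\<^esub>"
  obtains g where "hom_on P (\<pi> ` V) M g" "\<And>x. x \<in> V \<Longrightarrow> g (\<pi> x) = h x"
proof -
  interpret N: right_module N by fact
  interpret P: right_module P by fact
  interpret M: right_module M by fact
  note VD = N.rsubmoduleD[OF V] and \<pi>D = hom_onD[OF \<pi>] and hD = hom_onD[OF h]
  have eq: "h x = h y" if xy: "x \<in> V" "y \<in> V" "\<pi> x = \<pi> y" for x y
  proof -
    have m: "x \<oplus>\<^bsub>N\<^esub> \<ominus>\<^bsub>N\<^esub> y \<in> V" using VD(3)[OF xy(1) VD(5)[OF xy(2)]] .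
    have "\<pi> (x \<oplus>\<^bsub>N\<^esub> \<ominus>\<^bsub>N\<^esub> y) = \<zero>\<^bsub>P\<^esub>"
      using \<pi>D(2)[OF xy(1) VD(5)[OF xy(2)]] hom_on_minus[OF N P V \<pi> xy(2)] xy(3) \<pi>D(1)[OF xy(2)]
      by (simp add: P.r_neg)
    then have "h x \<oplus>\<^bsub>M\<^esub> \<ominus>\<^bsub>M\<^esub> h y = \<zero>\<^bsub>M\<^esub>"
      using ker[OF m] hD(2)[OF xy(1) VD(5)[OF xy(2)]] hom_on_minus[OF N M V h xy(2)] by simp
    then show ?thesis
      using M.add.inv_solve_right'[of "\<zero>\<^bsub>M\<^esub>" "h x" "h y"] hD(1)[OF xy(1)] hD(1)[OF xy(2)] by simp
  qed
  define g where "g y = h (inv_into V \<pi> y)" for y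
  have g: "g (\<pi> x) = h x" if "x \<in> V" for x
    unfolding g_def using that inv_into_into[of "\<pi> x" \<pi> V] f_inv_into_f[of "\<pi> x" \<pi> V]
    by (intro eq) auto
  have "hom_on P (\<pi> ` V) M g"
    unfolding hom_on_def
  proof (intro conjI ballI allI)
    show "g ` \<pi> ` V \<subseteq> carrier M" using g hD(1) by auto
  next
    fix x y assume "x \<in> \<pi> ` V" "y \<in> \<pi> ` V"
    then obtain u v where uv: "u \<in> V" "v \<in> V" "x = \<pi> u" "y = \<pi> v" by blast
    then have "x \<oplus>\<^bsub>P\<^esub> y = \<pi> (u \<oplus>\<^bsub>N\<^esub> v)" using \<pi>D(2) by simp
    then show "g (x \<oplus>\<^bsub>P\<^esub> y) = g x \<oplus>\<^bsub>M\<^esub> g y" using g VD(3)[OF uv(1,2)] uv hD(2) by simp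
  next
    fix a x assume "x \<in> \<pi> ` V"
    then obtain u where u: "u \<in> V" "x = \<pi> u" by blast
    then have "a \<odot>\<^bsub>P\<^esub> x = \<pi> (a \<odot>\<^bsub>N\<^esub> u)" using \<pi>D(3) by simp
    then show "g (a \<odot>\<^bsub>P\<^esub> x) = a \<odot>\<^bsub>M\<^esub> g x" using g VD(4)[OF u(1)] u hD(3) by simp
  qed
  then show ?thesis using that g by blast
qed

text \<open>Since \<open>W\<close> contains the kernel of \<open>\<pi>\<close>, passing to images
  loses nothing of \<open>V / W\<close>.\<close>

lemma factor_image:
  assumes N: "right_module N" and P: "right_module P" and M: "right_module M"
    and \<pi>: "hom_on N (carrier N) P \<pi>"
    and ker: "\<And>x. x \<in> carrier N \<Longrightarrow> \<pi> x = \<zero>\<^bsub>P\<^esub> \<Longrightarrow> x \<in> W"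
    and fac: "factor N V W M"
  shows "factor P (\<pi> ` V) (\<pi> ` W) M"
proof -
  interpret N: right_module N by fact
  interpret P: right_module P by fact
  have sub: "rsubmodule V N" "rsubmodule W N" "W \<subseteq> V" using fac by (auto simp: factor_def)
  note VD = N.rsubmoduleD[OF sub(1)]
  obtain \<rho> where \<rho>: "hom_on N V M \<rho>" "\<rho> ` V = carrier M" "\<And>x. x \<in> V \<Longrightarrow> \<rho> x = \<zero>\<^bsub>M\<^esub> \<longleftrightarrow> x \<in> W"
    using fac by (auto simp: factor_def)
  have hV: "hom_on N V P \<pi>" using hom_on_subset[OF \<pi> VD(1)] .
  have hW: "hom_on N W P \<pi>" using hom_on_subset[OF hV sub(3)] .
  have "\<rho> x = \<zero>\<^bsub>M\<^esub>" if "x \<in> V" "\<pi> x = \<zero>\<^bsub>P\<^esub>" for x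
    using \<rho>(3)[OF that(1)] ker[OF _ that(2)] VD(1) that(1) by blast
  then obtain g where g: "hom_on P (\<pi> ` V) M g" "\<And>x. x \<in> V \<Longrightarrow> g (\<pi> x) = \<rho> x"
    using hom_descend[OF N P M sub(1) hV \<rho>(1)] by blast
  have "g ` \<pi> ` V = carrier M"
    unfolding \<rho>(2)[symmetric] image_image using g(2) by (intro image_cong) auto
  moreover have "g y = \<zero>\<^bsub>M\<^esub> \<longleftrightarrow> y \<in> \<pi> ` W" if y: "y \<in> \<pi> ` V" for y
  proof -
    obtain v where v: "v \<in> V" "y = \<pi> v" using y by blast
    have "v \<in> W" if v': "\<pi> v \<in> \<pi> ` W"
    proof -
      obtain w where w: "w \<in> W" "\<pi> v = \<pi> w" using v' by blast
      have wV: "w \<in> V" using w(1) sub(3) by blast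
      have c: "v \<in> carrier N" "w \<in> carrier N" using VD(1) v(1) wV by auto
      have "\<pi> (v \<oplus>\<^bsub>N\<^esub> \<ominus>\<^bsub>N\<^esub> w) = \<zero>\<^bsub>P\<^esub>"
        using hom_onD(2)[OF hV v(1) VD(5)[OF wV]] hom_on_minus[OF N P sub(1) hV wV] w(2) hom_onD(1)[OF hV wV]
        by (simp add: P.r_neg)
      then have "v \<oplus>\<^bsub>N\<^esub> \<ominus>\<^bsub>N\<^esub> w \<in> W" using c by (intro ker) auto
      then have "(v \<oplus>\<^bsub>N\<^esub> \<ominus>\<^bsub>N\<^esub> w) \<oplus>\<^bsub>N\<^esub> w \<in> W" using N.rsubmoduleD(3)[OF sub(2)] w(1) by blast
      then show ?thesis using c by (simp add: N.a_assoc N.l_neg)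
    qed
    then have "v \<in> W \<longleftrightarrow> y \<in> \<pi> ` W" unfolding v(2) by (metis imageI)
    then show ?thesis using g(2)[OF v(1)] \<rho>(3)[OF v(1)] v(2) by simp
  qed
  ultimately show ?thesis
    unfolding factor_def
    using rsubmodule_image[OF N P sub(1) hV] rsubmodule_image[OF N P sub(2) hW] image_mono[OF sub(3)] g(1)
    by (intro conjI exI[of _ g] ballI)
qed

lemma chain_image:
  assumes N: "right_module N" and P: "right_module P" and M: "\<And>i. i \<in> J \<Longrightarrow> right_module (M i)"
    and \<pi>: "hom_on N (carrier N) P \<pi>"
    and ker: "\<And>x. x \<in> carrier N \<Longrightarrow> \<pi> x = \<zero>\<^bsub>P\<^esub> \<Longrightarrow> x \<in> U"
    and "chain N M J U V"
  shows "chain P M J (\<pi> ` U) (\<pi> ` V)"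
  using assms(6)
proof (induction rule: chain.induct)
  case base
  have "hom_on N U P \<pi>"
    using hom_on_subset[OF \<pi>] right_module.rsubmoduleD(1)[OF N base] by blast
  then show ?case by (intro chain.base rsubmodule_image[OF N P base])
next
  case (step V i V')
  have "U \<subseteq> V" using chain_rsubmodule[OF step.hyps(1)] by blast
  then have "factor P (\<pi> ` V') (\<pi> ` V) (M i)"
    using ker by (intro factor_image[OF N P M[OF step.hyps(2)] \<pi> _ step.hyps(3)]) auto
  then show ?case by (rule chain.step[where M = M, OF step.IH step.hyps(2)])
qed

lemma factor_trans:
  assumes fac: "factor N V W P" and iso: "factor P (carrier P) {\<zero>\<^bsub>P\<^esub>} M"
  shows "factor N V W M"
proof -
  obtain \<rho> where \<rho>: "hom_on N V P \<rho>" "\<rho> ` V = carrier P" "\<And>x. x \<in> V \<Longrightarrow> \<rho> x = \<zero>\<^bsub>P\<^esub> \<longleftrightarrow> x \<in> W"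
    using fac by (auto simp: factor_def)
  obtain g where g: "hom_on P (carrier P) M g" "g ` carrier P = carrier M"
    "\<And>x. x \<in> carrier P \<Longrightarrow> g x = \<zero>\<^bsub>M\<^esub> \<longleftrightarrow> x = \<zero>\<^bsub>P\<^esub>"
    using iso by (auto simp: factor_def)
  have "hom_on N V M (\<lambda>x. g (\<rho> x))"
    using hom_onD[OF g(1)] hom_onD[OF \<rho>(1)] unfolding hom_on_def by auto
  moreover have "(\<lambda>x. g (\<rho> x)) ` V = carrier M"
    by (simp only: image_image[of g \<rho>, symmetric] \<rho>(2) g(2))
  moreover have "g (\<rho> x) = \<zero>\<^bsub>M\<^esub> \<longleftrightarrow> x \<in> W" if "x \<in> V" for x
    using g(3)[of "\<rho> x"] \<rho>(3)[OF that] hom_onD(1)[OF \<rho>(1) that] by blast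
  ultimately show ?thesis
    using fac unfolding factor_def by (intro conjI exI[of _ "\<lambda>x. g (\<rho> x)"] ballI) simp_all
qed

text \<open>Both modules are \<open>V / W\<close>. This identifies \<open>M\<^sub>j\<close>, whose
  carrier is arbitrary, with a module given by matrices.\<close>

lemma factor_cancel:
  assumes N: "right_module N" and P: "right_module P" and M: "right_module M"
    and "factor N V W P" "factor N V W M"
  shows "factor P (carrier P) {\<zero>\<^bsub>P\<^esub>} M"
proof -
  interpret N: right_module N by fact
  interpret P: right_module P by fact
  have V: "rsubmodule V N" using assms by (simp add: factor_def)
  obtain \<rho> where \<rho>: "hom_on N V P \<rho>" "\<rho> ` V = carrier P" "\<And>x. x \<in> V \<Longrightarrow> \<rho> x = \<zero>\<^bsub>P\<^esub> \<longleftrightarrow> x \<in> W"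
    using assms(4) by (auto simp: factor_def)
  obtain h where h: "hom_on N V M h" "h ` V = carrier M" "\<And>x. x \<in> V \<Longrightarrow> h x = \<zero>\<^bsub>M\<^esub> \<longleftrightarrow> x \<in> W"
    using assms(5) by (auto simp: factor_def)
  obtain g where g: "hom_on P (\<rho> ` V) M g" "\<And>x. x \<in> V \<Longrightarrow> g (\<rho> x) = h x"
    by (rule hom_descend[OF N P M V \<rho>(1) h(1)]) (simp_all add: \<rho>(3) h(3))
  have "g ` carrier P = carrier M"
    unfolding h(2)[symmetric] \<rho>(2)[symmetric] image_image using g(2) by (intro image_cong) auto
  moreover have "g y = \<zero>\<^bsub>M\<^esub> \<longleftrightarrow> y = \<zero>\<^bsub>P\<^esub>" if "y \<in> carrier P" for y
  proof -
    have "y \<in> \<rho> ` V" using that by (simp only: \<rho>(2))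
    then obtain v where v: "v \<in> V" "y = \<rho> v" by (elim imageE)
    then show ?thesis using g(2) \<rho>(3) h(3) by simp
  qed
  ultimately show ?thesis
    unfolding factor_def using g(1) \<rho>(2) P.rsubmodule_carrier P.rsubmodule_zero
    by (intro conjI exI[of _ g] ballI) simp_all
qed

section \<open>Derivations\<close>

text \<open>Row vectors \<open>(v, w)\<close> under block matrices with rows
  \<open>(p a, D a)\<close> and \<open>(0, q a)\<close>: an extension of the module of
  \<open>p\<close> by that of \<open>q\<close>.\<close>

definition ext_module :: "nat \<Rightarrow> nat \<Rightarrow> ('a \<Rightarrow> 'k::field mat) \<Rightarrow> ('a \<Rightarrow> 'k mat) \<Rightarrow> ('a \<Rightarrow> 'k mat) \<Rightarrow> ('a, 'k vec \<times> 'k vec) module" where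
  "ext_module e d p q D = \<lparr>
     carrier = carrier_vec e \<times> carrier_vec d,
     monoid.mult = undefined,
     one = undefined,
     zero = (0\<^sub>v e, 0\<^sub>v d),
     add = (\<lambda>x y. (fst x + fst y, snd x + snd y)),
     smult = (\<lambda>a x. (transpose_mat (p a) *\<^sub>v fst x, transpose_mat (D a) *\<^sub>v fst x + transpose_mat (q a) *\<^sub>v snd x))\<rparr>"

lemma ext_module_simps:
  "carrier (ext_module e d p q D) = carrier_vec e \<times> carrier_vec d"
  "\<zero>\<^bsub>ext_module e d p q D\<^esub> = (0\<^sub>v e, 0\<^sub>v d)"
  "x \<oplus>\<^bsub>ext_module e d p q D\<^esub> y = (fst x + fst y, snd x + snd y)"
  "a \<odot>\<^bsub>ext_module e d p q D\<^esub> x =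
    (transpose_mat (p a) *\<^sub>v fst x, transpose_mat (D a) *\<^sub>v fst x + transpose_mat (q a) *\<^sub>v snd x)"
  by (simp_all add: ext_module_def)

text \<open>The Leibniz rule for \<open>D\<close> is associativity of the action, and
  \<open>D 1 = 0\<close> is its unit law.\<close>

lemma right_module_ext_module:
  fixes p q :: "'a::{ring,monoid_mult} \<Rightarrow> 'k::field mat"
  assumes p: "p \<in> mod_variety scl e" and q: "q \<in> mod_variety scl d"
    and D: "\<And>a. D a \<in> carrier_mat e d" "\<And>a b. D (a + b) = D a + D b"
      "\<And>a b. D (a * b) = p a * D b + D a * q b" "D 1 = 0\<^sub>m e d"
  shows "right_module (ext_module e d p q D)"
proof -
  let ?E = "ext_module e d p q D"
  note pD = mod_varietyD[OF p] and qD = mod_varietyD[OF q]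
  have pt: "transpose_mat (p a) \<in> carrier_mat e e" and qt: "transpose_mat (q a) \<in> carrier_mat d d"
    and Dt: "transpose_mat (D a) \<in> carrier_mat d e" for a
    using pD(1) qD(1) D(1) by simp_all
  interpret P: right_module "row_module e p" by (rule right_module_row_module[OF p])
  interpret Q: right_module "row_module d q" by (rule right_module_row_module[OF q])
  note PM = P.smult_l_distr P.smult_r_distr P.smult_assoc P.smult_one
  note QM = Q.smult_l_distr Q.smult_r_distr Q.smult_assoc Q.smult_one
  have "abelian_group ?E"
  proof (rule abelian_groupI)
    fix x assume "x \<in> carrier ?E"
    then show "\<exists>y\<in>carrier ?E. y \<oplus>\<^bsub>?E\<^esub> x = \<zero>\<^bsub>?E\<^esub>"
      by (intro bexI[of _ "(- fst x, - snd x)"]) (auto simp: ext_module_simps)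
  qed (auto simp: ext_module_simps intro: comm_add_vec)
  then interpret abelian_group ?E .
  have Dv: "transpose_mat (D a) *\<^sub>v v \<in> carrier_vec d" for a v
    by (rule carrier_vecI) (use D(1)[of a] in simp)
  have qv: "transpose_mat (q a) *\<^sub>v v \<in> carrier_vec d" for a v
    by (rule carrier_vecI) (use qD(3)[of a] in simp)
  have pv: "transpose_mat (p a) *\<^sub>v v \<in> carrier_vec e" for a v
    by (rule carrier_vecI) (use pD(3)[of a] in simp)
  have swap: "(x1 + x2) + (y1 + y2) = (x1 + y1) + (x2 + y2)"
    if "x1 \<in> carrier_vec d" "x2 \<in> carrier_vec d" "y1 \<in> carrier_vec d" "y2 \<in> carrier_vec d"
    for x1 x2 y1 y2 :: "'k vec"
    using that by (intro eq_vecI) auto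
  note swap = swap[OF Dv Dv qv qv]
  show ?thesis
  proof unfold_locales
    fix x a assume "x \<in> carrier ?E"
    then show "a \<odot>\<^bsub>?E\<^esub> x \<in> carrier ?E"
      using pv Dv qv unfolding ext_module_simps by (simp del: carrier_vec_dim_vec)
  next
    fix x a b assume "x \<in> carrier ?E"
    then obtain v w where x: "x = (v, w)" "v \<in> carrier_vec e" "w \<in> carrier_vec d"
      by (auto simp: ext_module_simps)
    have "transpose_mat (D (a + b)) *\<^sub>v v = transpose_mat (D a) *\<^sub>v v + transpose_mat (D b) *\<^sub>v v"
      unfolding D(2) transpose_add[OF D(1) D(1)] by (rule add_mult_distrib_mat_vec[OF Dt Dt x(2)])
    moreover have "transpose_mat (p (a + b)) *\<^sub>v v = transpose_mat (p a) *\<^sub>v v + transpose_mat (p b) *\<^sub>v v"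
      "transpose_mat (q (a + b)) *\<^sub>v w = transpose_mat (q a) *\<^sub>v w + transpose_mat (q b) *\<^sub>v w"
      using PM(1)[of v a b] QM(1)[of w a b] x(2,3) by (simp_all add: row_module_simps)
    ultimately show "(a + b) \<odot>\<^bsub>?E\<^esub> x = a \<odot>\<^bsub>?E\<^esub> x \<oplus>\<^bsub>?E\<^esub> b \<odot>\<^bsub>?E\<^esub> x"
      by (simp only: ext_module_simps x(1) fst_conv snd_conv swap)
  next
    fix x y a assume "x \<in> carrier ?E" "y \<in> carrier ?E"
    then obtain v w v' w' where x: "x = (v, w)" "v \<in> carrier_vec e" "w \<in> carrier_vec d"
      "y = (v', w')" "v' \<in> carrier_vec e" "w' \<in> carrier_vec d"
      by (auto simp: ext_module_simps)
    have "transpose_mat (D a) *\<^sub>v (v + v') = transpose_mat (D a) *\<^sub>v v + transpose_mat (D a) *\<^sub>v v'"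
      by (rule mult_add_distrib_mat_vec[OF Dt x(2,5)])
    moreover have "transpose_mat (p a) *\<^sub>v (v + v') = transpose_mat (p a) *\<^sub>v v + transpose_mat (p a) *\<^sub>v v'"
      by (rule mult_add_distrib_mat_vec[OF pt x(2,5)])
    moreover have "transpose_mat (q a) *\<^sub>v (w + w') = transpose_mat (q a) *\<^sub>v w + transpose_mat (q a) *\<^sub>v w'"
      by (rule mult_add_distrib_mat_vec[OF qt x(3,6)])
    ultimately show "a \<odot>\<^bsub>?E\<^esub> (x \<oplus>\<^bsub>?E\<^esub> y) = a \<odot>\<^bsub>?E\<^esub> x \<oplus>\<^bsub>?E\<^esub> a \<odot>\<^bsub>?E\<^esub> y"
      by (simp only: ext_module_simps x(1,4) fst_conv snd_conv swap)
  next
    fix x a b assume "x \<in> carrier ?E"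
    then obtain v w where x: "x = (v, w)" "v \<in> carrier_vec e" "w \<in> carrier_vec d"
      by (auto simp: ext_module_simps)
    have tr: "transpose_mat (D (a * b)) = transpose_mat (D b) * transpose_mat (p a) + transpose_mat (q b) * transpose_mat (D a)"
      unfolding D(3) using transpose_add[OF mult_carrier_mat[OF pD(1) D(1)] mult_carrier_mat[OF D(1) qD(1)]]
        transpose_mult[OF pD(1) D(1)] transpose_mult[OF D(1) qD(1)] by simp
    have "transpose_mat (D (a * b)) *\<^sub>v v =
        (transpose_mat (D b) * transpose_mat (p a)) *\<^sub>v v + (transpose_mat (q b) * transpose_mat (D a)) *\<^sub>v v"
      unfolding tr by (rule add_mult_distrib_mat_vec[OF mult_carrier_mat[OF Dt pt] mult_carrier_mat[OF qt Dt] x(2)])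
    also have "(transpose_mat (D b) * transpose_mat (p a)) *\<^sub>v v = transpose_mat (D b) *\<^sub>v (transpose_mat (p a) *\<^sub>v v)"
      by (rule assoc_mult_mat_vec[OF Dt pt x(2)])
    also have "(transpose_mat (q b) * transpose_mat (D a)) *\<^sub>v v = transpose_mat (q b) *\<^sub>v (transpose_mat (D a) *\<^sub>v v)"
      by (rule assoc_mult_mat_vec[OF qt Dt x(2)])
    finally have "transpose_mat (D (a * b)) *\<^sub>v v =
        transpose_mat (D b) *\<^sub>v (transpose_mat (p a) *\<^sub>v v) + transpose_mat (q b) *\<^sub>v (transpose_mat (D a) *\<^sub>v v)" .
    moreover have "transpose_mat (p (a * b)) *\<^sub>v v = transpose_mat (p b) *\<^sub>v (transpose_mat (p a) *\<^sub>v v)"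
      "transpose_mat (q (a * b)) *\<^sub>v w = transpose_mat (q b) *\<^sub>v (transpose_mat (q a) *\<^sub>v w)"
      using PM(3)[of v a b] QM(3)[of w a b] x(2,3) by (simp_all add: row_module_simps)
    moreover have "transpose_mat (q b) *\<^sub>v (transpose_mat (D a) *\<^sub>v v + transpose_mat (q a) *\<^sub>v w) =
        transpose_mat (q b) *\<^sub>v (transpose_mat (D a) *\<^sub>v v) + transpose_mat (q b) *\<^sub>v (transpose_mat (q a) *\<^sub>v w)"
      by (rule mult_add_distrib_mat_vec[OF qt Dv qv])
    ultimately show "(a * b) \<odot>\<^bsub>?E\<^esub> x = b \<odot>\<^bsub>?E\<^esub> (a \<odot>\<^bsub>?E\<^esub> x)"
      by (simp only: ext_module_simps x(1) fst_conv snd_conv assoc_add_vec[OF Dv qv qv])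
  next
    fix x assume "x \<in> carrier ?E"
    then obtain v w where x: "x = (v, w)" "v \<in> carrier_vec e" "w \<in> carrier_vec d"
      by (auto simp: ext_module_simps)
    have "transpose_mat (D 1) *\<^sub>v v = 0\<^sub>v d"
      unfolding D(4) using x(2) by (intro eq_vecI) auto
    then show "1 \<odot>\<^bsub>?E\<^esub> x = x"
      using x by (simp add: ext_module_simps pD(7) qD(7))
  qed
qed

text \<open>\<open>D\<close> defines an extension of \<open>X\<close> by the filtered module of
  \<open>q\<close>, which splits by \<open>chain_split\<close>. The complement is the graph of a
  linear map \<open>H\<close>, and its invariance under the action is the equation
  \<open>D a = p a * H - H * q a\<close>.\<close>

lemma derivation_inner:
  fixes p q :: "'a::{ring,monoid_mult} \<Rightarrow> 'k::field mat"
    and M :: "nat \<Rightarrow> ('a, 'm, 'z) module_scheme" and X :: "('a, 'm, 'z) module_scheme"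
  assumes p: "p \<in> mod_variety scl e" and q: "q \<in> mod_variety scl d"
    and D: "\<And>a. D a \<in> carrier_mat e d" "\<And>a b. D (a + b) = D a + D b"
      "\<And>a b. D (a * b) = p a * D b + D a * q b" "\<And>c. D (scl c 1) = 0\<^sub>m e d" "D 1 = 0\<^sub>m e d"
    and X: "right_module X" and M: "\<And>i. i \<in> J \<Longrightarrow> right_module (M i)"
    and ext: "\<And>i. i \<in> J \<Longrightarrow> trivial_group (Ext1 X (M i))"
    and iso: "factor (row_module e p) (carrier (row_module e p)) {\<zero>\<^bsub>row_module e p\<^esub>} X"
    and ch: "chain (row_module d q) M J {\<zero>\<^bsub>row_module d q\<^esub>} (carrier (row_module d q))"
  shows "\<exists>H. \<forall>a. \<forall>i<e. \<forall>j<d. D a $$ (i, j) =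
    (\<Sum>k\<in>{0..<e}. p a $$ (i, k) * H k j) - (\<Sum>k\<in>{0..<d}. H i k * q a $$ (k, j))"
proof -
  let ?E = "ext_module e d p q D" and ?P = "row_module e p" and ?Q = "row_module d q"
  note pD = mod_varietyD[OF p] and qD = mod_varietyD[OF q]
  have Emod: "right_module ?E" by (rule right_module_ext_module[OF p q D(1,2,3,5)])
  interpret E: right_module ?E by (rule Emod)
  interpret P: right_module ?P by (rule right_module_row_module[OF p])
  interpret Q: right_module ?Q by (rule right_module_row_module[OF q])
  have Dv: "transpose_mat (D a) *\<^sub>v v \<in> carrier_vec d" for a v
    by (rule carrier_vecI) (use D(1)[of a] in simp)
  have qv: "transpose_mat (q a) *\<^sub>v v \<in> carrier_vec d" for a v
    by (rule carrier_vecI) (use qD(3)[of a] in simp)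
  have pv: "transpose_mat (p a) *\<^sub>v v \<in> carrier_vec e" for a v
    by (rule carrier_vecI) (use pD(3)[of a] in simp)
  have pt0: "transpose_mat (p a) *\<^sub>v 0\<^sub>v e = 0\<^sub>v e" for a
    using P.smult_zero[of a] by (simp add: row_module_simps)
  have Dt0: "transpose_mat (D a) *\<^sub>v 0\<^sub>v e = 0\<^sub>v d" for a
    using D(1)[of a] by (intro eq_vecI) auto
  let ?in = "\<lambda>V. {0\<^sub>v e} \<times> V"
  have in_sub: "rsubmodule (?in V) ?E" if "rsubmodule V ?Q" for V
  proof -
    note VD = Q.rsubmoduleD[OF that]
    have Vc: "v \<in> carrier_vec d" if "v \<in> V" for v using VD(1) that by (auto simp: row_module_simps)
    show ?thesis
      unfolding E.rsubmodule_iff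
      using VD(2,3,4) Vc qv
      by (auto simp: ext_module_simps row_module_simps pt0 Dt0 simp del: carrier_vec_dim_vec)
  qed
  have in_factor: "factor ?E (?in V) (?in W) Z" if fac: "factor ?Q V W Z" for V W and Z :: "('a, 'm, 'z) module_scheme"
  proof -
    obtain \<rho> where \<rho>: "hom_on ?Q V Z \<rho>" "\<rho> ` V = carrier Z" "\<And>x. x \<in> V \<Longrightarrow> \<rho> x = \<zero>\<^bsub>Z\<^esub> \<longleftrightarrow> x \<in> W"
      using fac by (auto simp: factor_def)
    have sub: "rsubmodule V ?Q" "rsubmodule W ?Q" "W \<subseteq> V" using fac by (auto simp: factor_def)
    have Vc: "v \<in> carrier_vec d" if "v \<in> V" for v
      using Q.rsubmoduleD(1)[OF sub(1)] that by (auto simp: row_module_simps)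
    have "hom_on ?E (?in V) Z (\<lambda>x. \<rho> (snd x))"
      using hom_onD[OF \<rho>(1)] Vc qv unfolding hom_on_def
      by (auto simp: ext_module_simps row_module_simps Dt0 simp del: carrier_vec_dim_vec)
    moreover have "(\<lambda>x. \<rho> (snd x)) ` ?in V = carrier Z"
      unfolding \<rho>(2)[symmetric] by force
    ultimately show ?thesis
      unfolding factor_def using in_sub sub \<rho>(3)
      by (intro conjI exI[of _ "\<lambda>x. \<rho> (snd x)"]) auto
  qed
  have "chain ?E M J (?in {0\<^sub>v d}) (?in V)" if "chain ?Q M J {0\<^sub>v d} V" for V
    using that
  proof (induction rule: chain.induct)
    case base
    then show ?case by (intro chain.base in_sub)
  next
    case (step V i V')
    show ?case by (rule chain.step[where M = M, OF step.IH step.hyps(2) in_factor[OF step.hyps(3)]])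
  qed
  then have chE: "chain ?E M J {(0\<^sub>v e, 0\<^sub>v d)} (?in (carrier_vec d))"
    using ch by (simp add: row_module_simps)
  have facE: "factor ?E (carrier ?E) (?in (carrier_vec d)) X"
  proof -
    obtain \<rho> where \<rho>: "hom_on ?P (carrier ?P) X \<rho>" "\<rho> ` carrier ?P = carrier X"
      "\<And>x. x \<in> carrier ?P \<Longrightarrow> \<rho> x = \<zero>\<^bsub>X\<^esub> \<longleftrightarrow> x = \<zero>\<^bsub>?P\<^esub>"
      using iso by (auto simp: factor_def)
    have "hom_on ?E (carrier ?E) X (\<lambda>x. \<rho> (fst x))"
      using hom_onD[OF \<rho>(1)] unfolding hom_on_def
      by (auto simp: ext_module_simps row_module_simps)
    moreover have "(\<lambda>x. \<rho> (fst x)) ` carrier ?E = carrier X"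
    proof -
      have "carrier_vec d \<noteq> ({} :: 'k vec set)" using zero_carrier_vec by blast
      then have "fst ` (carrier_vec e \<times> (carrier_vec d :: 'k vec set)) = (carrier_vec e :: 'k vec set)" by simp
      then have "\<rho> ` fst ` carrier ?E = \<rho> ` carrier ?P"
        by (simp only: ext_module_simps row_module_simps)
      then show ?thesis by (simp only: image_image \<rho>(2))
    qed
    moreover have "\<rho> (fst x) = \<zero>\<^bsub>X\<^esub> \<longleftrightarrow> x \<in> ?in (carrier_vec d)" if "x \<in> carrier ?E" for x
      using \<rho>(3)[of "fst x"] that by (auto simp: ext_module_simps row_module_simps)
    moreover have "rsubmodule (?in (carrier_vec d)) ?E"
      using in_sub[OF Q.rsubmodule_carrier] by (simp add: row_module_simps)
    ultimately show ?thesis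
      unfolding factor_def using E.rsubmodule_carrier
      by (intro conjI exI[of _ "\<lambda>x. \<rho> (fst x)"]) (auto simp: ext_module_simps)
  qed
  obtain U where U: "factor ?E U {(0\<^sub>v e, 0\<^sub>v d)} X" "U \<inter> ?in (carrier_vec d) = {(0\<^sub>v e, 0\<^sub>v d)}"
    "\<And>y. y \<in> carrier ?E \<Longrightarrow> \<exists>u\<in>U. \<exists>v\<in>?in (carrier_vec d). y = u \<oplus>\<^bsub>?E\<^esub> v"
    using chain_split[OF Emod M X ext chE facE] by blast
  have Usub: "rsubmodule U ?E" using U(1) by (simp add: factor_def)
  note UD = E.rsubmoduleD[OF Usub]
  have Uc: "fst x \<in> carrier_vec e \<and> snd x \<in> carrier_vec d" if "x \<in> U" for x
    using UD(1) that by (auto simp: ext_module_simps)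
  \<comment> \<open>Uses that \<open>D\<close> vanishes on scalars, so that \<open>scl c 1\<close>
    acts on the pair as multiplication by \<open>c\<close>.\<close>
  have Usmult: "(c \<cdot>\<^sub>v v, c \<cdot>\<^sub>v w) \<in> U" if vw: "(v, w) \<in> U" for c v w
  proof -
    have c: "v \<in> carrier_vec e" "w \<in> carrier_vec d" using Uc[OF vw] by auto
    have t: "transpose_mat (c \<cdot>\<^sub>m 1\<^sub>m n) *\<^sub>v x = c \<cdot>\<^sub>v x" if "x \<in> carrier_vec n" for n and x :: "'k vec"
    proof -
      have "transpose_mat (c \<cdot>\<^sub>m 1\<^sub>m n) = c \<cdot>\<^sub>m (1\<^sub>m n :: 'k mat)"
        by (intro eq_matI) auto
      then show ?thesis using that by (auto intro!: eq_vecI)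
    qed
    have "transpose_mat (D (scl c 1)) *\<^sub>v v = 0\<^sub>v d"
      unfolding D(4) using c by (intro eq_vecI) auto
    then have "scl c 1 \<odot>\<^bsub>?E\<^esub> (v, w) = (c \<cdot>\<^sub>v v, c \<cdot>\<^sub>v w)"
      using c by (simp add: ext_module_simps pD(6,7) qD(6,7) t)
    then show ?thesis using UD(4)[OF vw, of "scl c 1"] by simp
  qed
  \<comment> \<open>The complement is a graph: a difference of two such elements has first component
    zero, hence lies in the trivial intersection.\<close>
  have uniq: "w = w'" if w: "(v, w) \<in> U" "(v, w') \<in> U" for v w w'
  proof -
    have c: "v \<in> carrier_vec e" "w \<in> carrier_vec d" "w' \<in> carrier_vec d"
      using Uc[OF w(1)] Uc[OF w(2)] by auto
    have "(v + (- 1) \<cdot>\<^sub>v v, w + (- 1) \<cdot>\<^sub>v w') \<in> U"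
      using UD(3)[OF w(1) Usmult[OF w(2), of "- 1"]] by (simp add: ext_module_simps)
    moreover have "v + (- 1) \<cdot>\<^sub>v v = 0\<^sub>v e" using c by (intro eq_vecI) auto
    ultimately have "(0\<^sub>v e, w + (- 1) \<cdot>\<^sub>v w') \<in> U \<inter> ?in (carrier_vec d)" using c by auto
    then have 0: "w + (- 1) \<cdot>\<^sub>v w' = 0\<^sub>v d" unfolding U(2) by simp
    show ?thesis
    proof (rule eq_vecI)
      fix i assume "i < dim_vec w'"
      then have i: "i < d" using c by simp
      have "(w + (- 1) \<cdot>\<^sub>v w') $ i = 0" unfolding 0 using i by simp
      then show "w $ i = w' $ i" using i c by simp
    qed (use c in simp)
  qed
  have "\<exists>w. (unit_vec e i, w) \<in> U" if "i < e" for i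
  proof -
    have "(unit_vec e i, 0\<^sub>v d) \<in> carrier ?E" by (simp add: ext_module_simps)
    then obtain u w where u: "u \<in> U" "w \<in> carrier_vec d" "(unit_vec e i, 0\<^sub>v d) = (fst u + 0\<^sub>v e, snd u + w)"
      using U(3) by (fastforce simp: ext_module_simps)
    then have "fst u = unit_vec e i" using Uc[OF u(1)] by simp
    then show ?thesis using u(1) by (metis prod.collapse)
  qed
  then obtain h where h: "\<And>i. i < e \<Longrightarrow> (unit_vec e i, h i) \<in> U" by metis
  define H where "H i j = h i $ j" for i j
  \<comment> \<open>Partial sums of the vectors \<open>(unit_vec e i, h i)\<close> with coefficients
    \<open>x i\<close>, added one at a time.\<close>
  have lin: "(vec e (\<lambda>i. if i < n then x i else 0), vec d (\<lambda>j. \<Sum>i\<in>{0..<n}. x i * H i j)) \<in> U"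
    if "n \<le> e" for n x
    using that
  proof (induction n)
    case 0
    have "vec e (\<lambda>i. if i < 0 then x i else 0) = 0\<^sub>v e" "vec d (\<lambda>j. \<Sum>i\<in>{0..<0}. x i * H i j) = 0\<^sub>v d"
      by (auto intro!: eq_vecI)
    then show ?case using UD(2) by (simp add: ext_module_simps)
  next
    case (Suc n)
    have hn: "h n \<in> carrier_vec d" using Uc[OF h[of n]] Suc.prems by simp
    have "vec e (\<lambda>i. if i < Suc n then x i else 0) =
        vec e (\<lambda>i. if i < n then x i else 0) + x n \<cdot>\<^sub>v unit_vec e n"
      using Suc.prems by (intro eq_vecI) (auto simp: less_Suc_eq)
    moreover have "vec d (\<lambda>j. \<Sum>i\<in>{0..<Suc n}. x i * H i j) =
        vec d (\<lambda>j. \<Sum>i\<in>{0..<n}. x i * H i j) + x n \<cdot>\<^sub>v h n"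
      using hn by (intro eq_vecI) (auto simp: H_def)
    ultimately show ?case
      using UD(3)[OF Suc.IH Usmult[OF h[of n], of "x n"]] Suc.prems by (simp add: ext_module_simps)
  qed
  have full: "(vec e x, vec d (\<lambda>j. \<Sum>i\<in>{0..<e}. x i * H i j)) \<in> U" for x
  proof -
    have "vec e (\<lambda>i. if i < e then x i else 0) = vec e x" by (intro eq_vecI) auto
    then show ?thesis using lin[of e x] by simp
  qed
  have "D a $$ (i, j) = (\<Sum>k\<in>{0..<e}. p a $$ (i, k) * H k j) - (\<Sum>k\<in>{0..<d}. H i k * q a $$ (k, j))"
    if ij: "i < e" "j < d" for a i j
  proof -
    have hi: "h i \<in> carrier_vec d" using Uc[OF h[OF ij(1)]] by simp
    have "a \<odot>\<^bsub>?E\<^esub> (unit_vec e i, h i) \<in> U" using UD(4)[OF h[OF ij(1)]] .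
    moreover have "transpose_mat (p a) *\<^sub>v unit_vec e i = vec e (\<lambda>k. p a $$ (i, k))"
      using pD(1)[of a] ij by (intro eq_vecI) auto
    ultimately have "(vec e (\<lambda>k. p a $$ (i, k)), transpose_mat (D a) *\<^sub>v unit_vec e i + transpose_mat (q a) *\<^sub>v h i) \<in> U"
      by (simp add: ext_module_simps)
    \<comment> \<open>Two elements of the graph lie over row \<open>i\<close> of \<open>p a\<close>:
      the translate of \<open>(unit_vec e i, h i)\<close> by \<open>a\<close>, and the combination
      of the \<open>h k\<close> with that row as coefficients. Their second components
      agree.\<close>
    from uniq[OF this full] have
      "(transpose_mat (D a) *\<^sub>v unit_vec e i + transpose_mat (q a) *\<^sub>v h i) $ j = (\<Sum>k\<in>{0..<e}. p a $$ (i, k) * H k j)"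
      using ij by simp
    moreover have "(transpose_mat (D a) *\<^sub>v unit_vec e i) $ j = D a $$ (i, j)"
      using D(1)[of a] ij by auto
    moreover have "(transpose_mat (q a) *\<^sub>v h i) $ j = (\<Sum>k\<in>{0..<d}. H i k * q a $$ (k, j))"
      using qD(1)[of a] ij hi by (auto simp: scalar_prod_def H_def mult.commute intro!: sum.cong)
    moreover have "(transpose_mat (D a) *\<^sub>v unit_vec e i + transpose_mat (q a) *\<^sub>v h i) $ j =
        (transpose_mat (D a) *\<^sub>v unit_vec e i) $ j + (transpose_mat (q a) *\<^sub>v h i) $ j"
      using carrier_vecD[OF qv[of a "h i"]] ij(2) by (intro index_add_vec(1)) simp
    ultimately show ?thesis by (simp only: eq_diff_eq)
  qed
  then show ?thesis by blast
qed

section \<open>Extending homomorphisms\<close>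

text \<open>A derivation along \<open>p\<close> and \<open>q\<close> is determined by its values \<open>y (l, i, j)\<close> on the generators;
  \<open>leibniz gs scl p e d a E\<close> says that the Leibniz rule gives it the entries
  \<open>\<Sum>s. E q i j s * y s\<close> at \<open>a\<close>. Different ways of writing \<open>a\<close> in terms of the generators lead to
  different \<open>E\<close>, and their differences are the linear conditions on \<open>y\<close> for such a derivation to exist.\<close>

inductive leibniz ::
  "'a list \<Rightarrow> ('k \<Rightarrow> 'a \<Rightarrow> 'a) \<Rightarrow> ('a \<Rightarrow> 'k mat) \<Rightarrow> nat \<Rightarrow> nat \<Rightarrow> 'a::{ring,monoid_mult}
    \<Rightarrow> (('a \<Rightarrow> 'k::field mat) \<Rightarrow> nat \<Rightarrow> nat \<Rightarrow> nat \<times> nat \<times> nat \<Rightarrow> 'k) \<Rightarrow> bool"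
  for gs scl p e d where
  gen: "l < length gs \<Longrightarrow> leibniz gs scl p e d (gs ! l) (\<lambda>q i j s. if s = (l, i, j) then 1 else 0)"
| const: "leibniz gs scl p e d (scl c 1) (\<lambda>q i j s. 0)"
| add: "leibniz gs scl p e d a E \<Longrightarrow> leibniz gs scl p e d b E' \<Longrightarrow>
    leibniz gs scl p e d (a + b) (\<lambda>q i j s. E q i j s + E' q i j s)"
| mult: "leibniz gs scl p e d a E \<Longrightarrow> leibniz gs scl p e d b E' \<Longrightarrow>
    leibniz gs scl p e d (a * b) (\<lambda>q i j s.
      (\<Sum>k\<in>{0..<e}. p a $$ (i, k) * E' q k j s) + (\<Sum>k\<in>{0..<d}. E q i k s * q b $$ (k, j)))"

text \<open>The matrix, in coordinates, of the map sending \<open>H\<close> to the family of all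
  \<open>p g * H - H * q g\<close> for generators \<open>g\<close>. Its kernel consists of the
  homomorphisms from the module of \<open>p\<close> to that of \<open>q\<close>.\<close>

definition commutator ::
  "'a list \<Rightarrow> ('a \<Rightarrow> 'k::field mat) \<Rightarrow> ('a \<Rightarrow> 'k mat) \<Rightarrow> nat \<times> nat \<times> nat \<Rightarrow> nat \<times> nat \<Rightarrow> 'k" where
  "commutator gs p q = (\<lambda>(l, i, j) (i', j').
     (if j = j' then p (gs ! l) $$ (i, i') else 0) - (if i = i' then q (gs ! l) $$ (j', j) else 0))"

lemma mod_variety_mult_entry:
  assumes "m \<in> mod_variety scl d" "i < d" "j < d"
  shows "m (a * b) $$ (i, j) = (\<Sum>k\<in>{0..<d}. m a $$ (i, k) * m b $$ (k, j))"
  using mod_varietyD(1)[OF assms(1), of a] mod_varietyD(1)[OF assms(1), of b] assms(2,3)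
  by (simp add: mod_varietyD(5)[OF assms(1)] scalar_prod_def)

lemma mod_variety_add_entry:
  assumes "m \<in> mod_variety scl d" "i < d" "j < d"
  shows "m (a + b) $$ (i, j) = m a $$ (i, j) + m b $$ (i, j)"
  using mod_varietyD(1)[OF assms(1), of b] assms(2,3) by (simp add: mod_varietyD(4)[OF assms(1)])

lemma mod_variety_scl_entry:
  assumes "m \<in> mod_variety scl d" "i < d" "j < d"
  shows "m (scl c 1) $$ (i, j) = (if i = j then c else 0)"
  using assms(2,3) by (simp add: mod_varietyD(6,7)[OF assms(1)])

lemma sum_mult_swap:
  fixes f :: "'i \<Rightarrow> 's \<Rightarrow> 'k::comm_ring"
  shows "(\<Sum>s\<in>S. (\<Sum>k\<in>K. g k * f k s) * c s) = (\<Sum>k\<in>K. g k * (\<Sum>s\<in>S. f k s * c s))"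
    and "(\<Sum>s\<in>S. (\<Sum>k\<in>K. f k s * g k) * c s) = (\<Sum>k\<in>K. (\<Sum>s\<in>S. f k s * c s) * g k)"
  unfolding sum_distrib_left sum_distrib_right by (subst sum.swap, simp add: mult_ac)+

lemma commutator_sum:
  assumes "i < e" "j < d"
  shows "(\<Sum>s\<in>{0..<e} \<times> {0..<d}. commutator gs p q (l, i, j) s * H s) =
    (\<Sum>k\<in>{0..<e}. p (gs ! l) $$ (i, k) * H (k, j)) - (\<Sum>k\<in>{0..<d}. H (i, k) * q (gs ! l) $$ (k, j))"
proof -
  have "(\<Sum>s\<in>{0..<e} \<times> {0..<d}. commutator gs p q (l, i, j) s * H s) =
      (\<Sum>i'\<in>{0..<e}. \<Sum>j'\<in>{0..<d}. (if j = j' then p (gs ! l) $$ (i, i') * H (i', j) else 0)) -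
      (\<Sum>i'\<in>{0..<e}. \<Sum>j'\<in>{0..<d}. (if i = i' then H (i, j') * q (gs ! l) $$ (j', j) else 0))"
    unfolding sum.cartesian_product sum_subtractf[symmetric] commutator_def
    by (intro sum.cong) (auto simp: left_diff_distrib)
  also have "(\<Sum>i'\<in>{0..<e}. \<Sum>j'\<in>{0..<d}. (if j = j' then p (gs ! l) $$ (i, i') * H (i', j) else 0)) =
      (\<Sum>k\<in>{0..<e}. p (gs ! l) $$ (i, k) * H (k, j))"
    using assms by simp
  also have "(\<Sum>i'\<in>{0..<e}. \<Sum>j'\<in>{0..<d}. (if i = i' then H (i, j') * q (gs ! l) $$ (j', j) else 0)) =
      (\<Sum>k\<in>{0..<d}. H (i, k) * q (gs ! l) $$ (k, j))"
    using assms by (subst sum.swap) simp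
  finally show ?thesis .
qed

text \<open>Inner derivations obey the Leibniz rule, so every way of writing \<open>a\<close>
  evaluates a commutator to \<open>p a * H - H * q a\<close>; here \<open>H\<close> is a matrix
  unit. Hence two ways of writing \<open>a\<close> differ by a functional that annihilates all
  commutators, for every \<open>q\<close> in the variety.\<close>

lemma leibniz_commutator:
  assumes lz: "leibniz gs scl p e d a E" and p: "p \<in> mod_variety scl e" and q: "q \<in> mod_variety scl d"
    and ij: "i < e" "j < d" "i' < e" "j' < d"
  shows "(\<Sum>s\<in>{0..<length gs} \<times> {0..<e} \<times> {0..<d}. E q i j s * commutator gs p q s (i', j')) =
    (if j = j' then p a $$ (i, i') else 0) - (if i = i' then q a $$ (j', j) else 0)"
  using lz ij
proof (induction arbitrary: i j rule: leibniz.induct)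
  case (gen l)
  let ?S = "{0..<length gs} \<times> {0..<e} \<times> {0..<d}"
  have "(\<Sum>s\<in>?S. (if s = (l, i, j) then 1 else 0) * commutator gs p q s (i', j')) =
      (\<Sum>s\<in>?S. if s = (l, i, j) then commutator gs p q s (i', j') else 0)"
    by (intro sum.cong) auto
  also have "\<dots> = commutator gs p q (l, i, j) (i', j')"
    using gen by simp
  finally show ?case by (simp add: commutator_def)
next
  case (const c)
  then show ?case
    using p q by (auto simp: mod_variety_scl_entry)
next
  case (add a E b E')
  then show ?case
    using p q by (simp add: distrib_right sum.distrib mod_variety_add_entry)
next
  case (mult a E b E')
  let ?S = "{0..<length gs} \<times> {0..<e} \<times> {0..<d}" and ?c = "\<lambda>s. commutator gs p q s (i', j')"
  have "(\<Sum>s\<in>?S. ((\<Sum>k\<in>{0..<e}. p a $$ (i, k) * E' q k j s) + (\<Sum>k\<in>{0..<d}. E q i k s * q b $$ (k, j))) * ?c s) =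
      (\<Sum>k\<in>{0..<e}. p a $$ (i, k) * (\<Sum>s\<in>?S. E' q k j s * ?c s)) +
      (\<Sum>k\<in>{0..<d}. (\<Sum>s\<in>?S. E q i k s * ?c s) * q b $$ (k, j))"
    unfolding distrib_right sum.distrib
    by (rule arg_cong2[where f = "(+)", OF sum_mult_swap(1) sum_mult_swap(2)])
  also have "(\<Sum>k\<in>{0..<e}. p a $$ (i, k) * (\<Sum>s\<in>?S. E' q k j s * ?c s)) =
      (\<Sum>k\<in>{0..<e}. (if j = j' then p a $$ (i, k) * p b $$ (k, i') else 0) -
        (if k = i' then p a $$ (i, k) * q b $$ (j', j) else 0))"
    using mult by (intro sum.cong) (auto simp: right_diff_distrib)
  also have "\<dots> = (if j = j' then p (a * b) $$ (i, i') else 0) - p a $$ (i, i') * q b $$ (j', j)"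
    using mult.prems by (simp add: sum_subtractf mod_variety_mult_entry[OF p])
  also have "(\<Sum>k\<in>{0..<d}. (\<Sum>s\<in>?S. E q i k s * ?c s) * q b $$ (k, j)) =
      (\<Sum>k\<in>{0..<d}. (if k = j' then p a $$ (i, i') * q b $$ (k, j) else 0) -
        (if i = i' then q a $$ (j', k) * q b $$ (k, j) else 0))"
    using mult by (intro sum.cong) (auto simp: left_diff_distrib)
  also have "\<dots> = p a $$ (i, i') * q b $$ (j', j) - (if i = i' then q (a * b) $$ (j', j) else 0)"
    using mult.prems by (simp add: sum_subtractf mod_variety_mult_entry[OF q])
  finally show ?case by simp
qed

lemma leibniz_exists:
  assumes "k_algebra scl" "generates_algebra scl (set gs)"
  shows "\<exists>E. leibniz gs scl p e d a E"
proof (induction a rule: generates_induct[OF assms(2) _ _ _ _ assms(1)])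
  case (1 g)
  then show ?case by (metis in_set_conv_nth leibniz.gen)
qed (blast intro: leibniz.const leibniz.add leibniz.mult)+

text \<open>Only the product rule brings in \<open>q\<close>, through a matrix entry, so the
  coefficients stay regular.\<close>

lemma leibniz_germs:
  assumes "k_algebra scl" "generates_algebra scl (set gs)" "leibniz gs scl p e d a E" "i < e" "j < d"
  shows "(\<lambda>q. E q i j s) \<in> germs scl gs d q0"
  using assms(3-5)
proof (induction arbitrary: i j rule: leibniz.induct)
  interpret germ_ring "germs scl gs d q0" "zar scl gs d q0" q0 by (rule germ_ring_germs)
  case (mult a E b E')
  then show ?case
    by (intro add sum germ_ring.mult[OF germ_ring_germs] const reg_in_germs[OF reg_entry[OF assms(1,2)]]) auto
qed (auto intro: germ_ring.const[OF germ_ring_germs] germ_ring.add[OF germ_ring_germs])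

text \<open>An instance of \<open>kernel_section\<close> with \<open>B\<close> the commutator
  matrix. Exactness at \<open>q0\<close> rests on \<open>derivation_inner\<close>: values on
  generators that satisfy all conditions come from a derivation, and this derivation is
  inner.\<close>

lemma hom_extends:
  fixes p q0 :: "'a::{ring,monoid_mult} \<Rightarrow> 'k::field mat"
    and M :: "nat \<Rightarrow> ('a, 'm, 'z) module_scheme" and X :: "('a, 'm, 'z) module_scheme"
  assumes alg: "k_algebra scl" and genr: "generates_algebra scl (set gs)"
    and p: "p \<in> mod_variety scl e" and q0: "q0 \<in> mod_variety scl d"
    and X: "right_module X" and M: "\<And>i. i \<in> J \<Longrightarrow> right_module (M i)"
    and ext: "\<And>i. i \<in> J \<Longrightarrow> trivial_group (Ext1 X (M i))"
    and iso: "factor (row_module e p) (carrier (row_module e p)) {\<zero>\<^bsub>row_module e p\<^esub>} X"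
    and ch: "chain (row_module d q0) M J {\<zero>\<^bsub>row_module d q0\<^esub>} (carrier (row_module d q0))"
    and H0: "\<And>a i j. i < e \<Longrightarrow> j < d \<Longrightarrow>
      (\<Sum>k\<in>{0..<e}. p a $$ (i, k) * H0 (k, j)) = (\<Sum>k\<in>{0..<d}. H0 (i, k) * q0 a $$ (k, j))"
  shows "\<exists>H. (\<forall>i<e. \<forall>j<d. (\<lambda>q. H q (i, j)) \<in> germs scl gs d q0) \<and> H q0 = H0 \<and>
    (\<forall>\<^sub>F q in zar scl gs d q0. \<forall>a. \<forall>i<e. \<forall>j<d.
      (\<Sum>k\<in>{0..<e}. p a $$ (i, k) * H q (k, j)) = (\<Sum>k\<in>{0..<d}. H q (i, k) * q a $$ (k, j)))"
proof -
  let ?J = "{0..<length gs} \<times> {0..<e} \<times> {0..<d}" and ?I = "{0..<e} \<times> {0..<d}"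
  let ?G = "germs scl gs d q0" and ?Z = "zar scl gs d q0"
  interpret k_algebra scl by fact
  interpret germ_ring ?G ?Z q0 by (rule germ_ring_germs)
  have entry: "(\<lambda>q. q a $$ (i, j)) \<in> ?G" if "i < d" "j < d" for a i j
    using that by (intro reg_in_germs reg_entry[OF alg genr])
  have variety: "\<forall>\<^sub>F q in ?Z. q \<in> mod_variety scl d" by (rule eventually_zar_variety)
  \<comment> \<open>One condition for each entry and each pair of ways of writing an element. The
    family may be infinite, which \<open>kernel_section\<close> allows.\<close>
  define C where "C = {\<lambda>q s. E q i j s - E' q i j s | a E E' i j.
    leibniz gs scl p e d a E \<and> leibniz gs scl p e d a E' \<and> i < e \<and> j < d}"
  have "\<exists>H. (\<forall>s\<in>?I. (\<lambda>q. H q s) \<in> ?G) \<and> H q0 = H0 \<and>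
      (\<forall>\<^sub>F q in ?Z. \<forall>t\<in>?J. (\<Sum>s\<in>?I. commutator gs p q t s * H q s) = 0)"
  proof (rule kernel_section[where C = C])
    show "finite ?J" "finite ?I" by auto
    show "(\<lambda>q. commutator gs p q t s) \<in> ?G" if ts': "t \<in> ?J" "s \<in> ?I" for t s
    proof -
      obtain l i j i' j' where ts: "t = (l, i, j)" "s = (i', j')" "j < d" "j' < d"
        using ts' by auto
      have "(\<lambda>q. if i = i' then q (gs ! l) $$ (j', j) else 0) \<in> ?G"
        using ts by (cases "i = i'") (auto intro: entry const)
      then show ?thesis
        unfolding ts(1,2) commutator_def prod.case by (intro diff const)
    qed
    show "(\<lambda>q. c q s) \<in> ?G" if c: "c \<in> C" for c s
    proof -
      obtain a E E' i j where cE: "c = (\<lambda>q s. E q i j s - E' q i j s)" "leibniz gs scl p e d a E"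
        "leibniz gs scl p e d a E'" "i < e" "j < d"
        using c unfolding C_def by blast
      show ?thesis
        unfolding cE(1) by (intro diff leibniz_germs[OF alg genr cE(2,4,5)] leibniz_germs[OF alg genr cE(3,4,5)])
    qed
    show "\<forall>\<^sub>F q in ?Z. (\<Sum>t\<in>?J. c q t * commutator gs p q t s) = 0" if c: "c \<in> C" and s: "s \<in> ?I" for c s
    proof -
      obtain a E E' i j where cE: "c = (\<lambda>q s. E q i j s - E' q i j s)" "leibniz gs scl p e d a E"
        "leibniz gs scl p e d a E'" "i < e" "j < d"
        using c unfolding C_def by blast
      obtain i' j' where s': "s = (i', j')" "i' < e" "j' < d" using s by auto
      show ?thesis
        using variety
      proof eventually_elim
        case (elim q)
        show ?case
          unfolding cE(1) left_diff_distrib sum_subtractf s'(1)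
            leibniz_commutator[OF cE(2) p elim cE(4,5) s'(2,3)] leibniz_commutator[OF cE(3) p elim cE(4,5) s'(2,3)]
          by simp
      qed
    qed
    show "(\<Sum>s\<in>?I. commutator gs p q0 t s * H0 s) = 0" if t': "t \<in> ?J" for t
    proof -
      obtain l i j where t: "t = (l, i, j)" "i < e" "j < d" using t' by auto
      show ?thesis unfolding t(1) commutator_sum[OF t(2,3)] using H0[OF t(2,3)] by simp
    qed
    show "\<exists>x. \<forall>t\<in>?J. y t = (\<Sum>s\<in>?I. commutator gs p q0 t s * x s)"
      if y: "\<And>c. c \<in> C \<Longrightarrow> (\<Sum>t\<in>?J. c q0 t * y t) = 0" for y
    proof -
      define v where "v E i j = (\<Sum>t\<in>?J. E q0 i j t * y t)" for E :: "('a \<Rightarrow> 'k mat) \<Rightarrow> nat \<Rightarrow> nat \<Rightarrow> nat \<times> nat \<times> nat \<Rightarrow> 'k" and i j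
      have indep: "v E i j = v E' i j"
        if E: "leibniz gs scl p e d a E" "leibniz gs scl p e d a E'" "i < e" "j < d" for a E E' i j
      proof -
        have "(\<lambda>q s. E q i j s - E' q i j s) \<in> C" unfolding C_def using E by blast
        from y[OF this] show ?thesis
          by (simp add: v_def left_diff_distrib sum_subtractf)
      qed
      \<comment> \<open>By \<open>indep\<close> the choice of \<open>E\<close> is immaterial, so
        additivity and the Leibniz rule can be read off from the matching rules of
        \<open>leibniz\<close>.\<close>
      define D where "D a = mat e d (\<lambda>(i, j). v (SOME E. leibniz gs scl p e d a E) i j)" for a
      have D: "D a $$ (i, j) = v E i j" if E: "leibniz gs scl p e d a E" "i < e" "j < d" for a E i j
      proof -
        have "leibniz gs scl p e d a (SOME E. leibniz gs scl p e d a E)"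
          using leibniz_exists[OF alg genr] by (rule someI_ex)
        from indep[OF this E] show ?thesis using E by (simp add: D_def)
      qed
      have Dc: "D a \<in> carrier_mat e d" for a by (simp add: D_def)
      have Dadd: "D (a + b) = D a + D b" for a b
      proof -
        obtain E E' where E: "leibniz gs scl p e d a E" "leibniz gs scl p e d b E'"
          using leibniz_exists[OF alg genr] by meson
        show ?thesis
        proof (rule eq_matI)
          fix i j assume "i < dim_row (D a + D b)" "j < dim_col (D a + D b)"
          then have ij: "i < e" "j < d" by (auto simp: D_def)
          show "D (a + b) $$ (i, j) = (D a + D b) $$ (i, j)"
            using ij Dc[of b] D[OF leibniz.add[OF E] ij] D[OF E(1) ij] D[OF E(2) ij]
            by (simp add: v_def distrib_right sum.distrib)
        qed (auto simp: D_def)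
      qed
      have Dmult: "D (a * b) = p a * D b + D a * q0 b" for a b
      proof -
        obtain E E' where E: "leibniz gs scl p e d a E" "leibniz gs scl p e d b E'"
          using leibniz_exists[OF alg genr] by meson
        note pc = mod_varietyD(2,3)[OF p] and qc = mod_varietyD(2,3)[OF q0]
        show ?thesis
        proof (rule eq_matI)
          fix i j assume "i < dim_row (p a * D b + D a * q0 b)" "j < dim_col (p a * D b + D a * q0 b)"
          then have ij: "i < e" "j < d" by (auto simp: D_def qc)
          have "D (a * b) $$ (i, j) = (\<Sum>k\<in>{0..<e}. p a $$ (i, k) * v E' k j) + (\<Sum>k\<in>{0..<d}. v E i k * q0 b $$ (k, j))"
            unfolding D[OF leibniz.mult[OF E] ij]
            unfolding v_def distrib_right sum.distrib
            by (rule arg_cong2[where f = "(+)", OF sum_mult_swap(1) sum_mult_swap(2)])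
          also have "\<dots> = (\<Sum>k\<in>{0..<e}. p a $$ (i, k) * D b $$ (k, j)) + (\<Sum>k\<in>{0..<d}. D a $$ (i, k) * q0 b $$ (k, j))"
            using ij D[OF E(1)] D[OF E(2)] by simp
          also have "\<dots> = (p a * D b + D a * q0 b) $$ (i, j)"
            using ij Dc[of a] Dc[of b] pc[of a] qc[of b] by (simp add: scalar_prod_def)
          finally show "D (a * b) $$ (i, j) = (p a * D b + D a * q0 b) $$ (i, j)" .
        qed (auto simp: D_def pc qc)
      qed
      have Dscl: "D (scl c 1) = 0\<^sub>m e d" for c
      proof (rule eq_matI)
        fix i j assume "i < dim_row (0\<^sub>m e d :: 'k mat)" "j < dim_col (0\<^sub>m e d :: 'k mat)"
        then show "D (scl c 1) $$ (i, j) = 0\<^sub>m e d $$ (i, j)"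
          using D[OF leibniz.const] by (simp add: v_def)
      qed (auto simp: D_def)
      have "D 1 = 0\<^sub>m e d" using Dscl[of 1] by simp
      from derivation_inner[OF p q0 Dc Dadd Dmult Dscl this X M ext iso ch]
      obtain H where H: "\<And>a i j. i < e \<Longrightarrow> j < d \<Longrightarrow> D a $$ (i, j) =
          (\<Sum>k\<in>{0..<e}. p a $$ (i, k) * H k j) - (\<Sum>k\<in>{0..<d}. H i k * q0 a $$ (k, j))"
        by blast
      \<comment> \<open>At a generator the coefficients single out the coordinate
        \<open>y t\<close>, so a matrix \<open>H\<close> exhibiting \<open>D\<close> as inner is a
        preimage of \<open>y\<close>.\<close>
      have "y t = (\<Sum>s\<in>?I. commutator gs p q0 t s * (\<lambda>(i, j). H i j) s)" if t': "t \<in> ?J" for t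
      proof -
        obtain l i j where t: "t = (l, i, j)" "l < length gs" "i < e" "j < d" using t' by auto
        have "D (gs ! l) $$ (i, j) = (\<Sum>s\<in>?J. if s = t then y s else 0)"
          unfolding D[OF leibniz.gen[OF t(2)] t(3,4)] v_def by (intro sum.cong) (auto simp: t(1))
        also have "\<dots> = y t" using t' by simp
        finally show ?thesis
          unfolding t(1) commutator_sum[OF t(3,4)] using H[OF t(3,4), of "gs ! l"] t(1) by simp
      qed
      then show ?thesis by blast
    qed
  qed
  then obtain H where H: "\<forall>s\<in>?I. (\<lambda>q. H q s) \<in> ?G" "H q0 = H0"
    "\<forall>\<^sub>F q in ?Z. \<forall>t\<in>?J. (\<Sum>s\<in>?I. commutator gs p q t s * H q s) = 0"
    by (elim exE conjE) (rule that; assumption)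
  have "\<forall>\<^sub>F q in ?Z. \<forall>a. \<forall>i<e. \<forall>j<d.
      (\<Sum>k\<in>{0..<e}. p a $$ (i, k) * H q (k, j)) = (\<Sum>k\<in>{0..<d}. H q (i, k) * q a $$ (k, j))"
    using H(3) variety
  proof eventually_elim
    case (elim q)
    note q = elim(2)
    let ?P = "\<lambda>a. \<forall>i<e. \<forall>j<d.
      (\<Sum>k\<in>{0..<e}. p a $$ (i, k) * H q (k, j)) = (\<Sum>k\<in>{0..<d}. H q (i, k) * q a $$ (k, j))"
    \<comment> \<open>So far \<open>H q\<close> is known to intertwine the generators only; the
      elements with this property contain the scalars and are closed under sums and
      products.\<close>
    have "?P a" for a
    proof (induction a rule: generates_induct[OF genr _ _ _ _ alg])
      case (1 g)
      then obtain l where l: "l < length gs" "g = gs ! l" by (metis in_set_conv_nth)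
      show ?case
      proof (intro allI impI)
        fix i j assume ij: "i < e" "j < d"
        have "(\<Sum>s\<in>?I. commutator gs p q (l, i, j) s * H q s) = 0" using elim(1) l(1) ij by simp
        then show "(\<Sum>k\<in>{0..<e}. p g $$ (i, k) * H q (k, j)) = (\<Sum>k\<in>{0..<d}. H q (i, k) * q g $$ (k, j))"
          unfolding commutator_sum[OF ij] l(2) by simp
      qed
    next
      case (2 c)
      show ?case
      proof (intro allI impI)
        fix i j assume ij: "i < e" "j < d"
        have "(\<Sum>k\<in>{0..<e}. p (scl c 1) $$ (i, k) * H q (k, j)) = (\<Sum>k\<in>{0..<e}. if k = i then c * H q (i, j) else 0)"
          using ij by (intro sum.cong) (auto simp: mod_variety_scl_entry[OF p])
        moreover have "(\<Sum>k\<in>{0..<d}. H q (i, k) * q (scl c 1) $$ (k, j)) = (\<Sum>k\<in>{0..<d}. if k = j then c * H q (i, j) else 0)"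
          using ij by (intro sum.cong) (auto simp: mod_variety_scl_entry[OF q])
        ultimately show "(\<Sum>k\<in>{0..<e}. p (scl c 1) $$ (i, k) * H q (k, j)) = (\<Sum>k\<in>{0..<d}. H q (i, k) * q (scl c 1) $$ (k, j))"
          using ij by simp
      qed
    next
      case (3 a b)
      then show ?case
        by (simp add: mod_variety_add_entry[OF p] mod_variety_add_entry[OF q] distrib_left distrib_right sum.distrib)
    next
      case (4 a b)
      show ?case
      proof (intro allI impI)
        fix i j assume ij: "i < e" "j < d"
        have "(\<Sum>k\<in>{0..<e}. p (a * b) $$ (i, k) * H q (k, j)) =
            (\<Sum>l\<in>{0..<e}. p a $$ (i, l) * (\<Sum>k\<in>{0..<e}. p b $$ (l, k) * H q (k, j)))"
          using ij by (simp add: mod_variety_mult_entry[OF p] sum_distrib_left sum_distrib_right mult.assoc) (rule sum.swap)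
        also have "\<dots> = (\<Sum>l\<in>{0..<e}. p a $$ (i, l) * (\<Sum>k\<in>{0..<d}. H q (l, k) * q b $$ (k, j)))"
          using 4 ij by simp
        also have "\<dots> = (\<Sum>k\<in>{0..<d}. (\<Sum>l\<in>{0..<e}. p a $$ (i, l) * H q (l, k)) * q b $$ (k, j))"
          by (simp add: sum_distrib_left sum_distrib_right mult.assoc) (rule sum.swap)
        also have "\<dots> = (\<Sum>k\<in>{0..<d}. (\<Sum>l\<in>{0..<d}. H q (i, l) * q a $$ (l, k)) * q b $$ (k, j))"
          using 4 ij by simp
        also have "\<dots> = (\<Sum>k\<in>{0..<d}. H q (i, k) * q (a * b) $$ (k, j))"
          using ij by (simp add: mod_variety_mult_entry[OF q] sum_distrib_left sum_distrib_right mult.assoc) (rule sum.swap)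
        finally show "(\<Sum>k\<in>{0..<e}. p (a * b) $$ (i, k) * H q (k, j)) = (\<Sum>k\<in>{0..<d}. H q (i, k) * q (a * b) $$ (k, j))" .
      qed
    qed
    then show ?case by (rule allI)
  qed
  moreover have "(\<lambda>q. H q (i, j)) \<in> ?G" if "i < e" "j < d" for i j
    using bspec[OF H(1), of "(i, j)"] that by simp
  ultimately show ?thesis using H(2) by (intro exI[of _ H] conjI allI impI) simp_all
qed

section \<open>Openness\<close>

lemma mat_mult3_entry:
  fixes A B C :: "'k::field mat"
  assumes "A \<in> carrier_mat n n" "B \<in> carrier_mat n n" "C \<in> carrier_mat n n" "i < n" "j < n"
  shows "(A * B * C) $$ (i, j) = (\<Sum>k\<in>{0..<n}. A $$ (i, k) * (\<Sum>l\<in>{0..<n}. B $$ (k, l) * C $$ (l, j)))"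
proof -
  have "(A * B * C) $$ (i, j) = (A * (B * C)) $$ (i, j)"
    using assoc_mult_mat[OF assms(1-3)] by simp
  then show ?thesis using assms by (simp add: scalar_prod_def)
qed

lemma mat_mult_one_entry:
  fixes A B :: "'k::field mat"
  assumes "A * B = 1\<^sub>m n" "A \<in> carrier_mat n n" "B \<in> carrier_mat n n" "i < n" "j < n"
  shows "(\<Sum>k\<in>{0..<n}. A $$ (i, k) * B $$ (k, j)) = (if i = j then 1 else 0)"
proof -
  have "(\<Sum>k\<in>{0..<n}. A $$ (i, k) * B $$ (k, j)) = (A * B) $$ (i, j)"
    using assms(2-5) by (simp add: scalar_prod_def)
  then show ?thesis using assms by simp
qed

text \<open>The inclusion of the submodule, with its matrix in the first \<open>e\<close> columns of
  \<open>C\<close>, supplies the homomorphism that is to be extended to nearby modules.\<close>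

lemma (in row_block) sub_rep_hom:
  assumes ij: "i < e" "j < d"
  shows "(\<Sum>k\<in>{0..<e}. sub_rep a $$ (i, k) * C $$ (j, k)) = (\<Sum>k\<in>{0..<d}. C $$ (k, i) * q a $$ (k, j))"
proof -
  have "C * \<Gamma> a = transpose_mat (q a) * C"
  proof -
    have "C * \<Gamma> a = C * (S * (transpose_mat (q a) * C))"
      unfolding \<Gamma>_def by (simp only: assoc_mult_mat[OF S qt C])
    also have "\<dots> = (C * S) * (transpose_mat (q a) * C)"
      by (rule assoc_mult_mat[OF C S mult_carrier_mat[OF qt C], symmetric])
    also have "\<dots> = transpose_mat (q a) * C"
      unfolding CS by (rule left_mult_one_mat[OF mult_carrier_mat[OF qt C]])
    finally show ?thesis .
  qed
  then have "(C * \<Gamma> a) $$ (j, i) = (transpose_mat (q a) * C) $$ (j, i)" by simp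
  moreover have "(C * \<Gamma> a) $$ (j, i) = (\<Sum>k\<in>{0..<d}. C $$ (j, k) * \<Gamma> a $$ (k, i))"
    using ij ed C by (simp add: scalar_prod_def)
  moreover have "\<dots> = (\<Sum>k\<in>{0..<e}. C $$ (j, k) * \<Gamma> a $$ (k, i))"
    using ij by (intro sum_low) (simp add: \<Gamma>_zero)
  moreover have "\<dots> = (\<Sum>k\<in>{0..<e}. sub_rep a $$ (i, k) * C $$ (j, k))"
    using ij by (intro sum.cong) (auto simp: sub_rep_def)
  moreover have "(transpose_mat (q a) * C) $$ (j, i) = (\<Sum>k\<in>{0..<d}. C $$ (k, i) * q a $$ (k, j))"
    using ij ed C mod_varietyD(2,3)[OF q] by (auto simp: scalar_prod_def intro!: sum.cong)
  ultimately show ?thesis by simp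
qed

text \<open>On the first \<open>e\<close> columns the transpose of \<open>q a\<close> acts through
  \<open>C\<close> as the transpose of \<open>p a\<close>. Multiplication by \<open>S\<close>
  cancels \<open>C\<close> and leaves that transpose above zeros, so the sub block is
  \<open>p\<close> itself and not merely isomorphic to it.\<close>

lemma row_block_of_hom:
  assumes p: "p \<in> mod_variety scl e" and q: "q \<in> mod_variety scl d"
    and C: "C \<in> carrier_mat d d" and S: "S \<in> carrier_mat d d" and CS: "C * S = 1\<^sub>m d" and SC: "S * C = 1\<^sub>m d"
    and ed: "e \<le> d"
    and hom: "\<And>a i j. i < e \<Longrightarrow> j < d \<Longrightarrow>
      (\<Sum>k\<in>{0..<e}. p a $$ (i, k) * C $$ (j, k)) = (\<Sum>k\<in>{0..<d}. C $$ (k, i) * q a $$ (k, j))"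
  shows "row_block scl d e q C S" "row_block.sub_rep e q C S = p"
proof -
  have qt: "transpose_mat (q a) \<in> carrier_mat d d" for a using mod_varietyD(1)[OF q] by simp
  have ent: "(S * transpose_mat (q a) * C) $$ (k, i) = (if k < e then p a $$ (i, k) else 0)"
    if ki: "k < d" "i < e" for a k i
  proof -
    have "(S * transpose_mat (q a) * C) $$ (k, i) =
        (\<Sum>j\<in>{0..<d}. S $$ (k, j) * (\<Sum>l\<in>{0..<d}. transpose_mat (q a) $$ (j, l) * C $$ (l, i)))"
      using ki ed by (intro mat_mult3_entry[OF S qt C]) auto
    also have "\<dots> = (\<Sum>j\<in>{0..<d}. S $$ (k, j) * (\<Sum>l\<in>{0..<e}. p a $$ (i, l) * C $$ (j, l)))"
    proof (rule sum.cong[OF refl])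
      fix j assume j: "j \<in> {0..<d}"
      have "(\<Sum>l\<in>{0..<d}. transpose_mat (q a) $$ (j, l) * C $$ (l, i)) = (\<Sum>l\<in>{0..<d}. C $$ (l, i) * q a $$ (l, j))"
        using j mod_varietyD(2,3)[OF q] by (intro sum.cong) (auto simp: mult.commute)
      also have "\<dots> = (\<Sum>l\<in>{0..<e}. p a $$ (i, l) * C $$ (j, l))"
        using hom[OF ki(2), of j a] j by simp
      finally show "S $$ (k, j) * (\<Sum>l\<in>{0..<d}. transpose_mat (q a) $$ (j, l) * C $$ (l, i)) =
          S $$ (k, j) * (\<Sum>l\<in>{0..<e}. p a $$ (i, l) * C $$ (j, l))" by simp
    qed
    also have "\<dots> = (\<Sum>l\<in>{0..<e}. p a $$ (i, l) * (\<Sum>j\<in>{0..<d}. S $$ (k, j) * C $$ (j, l)))"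
      unfolding sum_distrib_left by (subst sum.swap) (simp add: mult_ac)
    also have "\<dots> = (\<Sum>l\<in>{0..<e}. if l = k then p a $$ (i, k) else 0)"
      using ki ed by (intro sum.cong refl) (simp add: mat_mult_one_entry[OF SC S C])
    also have "\<dots> = (if k < e then p a $$ (i, k) else 0)" by simp
    finally show ?thesis .
  qed
  show block: "row_block scl d e q C S"
    using q C S CS SC ed by unfold_locales (simp_all add: ent del: index_mult_mat)
  interpret row_block scl d e q C S by (rule block)
  show "sub_rep = p"
  proof (rule ext)
    fix a
    show "sub_rep a = p a"
      using ed mod_varietyD(2,3)[OF p] by (intro eq_matI) (auto simp: sub_rep_def \<Gamma>_def ent simp del: index_mult_mat(1))
  qed
qed

text \<open>Invariance of \<open>V\<close> under the action gives the vanishing block. Positivity of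
  \<open>e\<close> is recorded because the induction passes to dimension
  \<open>d - e\<close>.\<close>

lemma row_block_of_rsubmodule:
  fixes q :: "'a::{ring,monoid_mult} \<Rightarrow> 'k::field mat"
  assumes q: "q \<in> mod_variety scl d" and V: "rsubmodule V (row_module d q)" and nz: "V \<noteq> {0\<^sub>v d}"
  obtains C S e where "row_block scl d e q C S" "row_block.U d e S = V" "0 < e"
proof -
  interpret N: right_module "row_module d q" by (rule right_module_row_module[OF q])
  note VD = N.rsubmoduleD[OF V, unfolded row_module_simps]
  obtain C S e where C: "C \<in> carrier_mat d d" "S \<in> carrier_mat d d" "C * S = 1\<^sub>m d" "S * C = 1\<^sub>m d" "e \<le> d"
    and Veq: "V = {v \<in> carrier_vec d. \<forall>k. e \<le> k \<longrightarrow> k < d \<longrightarrow> (S *\<^sub>v v) $ k = 0}"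
    using subspace_basis[OF VD(1,2,3) rsubmodule_row_module_smult[OF q V]] by blast
  have qt: "transpose_mat (q a) \<in> carrier_mat d d" for a using mod_varietyD(1)[OF q] by simp
  have block: "row_block scl d e q C S"
  proof
    fix i k a assume ik: "i < e" "e \<le> k" "k < d"
    then have i: "i < d" by simp
    let ?u = "unit_vec d i"
    have "S *\<^sub>v (C *\<^sub>v ?u) = ?u"
      using assoc_mult_mat_vec[OF C(2,1), of ?u] C(4) by simp
    then have "C *\<^sub>v ?u \<in> V"
      unfolding Veq using C(1) ik by (auto simp del: index_mult_mat_vec)
    then have "transpose_mat (q a) *\<^sub>v (C *\<^sub>v ?u) \<in> V" by (rule VD(4))
    then have "(S *\<^sub>v (transpose_mat (q a) *\<^sub>v (C *\<^sub>v ?u))) $ k = 0"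
      unfolding Veq using ik by blast
    also have "S *\<^sub>v (transpose_mat (q a) *\<^sub>v (C *\<^sub>v ?u)) = (S * transpose_mat (q a) * C) *\<^sub>v ?u"
      using assoc_mult_mat_vec[OF mult_carrier_mat[OF C(2) qt] C(1), of ?u a]
        assoc_mult_mat_vec[OF C(2) qt mult_mat_vec_carrier[OF C(1)], of ?u a] by simp
    also have "\<dots> = col (S * transpose_mat (q a) * C) i"
      using mult_mat_vec_unit[OF mult_carrier_mat[OF mult_carrier_mat[OF C(2) qt] C(1)] i] .
    also have "\<dots> $ k = (S * transpose_mat (q a) * C) $$ (k, i)"
      using C(1,2) ik i by simp
    finally show "(S * transpose_mat (q a) * C) $$ (k, i) = 0" .
  qed (use q C in auto)
  interpret row_block scl d e q C S by (rule block)
  have U: "U = V" unfolding U_def Veq ..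
  have "0 < e"
  proof (rule ccontr)
    assume "\<not> 0 < e"
    have "v = 0\<^sub>v d" if v: "v \<in> V" for v
    proof -
      have vc: "v \<in> carrier_vec d" using VD(1) v by blast
      have "S *\<^sub>v v = 0\<^sub>v d"
        using v \<open>\<not> 0 < e\<close> unfolding Veq by (intro eq_vecI) (auto simp del: index_mult_mat_vec)
      then show ?thesis using C_S_vec[OF vc] C(1) by (auto intro!: eq_vecI simp: scalar_prod_def)
    qed
    then show False using nz VD(2) by blast
  qed
  then show ?thesis using that block U by blast
qed

lemma filtered_variety_iff:
  assumes "\<And>i. i \<in> {1..t} \<Longrightarrow> right_module (M i)"
  shows "m \<in> filtered_variety scl d M t \<longleftrightarrow> m \<in> mod_variety scl d \<and>
    chain (row_module d m) M {1..t} {\<zero>\<^bsub>row_module d m\<^esub>} (carrier (row_module d m))"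
proof (cases "m \<in> mod_variety scl d")
  case True
  from filtered_by_iff_chain[OF right_module_row_module[OF True] assms] show ?thesis
    using True by (simp add: filtered_variety_def)
qed (simp add: filtered_variety_def)

text \<open>Strong induction that includes dimension 0, since the cokernel may vanish. Only the
  bottom factor is deformed by hand; the hypothesis in dimension \<open>d - e\<close> takes care of
  all the others at once.\<close>

lemma filtered_variety_open:
  fixes scl :: "'k::field \<Rightarrow> 'a::{ring,monoid_mult} \<Rightarrow> 'a"
    and M :: "nat \<Rightarrow> ('a, 'm) module"
  assumes alg: "k_algebra scl" and gen: "generates_algebra scl (set gs)"
    and M: "\<And>i. i \<in> {1..t} \<Longrightarrow> right_module (M i)"
    and ext: "\<And>i j. i \<in> {1..t} \<Longrightarrow> j \<in> {1..t} \<Longrightarrow> i \<le> j \<Longrightarrow> trivial_group (Ext1 (M i) (M j))"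
  shows "openin (mod_topology scl gs d) (filtered_variety scl d M t)"
proof (induction d rule: less_induct)
  case (less d)
  have iff: "q \<in> filtered_variety scl n M t \<longleftrightarrow> q \<in> mod_variety scl n \<and>
      chain (row_module n q) M {1..t} {\<zero>\<^bsub>row_module n q\<^esub>} (carrier (row_module n q))" for q n
    by (rule filtered_variety_iff) (rule M)
  have "\<forall>\<^sub>F q in zar scl gs d q0. q \<in> filtered_variety scl d M t"
    if q0F: "q0 \<in> filtered_variety scl d M t" for q0
  proof (cases "d = 0")
    case True
    have "q \<in> filtered_variety scl d M t" if q: "q \<in> mod_variety scl d" for q
    proof -
      have "carrier (row_module d q) = {\<zero>\<^bsub>row_module d q\<^esub>}"
        unfolding row_module_simps True by auto
      moreover have "chain (row_module d q) M {1..t} {\<zero>\<^bsub>row_module d q\<^esub>} {\<zero>\<^bsub>row_module d q\<^esub>}"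
        by (intro chain.base right_module.rsubmodule_zero right_module_row_module[OF q])
      ultimately show ?thesis using q by (simp add: iff)
    qed
    then show ?thesis using eventually_zar_variety by (rule eventually_mono[rotated])
  next
    case False
    let ?N0 = "row_module d q0" and ?G = "germs scl gs d q0" and ?Z = "zar scl gs d q0"
    have q0: "q0 \<in> mod_variety scl d" and ch0: "chain ?N0 M {1..t} {\<zero>\<^bsub>?N0\<^esub>} (carrier ?N0)"
      using q0F by (simp_all add: iff)
    interpret germ_ring ?G ?Z q0 by (rule germ_ring_germs)
    have N0: "right_module ?N0" by (rule right_module_row_module[OF q0])
    have "unit_vec d 0 \<noteq> (0\<^sub>v d :: 'k vec)" using False by simp
    then have "carrier ?N0 \<noteq> {\<zero>\<^bsub>?N0\<^esub>}"
      unfolding row_module_simps using unit_vec_carrier by blast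
    then obtain j V where j: "j \<in> {1..t}" and V: "V \<noteq> {\<zero>\<^bsub>?N0\<^esub>}" "factor ?N0 V {\<zero>\<^bsub>?N0\<^esub>} (M j)"
      and chV: "chain ?N0 M {i \<in> {1..t}. j \<le> i} V (carrier ?N0)"
      and chN: "chain ?N0 M {i \<in> {1..t}. j \<le> i} {\<zero>\<^bsub>?N0\<^esub>} (carrier ?N0)"
      using chain_bottom_factor[where M = M and J = "{1..t}", OF N0 M ext ch0] by blast
    have Vsub: "rsubmodule V ?N0" using V(2) by (simp add: factor_def)
    obtain C S e where block: "row_block scl d e q0 C S" and UV: "row_block.U d e S = V" and e: "0 < e"
      using row_block_of_rsubmodule[OF q0 Vsub] V(1)[unfolded row_module_simps] by blast
    interpret B: row_block scl d e q0 C S by (rule block)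
    \<comment> \<open>The coordinates chosen at \<open>q0\<close> fix one representation of
      \<open>M\<^sub>j\<close>, which does not vary with \<open>q\<close>.\<close>
    define p where "p = B.sub_rep"
    have p: "p \<in> mod_variety scl e" unfolding p_def by (rule B.sub_rep_variety)
    have P: "right_module (row_module e p)" by (rule right_module_row_module[OF p])
    have iso: "factor (row_module e p) (carrier (row_module e p)) {\<zero>\<^bsub>row_module e p\<^esub>} (M j)"
      using factor_cancel[OF N0 P M[OF j] _ V(2)] B.factor_U unfolding UV p_def by blast
    define H0 where "H0 = (\<lambda>(i, k). C $$ (k, i))"
    have "\<exists>H. (\<forall>i<e. \<forall>j<d. (\<lambda>q. H q (i, j)) \<in> ?G) \<and> H q0 = H0 \<and>
        (\<forall>\<^sub>F q in ?Z. \<forall>a. \<forall>i<e. \<forall>j<d.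
          (\<Sum>k\<in>{0..<e}. p a $$ (i, k) * H q (k, j)) = (\<Sum>k\<in>{0..<d}. H q (i, k) * q a $$ (k, j)))"
    proof (rule hom_extends[OF alg gen p q0 M[OF j] _ _ iso chN])
      show "right_module (M i)" "trivial_group (Ext1 (M j) (M i))" if "i \<in> {i \<in> {1..t}. j \<le> i}" for i
        using that M ext j by auto
      show "(\<Sum>k\<in>{0..<e}. p a $$ (i, k) * H0 (k, l)) = (\<Sum>k\<in>{0..<d}. H0 (i, k) * q0 a $$ (k, l))"
        if "i < e" "l < d" for a i l
        using B.sub_rep_hom[OF that] by (simp add: H0_def p_def)
    qed
    then obtain H where HG: "\<forall>i<e. \<forall>j<d. (\<lambda>q. H q (i, j)) \<in> ?G" and Hq0: "H q0 = H0"
      and Hom: "\<forall>\<^sub>F q in ?Z. \<forall>a. \<forall>i<e. \<forall>j<d.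
          (\<Sum>k\<in>{0..<e}. p a $$ (i, k) * H q (k, j)) = (\<Sum>k\<in>{0..<d}. H q (i, k) * q a $$ (k, j))"
      by (elim exE conjE) (rule that; assumption)
    \<comment> \<open>The first \<open>e\<close> columns follow the extended homomorphism, the
      others keep the complement chosen at \<open>q0\<close>. At \<open>q0\<close> this is
      \<open>C\<close>, so it stays invertible nearby, and that includes injectivity of the
      homomorphism.\<close>
    define C' where "C' q = mat d d (\<lambda>(r, s). if s < e then H q (s, r) else C $$ (r, s))" for q
    define S' where "S' q = inverse (det (C' q)) \<cdot>\<^sub>m adj_mat (C' q)" for q
    have C'c: "C' q \<in> carrier_mat d d" for q by (simp add: C'_def)
    have C'G: "(\<lambda>q. C' q $$ (r, s)) \<in> ?G" if "r < d" "s < d" for r s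
      using that HG by (cases "s < e") (auto simp: C'_def const)
    have C'0: "C' q0 = C"
      using B.C by (intro eq_matI) (auto simp: C'_def Hq0 H0_def)
    have detG: "(\<lambda>q. det (C' q)) \<in> ?G" by (rule det[OF C'c C'G])
    have "det C * det S = 1"
      using det_mult[OF B.C B.S] B.CS by simp
    then have det0: "det (C' q0) \<noteq> 0" unfolding C'0 by auto
    have S'G: "(\<lambda>q. S' q $$ (r, s)) \<in> ?G" if "r < d" "s < d" for r s
    proof -
      have "(\<lambda>q. inverse (det (C' q)) * adj_mat (C' q) $$ (r, s)) \<in> ?G"
        by (intro mult inverse detG det0 adj_mat[OF C'c C'G] that)
      then show ?thesis
        using that carrier_matD[OF Determinant.adj_mat(1)[OF C'c]] by (simp add: S'_def)
    qed
    have S'0: "S' q0 = S"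
    proof -
      note S'' = det_nonzero_inverse[OF C'c det0, folded S'_def, unfolded C'0]
      have "S' q0 = S' q0 * (C * S)" using S''(1) B.CS by simp
      also have "\<dots> = (S' q0 * C) * S" by (rule assoc_mult_mat[OF S''(1) B.C B.S, symmetric])
      also have "\<dots> = S" using S''(3) B.S by simp
      finally show ?thesis .
    qed
    define r where "r q = row_block.quot_rep d e q (C' q) (S' q)" for q
    have near: "row_block scl d e q (C' q) (S' q) \<and> row_block.sub_rep e q (C' q) (S' q) = p"
      if q: "q \<in> mod_variety scl d" and dq: "det (C' q) \<noteq> 0"
        and Hq: "\<forall>a. \<forall>i<e. \<forall>j<d.
          (\<Sum>k\<in>{0..<e}. p a $$ (i, k) * H q (k, j)) = (\<Sum>k\<in>{0..<d}. H q (i, k) * q a $$ (k, j))" for q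
    proof -
      note S'' = det_nonzero_inverse[OF C'c dq, folded S'_def]
      have "(\<Sum>k\<in>{0..<e}. p a $$ (i, k) * C' q $$ (l, k)) = (\<Sum>k\<in>{0..<d}. C' q $$ (k, i) * q a $$ (k, l))"
        if "i < e" "l < d" for a i l
        using Hq that B.ed by (simp add: C'_def)
      from row_block_of_hom[OF p q C'c S'' B.ed this] show ?thesis by blast
    qed
    \<comment> \<open>The filtration above \<open>V\<close> is carried to the cokernel, so the
      induction hypothesis supplies a neighbourhood of \<open>r q0\<close>.\<close>
    have "r q0 \<in> filtered_variety scl (d - e) M t"
    proof -
      let ?Q = "row_module (d - e) (r q0)"
      have rq0: "r q0 = B.quot_rep" by (simp add: r_def C'0 S'0)
      have Q: "right_module ?Q" unfolding rq0 by (rule right_module_row_module[OF B.quot_rep_variety])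
      have hom: "hom_on ?N0 (carrier ?N0) ?Q B.quot_map" unfolding rq0 by (rule B.quot_map_hom)
      have ker: "x \<in> V \<longleftrightarrow> B.quot_map x = \<zero>\<^bsub>?Q\<^esub>" if "x \<in> carrier ?N0" for x
        using B.quot_map_kernel[OF that] unfolding UV rq0 by blast
      have "chain ?Q M {i \<in> {1..t}. j \<le> i} (B.quot_map ` V) (B.quot_map ` carrier ?N0)"
        by (rule chain_image[where M = M, OF N0 Q _ hom _ chV]) (auto simp: ker intro: M)
      moreover have "B.quot_map ` V = {\<zero>\<^bsub>?Q\<^esub>}"
        using ker right_module.rsubmoduleD(1,2)[OF N0 Vsub] by force
      moreover have "B.quot_map ` carrier ?N0 = carrier ?Q" unfolding rq0 by (rule B.quot_map_onto)
      ultimately have "chain ?Q M {i \<in> {1..t}. j \<le> i} {\<zero>\<^bsub>?Q\<^esub>} (carrier ?Q)" by simp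
      then have "chain ?Q M {1..t} {\<zero>\<^bsub>?Q\<^esub>} (carrier ?Q)" by (rule chain_mono) auto
      then show ?thesis using B.quot_rep_variety by (simp add: iff rq0)
    qed
    moreover have "openin (mod_topology scl gs (d - e)) (filtered_variety scl (d - e) M t)"
      using less.IH[of "d - e"] e False by simp
    ultimately have "\<forall>\<^sub>F m in zar scl gs (d - e) (r q0). m \<in> filtered_variety scl (d - e) M t"
      unfolding openin_mod_topology_iff by blast
    then obtain f where f: "f \<in> reg scl gs (d - e)" "f (r q0) \<noteq> 0"
      "\<And>m. m \<in> mod_variety scl (d - e) \<Longrightarrow> f m \<noteq> 0 \<Longrightarrow> m \<in> filtered_variety scl (d - e) M t"
      unfolding eventually_zar by blast
    then obtain R where R: "R \<in> polyfuns (length gs) (d - e)"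
      "\<And>m. m \<in> mod_variety scl (d - e) \<Longrightarrow> f m = R (map m gs)"
      unfolding reg_def by blast
    \<comment> \<open>The matrices of \<open>r q\<close> at the generators, spelled out because the
      defining equation of \<open>quot_rep\<close> is available only where the block condition
      holds. Their entries are germs, so a condition on \<open>r q\<close> becomes one on
      \<open>q\<close>.\<close>
    define X where "X q = map (\<lambda>a. mat (d - e) (d - e) (\<lambda>(i, k). (S' q * transpose_mat (q a) * C' q) $$ (k + e, i + e))) gs" for q
    have X: "X q = map (r q) gs" if "row_block scl d e q (C' q) (S' q)" for q
      by (simp add: X_def r_def row_block.quot_rep_def[OF that] row_block.\<Gamma>_def[OF that])
    have "(\<lambda>q. R (X q)) \<in> ?G"
    proof (rule polyfun_comp[OF R(1)])
      fix l i k assume lik: "l < length gs" "i < d - e" "k < d - e"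
      let ?a = "gs ! l"
      define h where "h q = (\<Sum>u\<in>{0..<d}. S' q $$ (k + e, u) * (\<Sum>v\<in>{0..<d}. q ?a $$ (v, u) * C' q $$ (v, i + e)))" for q
      have hG: "h \<in> ?G"
        unfolding h_def[abs_def]
        using lik by (intro sum mult S'G C'G reg_in_germs[OF reg_entry[OF alg gen]]) auto
      have Xh: "(X q ! l) $$ (i, k) = h q" if q: "q \<in> mod_variety scl d" for q
      proof -
        have qt: "transpose_mat (q ?a) \<in> carrier_mat d d" using mod_varietyD(1)[OF q] by simp
        have S'c: "S' q \<in> carrier_mat d d" using Determinant.adj_mat(1)[OF C'c] by (simp add: S'_def)
        have "(X q ! l) $$ (i, k) = (S' q * transpose_mat (q ?a) * C' q) $$ (k + e, i + e)"
          using lik by (simp add: X_def)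
        also have "\<dots> = h q"
          unfolding h_def using lik mod_varietyD(2,3)[OF q]
          by (subst mat_mult3_entry[OF S'c qt C'c]) auto
        finally show ?thesis .
      qed
      show "(\<lambda>q. (X q ! l) $$ (i, k)) \<in> ?G"
        by (rule germs_cong[OF hG Xh q0])
    qed
    moreover have "R (X q0) \<noteq> 0"
    proof -
      have b0: "row_block scl d e q0 (C' q0) (S' q0)" using block by (simp add: C'0 S'0)
      have "r q0 \<in> mod_variety scl (d - e)" unfolding r_def by (rule row_block.quot_rep_variety[OF b0])
      then show ?thesis using R(2) f(2) X[OF b0] by simp
    qed
    ultimately have "\<forall>\<^sub>F q in ?Z. R (X q) \<noteq> 0" by (rule nonzero)
    moreover have "\<forall>\<^sub>F q in ?Z. det (C' q) \<noteq> 0" using detG det0 by (rule nonzero)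
    moreover have "\<forall>\<^sub>F q in ?Z. q \<in> mod_variety scl d" by (rule eventually_zar_variety)
    ultimately show ?thesis
      using Hom
    proof eventually_elim
      case (elim q)
      note q = elim(3)
      have bq: "row_block scl d e q (C' q) (S' q)" and sub: "row_block.sub_rep e q (C' q) (S' q) = p"
        using near[OF q elim(2,4)] by auto
      interpret Bq: row_block scl d e q "C' q" "S' q" by (rule bq)
      let ?N = "row_module d q" and ?Q = "row_module (d - e) (r q)"
      have rq: "r q = Bq.quot_rep" by (simp add: r_def)
      have rv: "r q \<in> mod_variety scl (d - e)" unfolding rq by (rule Bq.quot_rep_variety)
      have "f (r q) \<noteq> 0" using elim(1) R(2)[OF rv] X[OF bq] by simp
      then have "r q \<in> filtered_variety scl (d - e) M t" using f(3) rv by blast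
      then have chQ: "chain ?Q M {1..t} {\<zero>\<^bsub>?Q\<^esub>} (carrier ?Q)" by (simp add: iff)
      have hom: "hom_on ?N (carrier ?N) ?Q Bq.quot_map" unfolding rq by (rule Bq.quot_map_hom)
      have onto: "Bq.quot_map ` carrier ?N = carrier ?Q" unfolding rq by (rule Bq.quot_map_onto)
      have "chain ?N M {1..t} {x \<in> carrier ?N. Bq.quot_map x \<in> {\<zero>\<^bsub>?Q\<^esub>}} {x \<in> carrier ?N. Bq.quot_map x \<in> carrier ?Q}"
        by (rule chain_preimage[OF Bq.right_module_N right_module_row_module[OF rv] hom onto chQ])
      moreover have "{x \<in> carrier ?N. Bq.quot_map x \<in> {\<zero>\<^bsub>?Q\<^esub>}} = Bq.U"
        using Bq.quot_map_kernel unfolding rq by (auto simp: Bq.U_def row_module_simps)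
      moreover have "{x \<in> carrier ?N. Bq.quot_map x \<in> carrier ?Q} = carrier ?N"
        using onto by blast
      ultimately have chU: "chain ?N M {1..t} Bq.U (carrier ?N)" by simp
      \<comment> \<open>The sub block at \<open>q\<close> is again \<open>p\<close>, so the bottom
        factor is the same \<open>M\<^sub>j\<close>.\<close>
      have "factor ?N Bq.U {\<zero>\<^bsub>?N\<^esub>} (M j)"
        using factor_trans[OF Bq.factor_U] iso unfolding sub by blast
      from chain_prepend[where M = M, OF chU j this] show ?case using q by (simp add: iff)
    qed
  qed
  then show ?case
    unfolding openin_mod_topology_iff by (auto simp: filtered_variety_def)
qed

theorem corollary1p5:
  fixes scl :: "'k::alg_closed_field \<Rightarrow> 'a::{ring,monoid_mult} \<Rightarrow> 'a"
    and gs :: "'a list"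
    and M :: "nat \<Rightarrow> ('a, 'm) module"
    and t :: nat
  assumes "k_algebra scl"
    and "generates_algebra scl (set gs)"
    and "\<And>i. i \<in> {1..t} \<Longrightarrow> right_module (M i)"
    and "\<And>i j. i \<in> {1..t} \<Longrightarrow> j \<in> {1..t} \<Longrightarrow> i \<le> j \<Longrightarrow> trivial_group (Ext1 (M i) (M j))"
  shows "\<forall>d\<ge>1. openin (mod_topology scl gs d) (filtered_variety scl d M t)"
proof (intro allI impI)
  fix d :: nat
  show "openin (mod_topology scl gs d) (filtered_variety scl d M t)"
    by (rule filtered_variety_open) (fact assms)+
qed

end
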